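(* Let $M$ be a smooth $n$-dimensional manifold and let $L$ be an $n$-dimensional smooth submanifold of $T^*M$ on which the Liouville one-form $\theta$ vanishes identically (that is, $\theta(x)[\zeta]=0$ for every $x\in L$ and $\zeta\in T_xL$). Then the intersection of $L$ with the zero-section of $T^*M$ is a smooth submanifold $R$, and if $L$ is a closed subset of $T^*M$ then $L=N^*R$.
   Context: Manifolds and submanifolds have no boundary. $\tau^*:T^*M\to M$ is the projection and the Liouville one-form is $\theta(x)[\zeta]=x[D\tau^*(x)[\zeta]]$ for $x\in T^*M$, $\zeta\in T_xT^*M$. The zero-section of $T^*M$ is identified with $M$, so that $R$ is regarded as a submanifold of $M$; its connected components are allowed to have different dimensions. The conormal bundle of a submanifold $R\subset M$ is $N^*R=\{x\in T^*M:\tau^*(x)\in R,\ x[\xi]=0\ \forall\xi\in T_{\tau^*(x)}R\}$. *)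

theory Defs
  imports "HOL-Analysis.Analysis"
begin

section \<open>Smooth maps between open subsets of normed spaces\<close>

primrec cont_diff_on ::
    "'a::real_normed_vector set \<Rightarrow> nat \<Rightarrow> ('a \<Rightarrow> 'b::real_normed_vector) \<Rightarrow> bool" where
  "cont_diff_on S 0 = (\<lambda>f. continuous_on S f)"
| "cont_diff_on S (Suc k) = (\<lambda>f. (\<forall>x\<in>S. f differentiable (at x)) \<and>
     (\<forall>v. cont_diff_on S k (\<lambda>x. frechet_derivative f (at x) v)))"

text \<open>For open \<open>S\<close> in a finite-dimensional space, \<^term>\<open>cont_diff_on S k f\<close> says that \<open>f\<close> is of
  class \<open>C\<^sup>k\<close> on \<open>S\<close>; only such \<open>S\<close> occur below.\<close>

definition smooth_on :: "'a::real_normed_vector set \<Rightarrow> ('a \<Rightarrow> 'b::real_normed_vector) \<Rightarrow> bool" where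
  "smooth_on S f \<longleftrightarrow> (\<forall>k. cont_diff_on S k f)"


section \<open>Smooth manifolds\<close>

text \<open>A chart is a pair \<open>(U, \<phi>)\<close> of its domain and its coordinate map; the values of \<open>\<phi>\<close> outside
  \<open>U\<close> are irrelevant. The model space \<open>'e\<close> plays the role of \<open>\<real>\<^sup>n\<close>.\<close>

type_synonym ('m, 'e) chart = "'m set \<times> ('m \<Rightarrow> 'e)"

definition is_chart :: "'m topology \<Rightarrow> ('m, 'e::real_normed_vector) chart \<Rightarrow> bool" where
  "is_chart X c \<longleftrightarrow> openin X (fst c) \<and> open (snd c ` fst c) \<and>
     homeomorphic_map (subtopology X (fst c)) (top_of_set (snd c ` fst c)) (snd c)"

definition transition :: "('m, 'e) chart \<Rightarrow> ('m, 'e) chart \<Rightarrow> 'e \<Rightarrow> 'e" where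
  "transition c d = snd d \<circ> inv_into (fst c) (snd c)"

definition compatible ::
    "('m, 'e::real_normed_vector) chart \<Rightarrow> ('m, 'e) chart \<Rightarrow> bool" where
  "compatible c d \<longleftrightarrow> smooth_on (snd c ` (fst c \<inter> fst d)) (transition c d) \<and>
     smooth_on (snd d ` (fst c \<inter> fst d)) (transition d c)"

definition maximal_atlas ::
    "'m topology \<Rightarrow> ('m, 'e::real_normed_vector) chart set \<Rightarrow> ('m, 'e) chart set" where
  "maximal_atlas X A = {c. is_chart X c \<and> (\<forall>d\<in>A. compatible c d)}"

text \<open>The smooth structure \<open>A\<close> is a maximal atlas: the last equation says that \<open>A\<close> consists of
  pairwise compatible charts and contains every chart that is compatible with all of them. The
  dimension of the manifold is the dimension of the model space, which the first conjunct requires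
  to be \<open>n\<close>. The class \<^class>\<open>euclidean_space\<close> is not used for the model space since
  it would exclude \<open>n = 0\<close>. Instead, model spaces are inner product spaces of finite dimension;
  these belong to \<^class>\<open>banach\<close> and \<^class>\<open>heine_borel\<close>, so that adding these
  sorts is no restriction.\<close>

definition smooth_manifold ::
    "nat \<Rightarrow> 'm topology \<Rightarrow> ('m, 'e::real_normed_vector) chart set \<Rightarrow> bool" where
  "smooth_manifold n X A \<longleftrightarrow>
     (\<exists>B::'e set. finite B \<and> independent B \<and> span B = UNIV \<and> card B = n) \<and>
     Hausdorff_space X \<and> second_countable X \<and>
     \<Union> (fst ` A) = topspace X \<and> A = maximal_atlas X A"

definition charts_at :: "('m, 'e) chart set \<Rightarrow> 'm \<Rightarrow> ('m, 'e) chart set" where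
  "charts_at A p = {c \<in> A. p \<in> fst c}"


section \<open>Tangent vectors, differentials, submanifolds\<close>

text \<open>A tangent vector at \<open>p\<close> is the family of its coordinate representations in the charts at
  \<open>p\<close>, which transform under the derivatives of the transition maps. It is set to zero at all other
  charts, so that equality of tangent vectors is equality of functions. The vector space operations
  are the pointwise ones.\<close>

definition tangent_space ::
    "('m, 'e::real_normed_vector) chart set \<Rightarrow> 'm \<Rightarrow> (('m, 'e) chart \<Rightarrow> 'e) set" where
  "tangent_space A p = {v. (\<forall>c. c \<notin> charts_at A p \<longrightarrow> v c = 0) \<and>
     (\<forall>c\<in>charts_at A p. \<forall>d\<in>charts_at A p.
        v d = frechet_derivative (transition c d) (at (snd c p)) (v c))}"

text \<open>The differential at \<open>p\<close> of a map \<open>f\<close> between manifolds with smooth structures \<open>A\<close> and \<open>B\<close>.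
  For \<open>f\<close> smooth the result does not depend on the choice of the chart \<open>c\<close>.\<close>

definition differential ::
    "('m, 'e::real_normed_vector) chart set \<Rightarrow> ('l, 'f::real_normed_vector) chart set \<Rightarrow>
     ('m \<Rightarrow> 'l) \<Rightarrow> 'm \<Rightarrow> (('m, 'e) chart \<Rightarrow> 'e) \<Rightarrow> (('l, 'f) chart \<Rightarrow> 'f)" where
  "differential A B f p v = (\<lambda>d. if d \<in> charts_at B (f p)
     then (let c = (SOME c. c \<in> charts_at A p) in
           frechet_derivative (snd d \<circ> f \<circ> inv_into (fst c) (snd c)) (at (snd c p)) (v c))
     else 0)"

text \<open>In the slice chart \<open>c\<close> at \<open>p\<close>, the set \<open>S\<close> corresponds to the linear subspace \<open>F\<close>.\<close>

definition slice_chart ::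
    "('m, 'e::real_normed_vector) chart set \<Rightarrow> 'm set \<Rightarrow> 'm \<Rightarrow> ('m, 'e) chart \<Rightarrow> 'e set \<Rightarrow> bool" where
  "slice_chart A S p c F \<longleftrightarrow> c \<in> charts_at A p \<and> subspace F \<and>
     snd c ` (fst c \<inter> S) = snd c ` fst c \<inter> F"

text \<open>Submanifolds are embedded, but need not be closed. In \<open>submanifold\<close> the dimension of \<open>F\<close> may
  depend on the point \<open>p\<close>; it is constant on connected components.\<close>

definition submanifold :: "('m, 'e::real_normed_vector) chart set \<Rightarrow> 'm set \<Rightarrow> bool" where
  "submanifold A S \<longleftrightarrow> (\<forall>p\<in>S. \<exists>c F. slice_chart A S p c F)"

definition submanifold_of_dim ::
    "nat \<Rightarrow> ('m, 'e::real_normed_vector) chart set \<Rightarrow> 'm set \<Rightarrow> bool" where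
  "submanifold_of_dim k A S \<longleftrightarrow> (\<forall>p\<in>S. \<exists>c F. slice_chart A S p c F \<and> dim F = k)"

text \<open>\<open>T\<^sub>pS\<close> as a subspace of the tangent space of the ambient manifold.\<close>

definition sub_tangent_space ::
    "('m, 'e::real_normed_vector) chart set \<Rightarrow> 'm set \<Rightarrow> 'm \<Rightarrow> (('m, 'e) chart \<Rightarrow> 'e) set" where
  "sub_tangent_space A S p =
     {v \<in> tangent_space A p. \<exists>c F. slice_chart A S p c F \<and> v c \<in> F}"


section \<open>The cotangent bundle\<close>

text \<open>A covector at \<open>p\<close> is a linear functional on the tangent space at \<open>p\<close>, extended by zero outside
  this space.\<close>

type_synonym ('m, 'e) covector = "(('m, 'e) chart \<Rightarrow> 'e) \<Rightarrow> real"

definition cotangent_space ::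
    "('m, 'e::real_normed_vector) chart set \<Rightarrow> 'm \<Rightarrow> ('m, 'e) covector set" where
  "cotangent_space A p = {\<xi>. (\<forall>v. v \<notin> tangent_space A p \<longrightarrow> \<xi> v = 0) \<and>
     (\<forall>v\<in>tangent_space A p. \<forall>w\<in>tangent_space A p. \<xi> (\<lambda>c. v c + w c) = \<xi> v + \<xi> w) \<and>
     (\<forall>a. \<forall>v\<in>tangent_space A p. \<xi> (\<lambda>c. a *\<^sub>R v c) = a * \<xi> v)}"

definition cotangent_bundle ::
    "'m topology \<Rightarrow> ('m, 'e::real_normed_vector) chart set \<Rightarrow> ('m \<times> ('m, 'e) covector) set" where
  "cotangent_bundle X A = Sigma (topspace X) (cotangent_space A)"

abbreviation cotangent_proj :: "'m \<times> ('m, 'e) covector \<Rightarrow> 'm" where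
  "cotangent_proj \<equiv> fst"

text \<open>The chart of the cotangent bundle induced by a chart \<open>c\<close> of the base: the covector \<open>\<xi>\<close> has
  as coordinates the vector \<open>g\<close> representing it with respect to the inner product of the model
  space; for \<open>\<real>\<^sup>n\<close> this is \<open>\<xi> = (\<Sum>i. g\<^sub>i dx\<^sub>i)\<close>.\<close>

definition cotangent_chart ::
    "'m topology \<Rightarrow> ('m, 'e::real_inner) chart set \<Rightarrow> ('m, 'e) chart \<Rightarrow>
     ('m \<times> ('m, 'e) covector, 'e \<times> 'e) chart" where
  "cotangent_chart X A c =
     ({x \<in> cotangent_bundle X A. fst x \<in> fst c},
      \<lambda>(p, \<xi>). (snd c p, THE g. \<forall>v\<in>tangent_space A p. \<xi> v = inner g (v c)))"

definition cotangent_topology ::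
    "'m topology \<Rightarrow> ('m, 'e::real_inner) chart set \<Rightarrow> ('m \<times> ('m, 'e) covector) topology" where
  "cotangent_topology X A = topology_generated_by
     {{x \<in> fst (cotangent_chart X A c). snd (cotangent_chart X A c) x \<in> W} | c W.
        c \<in> A \<and> open W}"

definition cotangent_structure ::
    "'m topology \<Rightarrow> ('m, 'e::real_inner) chart set \<Rightarrow>
     ('m \<times> ('m, 'e) covector, 'e \<times> 'e) chart set" where
  "cotangent_structure X A = maximal_atlas (cotangent_topology X A) (cotangent_chart X A ` A)"

definition liouville_form ::
    "'m topology \<Rightarrow> ('m, 'e::real_inner) chart set \<Rightarrow> 'm \<times> ('m, 'e) covector \<Rightarrow>
     (('m \<times> ('m, 'e) covector, 'e \<times> 'e) chart \<Rightarrow> 'e \<times> 'e) \<Rightarrow> real" where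
  "liouville_form X A x \<zeta> =
     snd x (differential (cotangent_structure X A) A cotangent_proj x \<zeta>)"

definition zero_section ::
    "'m topology \<Rightarrow> ('m \<times> ('m, 'e) covector) set" where
  "zero_section X = {(p, \<lambda>v. 0) | p. p \<in> topspace X}"

definition conormal_bundle ::
    "'m topology \<Rightarrow> ('m, 'e::real_normed_vector) chart set \<Rightarrow> 'm set \<Rightarrow>
     ('m \<times> ('m, 'e) covector) set" where
  "conormal_bundle X A R = {x \<in> cotangent_bundle X A. cotangent_proj x \<in> R \<and>
     (\<forall>v\<in>sub_tangent_space A R (cotangent_proj x). snd x v = 0)}"

end

theory Submission
  imports Defs
begin

text \<open>
  Let \<open>\<omega>\<close> be the canonical symplectic form, which is \<open>d\<theta>\<close> up to sign. If \<open>\<theta>\<close> vanishes on \<open>L\<close>, then so does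
  \<open>\<omega>\<close>, and having half the dimension, \<open>L\<close> is Lagrangian: a vector that is \<open>\<omega>\<close>-orthogonal to the tangent
  space of \<open>L\<close> is tangent to \<open>L\<close>. The Liouville vector field, which generates the fibrewise dilations, is
  dual to \<open>\<theta>\<close> under \<open>\<omega>\<close>. So it is \<open>\<omega>\<close>-orthogonal to \<open>L\<close> and therefore tangent to it, and \<open>L\<close> is locally
  invariant under dilations (\<open>dilation_local\<close>).

  Near a zero covector in \<open>L\<close> there are neighbourhoods that are star-shaped in the fibres, and in these
  the invariance extends to the factor \<open>0\<close>: the projection \<open>(q, y) \<mapsto> (q, 0)\<close> maps \<open>L\<close> into itself
  (\<open>dilation_box\<close>). It is a smooth retraction of \<open>L\<close> onto its intersection with the zero-section, and
  its derivative splits the tangent space of \<open>L\<close> as \<open>H \<times> H'\<close> with \<open>H\<close> horizontal, \<open>H'\<close> vertical. As this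
  space is Lagrangian, \<open>H'\<close> is the annihilator of \<open>H\<close>. Images of smooth retractions are submanifolds, so
  \<open>R\<close> is one, with tangent space \<open>H\<close>; the slice chart is constructed in \<open>straightening\<close> and
  \<open>zero_section_slice\<close>.

  If \<open>L\<close> is closed, local invariance under dilations gives invariance under all dilations with factors
  \<open>s \<ge> 0\<close>, by connectedness (\<open>L_conic\<close>). So \<open>L\<close> contains the ray from zero through each of its covectors
  \<open>\<xi>\<close>; its velocity \<open>\<xi>\<close> at zero is a vertical tangent vector of \<open>L\<close> and hence annihilates \<open>H\<close>. Conversely, near
  the zero covector over \<open>p \<in> R\<close>, \<open>L\<close> projects onto \<open>H \<times> H'\<close>. The points over \<open>\<xi> \<in> H'\<close> small must lie over
  \<open>p\<close>, because \<open>R\<close> projects injectively to \<open>H\<close>, and so they are \<open>\<xi>\<close> itself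
  (\<open>orthogonal_fibre_in_Lam\<close>). Dilations then give the whole conormal space.

  The model space is a finite-dimensional inner product space of arbitrary, possibly zero, dimension.
  The calculus that the argument needs is developed for such spaces through orthonormal bases: the
  chain rule for the given notion of smoothness, the inverse function theorem, and the symmetry of
  second derivatives.
\<close>

section \<open>Orthonormal sets and orthogonal projections\<close>

definition orthonormal_set :: "'a::real_inner set \<Rightarrow> bool" where
  "orthonormal_set C \<longleftrightarrow> finite C \<and> (\<forall>b\<in>C. \<forall>c\<in>C. b \<bullet> c = (if b = c then 1 else 0))"

text \<open>For orthonormal \<open>C\<close> this is the orthogonal projection onto \<open>span C\<close>. Closed conditions of the
  form \<open>x \<in> span C\<close> are handled below as equations \<open>x = oproj C x\<close>.\<close>

definition oproj :: "'a::real_inner set \<Rightarrow> 'a \<Rightarrow> 'a" where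
  "oproj C x = (\<Sum>b\<in>C. (x \<bullet> b) *\<^sub>R b)"

definition orthonormal_basis :: "'a::real_inner set \<Rightarrow> bool" where
  "orthonormal_basis C \<longleftrightarrow> orthonormal_set C \<and> span C = UNIV"

lemma bounded_linear_oproj: "bounded_linear (oproj C)"
  unfolding oproj_def[abs_def]
  by (intro bounded_linear_sum bounded_linear_scaleR_const bounded_linear_inner_left)

lemmas linear_oproj = bounded_linear.linear[OF bounded_linear_oproj]

lemma oproj_in_span: "oproj C x \<in> span C"
  unfolding oproj_def by (intro span_sum span_scale span_base)

lemma oproj_inner_basis:
  assumes "orthonormal_set C" "c \<in> C"
  shows "oproj C x \<bullet> c = x \<bullet> c"
proof -
  have "oproj C x \<bullet> c = (\<Sum>b\<in>C. (x \<bullet> b) * (if b = c then 1 else 0))"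
    unfolding oproj_def inner_sum_left using assms
    by (intro sum.cong) (auto simp: orthonormal_set_def)
  also have "\<dots> = x \<bullet> c"
    using assms by (simp add: orthonormal_set_def if_distrib cong: if_cong)
  finally show ?thesis .
qed

lemma oproj_orthogonal:
  assumes "orthonormal_set C" "y \<in> span C"
  shows "(x - oproj C x) \<bullet> y = 0"
  using assms(2)
proof (induction rule: span_induct_alt)
  case (step c b z)
  then show ?case using oproj_inner_basis[OF assms(1)]
    by (simp add: inner_diff_left inner_add_right)
qed simp

lemma oproj_id:
  assumes "orthonormal_set C" "x \<in> span C"
  shows "oproj C x = x"
proof -
  have "x - oproj C x \<in> span C"
    by (intro span_diff assms oproj_in_span)
  then have "(x - oproj C x) \<bullet> (x - oproj C x) = 0"
    using oproj_orthogonal[OF assms(1)] by blast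
  then show ?thesis by simp
qed

lemma oproj_eq_iff: "orthonormal_set C \<Longrightarrow> oproj C x = x \<longleftrightarrow> x \<in> span C"
  using oproj_id oproj_in_span by metis

lemma oproj_eq_0:
  assumes "\<And>c. c \<in> C \<Longrightarrow> x \<bullet> c = 0"
  shows "oproj C x = 0"
  unfolding oproj_def using assms by (intro sum.neutral) simp

lemma norm_oproj_le:
  assumes "orthonormal_set C"
  shows "norm (oproj C x) \<le> norm x"
proof -
  have "(x - oproj C x) \<bullet> oproj C x = 0" by (rule oproj_orthogonal[OF assms oproj_in_span])
  then have "norm (oproj C x) ^ 2 = x \<bullet> oproj C x"
    by (simp add: inner_diff_left power2_norm_eq_inner)
  also have "\<dots> \<le> norm x * norm (oproj C x)" by (rule norm_cauchy_schwarz)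
  finally show ?thesis by (cases "norm (oproj C x) = 0") (auto simp: power2_eq_square)
qed

lemma orthonormal_set_independent:
  assumes "orthonormal_set C"
  shows "independent C"
proof -
  have "c \<notin> span (C - {c})" if c: "c \<in> C" for c
  proof
    assume "c \<in> span (C - {c})"
    then have "c \<bullet> c = 0"
    proof (rule span_induct[where P = "\<lambda>x. x \<bullet> c = 0"])
      show "subspace {x. x \<bullet> c = 0}" by (auto simp: subspace_def inner_add_left)
      show "x \<bullet> c = 0" if "x \<in> C - {c}" for x
        using assms c that by (auto simp: orthonormal_set_def)
    qed
    moreover have "c \<bullet> c = 1" using assms c by (simp add: orthonormal_set_def)
    ultimately show False by simp
  qed
  then show ?thesis by (auto simp: dependent_def)
qed

text \<open>Gram--Schmidt. The model space is only known to be spanned by some finite set, possibly an empty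
  one, so orthonormal bases are produced from spanning sets.\<close>

lemma ex_orthonormal_set:
  assumes "finite S"
  shows "\<exists>C. orthonormal_set C \<and> span C = span S"
  using assms
proof (induction S)
  case empty
  then show ?case by (intro exI[of _ "{}"]) (simp add: orthonormal_set_def)
next
  case (insert a S)
  then obtain C where C: "orthonormal_set C" "span C = span S" by auto
  show ?case
  proof (cases "a \<in> span S")
    case True
    then show ?thesis using C span_redundant[of a S] by auto
  next
    case False
    define r where "r = a - oproj C a"
    define e where "e = r /\<^sub>R norm r"
    have "a \<noteq> oproj C a" using False C(2) oproj_in_span[of C a] by metis
    then have "r \<noteq> 0" by (simp add: r_def)
    then have e1: "e \<bullet> e = 1"
      unfolding e_def by (simp add: dot_square_norm power2_eq_square)
    have er: "norm r *\<^sub>R e = r" using \<open>r \<noteq> 0\<close> by (simp add: e_def)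
    have e0: "e \<bullet> c = 0" if "c \<in> C" for c
      using oproj_orthogonal[OF C(1) span_base[OF that], of a] by (simp add: e_def r_def)
    have on: "orthonormal_set (insert e C)"
      unfolding orthonormal_set_def
    proof (intro conjI ballI)
      show "finite (insert e C)" using C by (simp add: orthonormal_set_def)
      fix b c assume "b \<in> insert e C" "c \<in> insert e C"
      then show "b \<bullet> c = (if b = c then 1 else 0)"
        using C e1 e0 by (auto simp: orthonormal_set_def inner_commute)
    qed
    have "span (insert e C) = span (insert a C)"
    proof (rule antisym; rule span_minimal[OF _ subspace_span])
      have "oproj C a \<in> span (insert a C)"
        by (rule subsetD[OF span_mono[OF subset_insertI] oproj_in_span])
      then have "e \<in> span (insert a C)"
        unfolding e_def r_def by (intro span_scale span_diff) (auto intro: span_base)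
      then show "insert e C \<subseteq> span (insert a C)" by (simp add: span_superset[THEN subset_trans[OF subset_insertI]])
      have "oproj C a \<in> span (insert e C)"
        by (rule subsetD[OF span_mono[OF subset_insertI] oproj_in_span])
      moreover have "r \<in> span (insert e C)"
        by (subst er[symmetric], intro span_scale) (auto intro: span_base)
      ultimately have "r + oproj C a \<in> span (insert e C)" by (rule span_add[rotated])
      then have "a \<in> span (insert e C)" unfolding r_def by simp
      then show "insert a C \<subseteq> span (insert e C)" by (simp add: span_superset[THEN subset_trans[OF subset_insertI]])
    qed
    moreover have "span (insert a C) = span (insert a S)"
      using C(2) by (simp add: span_insert)
    ultimately show ?thesis using on by blast
  qed
qed

lemma orthonormal_basis_oproj: "orthonormal_basis B \<Longrightarrow> oproj B x = x"
  using oproj_id unfolding orthonormal_basis_def by blast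

lemma orthonormal_basis_finite: "orthonormal_basis B \<Longrightarrow> finite B"
  unfolding orthonormal_basis_def orthonormal_set_def by blast

text \<open>Expanding the argument in an orthonormal basis is what makes the ambient space behave as a
  finite-dimensional one: every linear map is a finite sum of inner products times fixed vectors,
  and so statements about it reduce to its values on basis vectors.\<close>

lemma orthonormal_basis_expand:
  fixes f :: "'a::real_inner \<Rightarrow> 'b::real_normed_vector" and B :: "'a set"
  assumes "orthonormal_basis B" "linear f"
  shows "f x = (\<Sum>b\<in>B. (x \<bullet> b) *\<^sub>R f b)"
proof -
  have "f x = f (oproj B x)" using orthonormal_basis_oproj[OF assms(1)] by simp
  also have "\<dots> = (\<Sum>b\<in>B. (x \<bullet> b) *\<^sub>R f b)"
    unfolding oproj_def by (simp add: linear_sum[OF assms(2)] linear_scale[OF assms(2)])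
  finally show ?thesis .
qed

lemma linear_imp_bounded_linear:
  fixes f :: "'a::real_inner \<Rightarrow> 'b::real_normed_vector" and B :: "'a set"
  assumes "orthonormal_basis B" "linear f"
  shows "bounded_linear f"
proof -
  have "f = (\<lambda>x. \<Sum>b\<in>B. (x \<bullet> b) *\<^sub>R f b)" using orthonormal_basis_expand[OF assms] by blast
  moreover have "bounded_linear (\<lambda>x. \<Sum>b\<in>B. (x \<bullet> b) *\<^sub>R f b)"
    by (intro bounded_linear_sum bounded_linear_scaleR_const bounded_linear_inner_left)
  ultimately show ?thesis by simp
qed

lemma onorm_le_sum_basis:
  fixes f :: "'a::real_inner \<Rightarrow> 'b::real_normed_vector" and B :: "'a set"
  assumes "orthonormal_basis B" "linear f"
  shows "onorm f \<le> (\<Sum>b\<in>B. norm (f b))"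
proof (rule onorm_bound)
  show "0 \<le> (\<Sum>b\<in>B. norm (f b))" by (simp add: sum_nonneg)
  fix x
  have "norm (f x) = norm (\<Sum>b\<in>B. (x \<bullet> b) *\<^sub>R f b)" using orthonormal_basis_expand[OF assms, of x] by simp
  also have "\<dots> \<le> (\<Sum>b\<in>B. norm ((x \<bullet> b) *\<^sub>R f b))" by (rule norm_sum)
  also have "\<dots> \<le> (\<Sum>b\<in>B. norm x * norm (f b))"
  proof (rule sum_mono)
    fix b assume "b \<in> B"
    then have "norm b = 1" using assms(1)
      by (simp add: orthonormal_basis_def orthonormal_set_def norm_eq_sqrt_inner)
    then have "\<bar>x \<bullet> b\<bar> \<le> norm x" using Cauchy_Schwarz_ineq2[of x b] by simp
    then show "norm ((x \<bullet> b) *\<^sub>R f b) \<le> norm x * norm (f b)" by (simp add: mult_right_mono)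
  qed
  finally show "norm (f x) \<le> (\<Sum>b\<in>B. norm (f b)) * norm x" by (simp add: sum_distrib_left mult.commute)
qed

lemma orthonormal_basis_prod:
  assumes "orthonormal_basis B" "orthonormal_basis C"
  shows "orthonormal_basis ((\<lambda>b. (b, 0)) ` B \<union> (\<lambda>c. (0, c)) ` C)" (is "orthonormal_basis (?P \<union> ?Q)")
  unfolding orthonormal_basis_def
proof
  have "0 \<notin> B" if "orthonormal_set B" for B :: "'c::real_inner set"
    using that unfolding orthonormal_set_def by (metis inner_zero_left zero_neq_one)
  then have nz: "0 \<notin> B" "0 \<notin> C" using assms unfolding orthonormal_basis_def by blast+
  show "orthonormal_set (?P \<union> ?Q)"
    unfolding orthonormal_set_def
  proof (intro conjI ballI)
    show "finite (?P \<union> ?Q)" using assms by (simp add: orthonormal_basis_finite)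
    have B: "b \<bullet> b' = (if b = b' then 1 else 0)" if "b \<in> B" "b' \<in> B" for b b'
      using assms(1) that unfolding orthonormal_basis_def orthonormal_set_def by blast
    have C: "b \<bullet> b' = (if b = b' then 1 else 0)" if "b \<in> C" "b' \<in> C" for b b'
      using assms(2) that unfolding orthonormal_basis_def orthonormal_set_def by blast
    fix z w assume "z \<in> ?P \<union> ?Q" "w \<in> ?P \<union> ?Q"
    then show "z \<bullet> w = (if z = w then 1 else 0)"
      using nz B C by (elim UnE imageE) auto
  qed
  show "span (?P \<union> ?Q) = UNIV"
  proof (intro equalityI subsetI)
    fix z :: "'a \<times> 'b"
    have l1: "linear (\<lambda>b::'a. (b, 0::'b))" and l2: "linear (\<lambda>b::'b. (0::'a, b))"
      by (auto intro!: linearI)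
    have "(fst z, 0) \<in> (\<lambda>b. (b, 0::'b)) ` span B" "(0, snd z) \<in> (\<lambda>b. (0::'a, b)) ` span C"
      using assms unfolding orthonormal_basis_def by auto
    then have "(fst z, 0) \<in> span ?P" "(0, snd z) \<in> span ?Q"
      by (simp_all add: linear_span_image[OF l1, symmetric] linear_span_image[OF l2, symmetric])
    then have "(fst z, 0) + (0, snd z) \<in> span (?P \<union> ?Q)"
      using span_mono[of ?P "?P \<union> ?Q"] span_mono[of ?Q "?P \<union> ?Q"] by (intro span_add) blast+
    then show "z \<in> span (?P \<union> ?Q)" by simp
  qed simp
qed

lemma ex_orthonormal_subspace:
  fixes B H :: "'a::real_inner set"
  assumes "orthonormal_basis B" "subspace H"
  shows "\<exists>C. orthonormal_set C \<and> span C = H"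
proof -
  obtain S where S: "S \<subseteq> H" "independent S" "H \<subseteq> span S"
    using basis_exists[of H] by metis
  have "finite S"
    using independent_span_bound[of B S] assms(1) S(2) orthonormal_basis_finite[OF assms(1)]
    unfolding orthonormal_basis_def by blast
  moreover have "span S = H" using S span_minimal[OF S(1) assms(2)] by blast
  ultimately show ?thesis using ex_orthonormal_set[of S] by simp
qed

lemma ex_orthonormal_basis:
  assumes "finite B" "span B = (UNIV :: 'a::real_inner set)"
  shows "\<exists>C :: 'a set. orthonormal_basis C"
  using ex_orthonormal_set[OF assms(1)] assms(2) unfolding orthonormal_basis_def by simp

section \<open>Calculus of smooth maps in finite dimension\<close>

abbreviation Diff :: "('a::real_normed_vector \<Rightarrow> 'b::real_normed_vector) \<Rightarrow> 'a \<Rightarrow> 'a \<Rightarrow> 'b" where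
  "Diff f x \<equiv> frechet_derivative f (at x)"

lemma Diff_eq: "(f has_derivative f') (at x) \<Longrightarrow> Diff f x = f'"
  using frechet_derivative_at by metis

lemma cont_diff_on_SucD:
  assumes "cont_diff_on S (Suc k) f" "x \<in> S"
  shows "(f has_derivative Diff f x) (at x)"
  using assms by (simp add: frechet_derivative_works)

text \<open>On an open set, being of class \<open>C\<^sup>k\<close> depends only on the values there: the derivatives at a
  point are determined by the germ of the map.\<close>

lemma cont_diff_on_cong:
  assumes "open S" "\<And>x. x \<in> S \<Longrightarrow> f x = g x" "cont_diff_on S k f"
  shows "cont_diff_on S k g"
  using assms(2,3)
proof (induction k arbitrary: f g)
  case 0
  then show ?case using continuous_on_cong[of S S f g] by simp
next
  case (Suc k)
  have *: "(g has_derivative Diff f x) (at x)" if "x \<in> S" for x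
    using cont_diff_on_SucD[OF Suc.prems(2) that]
    by (rule has_derivative_transform_within_open[OF _ assms(1) that]) (use Suc.prems in auto)
  then have "Diff g x = Diff f x" if "x \<in> S" for x using Diff_eq that by blast
  then have "cont_diff_on S k (\<lambda>x. Diff g x v)" for v
    using Suc.IH[of "\<lambda>x. Diff f x v" "\<lambda>x. Diff g x v"] Suc.prems(2) by simp
  then show ?case using * by (auto simp: differentiable_def)
qed

lemma cont_diff_on_SucI:
  assumes "open S" "\<And>x. x \<in> S \<Longrightarrow> (f has_derivative f' x) (at x)"
    and "\<And>v. cont_diff_on S k (\<lambda>x. f' x v)"
  shows "cont_diff_on S (Suc k) f"
proof -
  have "Diff f x = f' x" if "x \<in> S" for x using Diff_eq assms(2) that by blast
  then have "cont_diff_on S k (\<lambda>x. Diff f x v)" for v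
    by (intro cont_diff_on_cong[OF assms(1) _ assms(3)]) simp
  then show ?thesis using assms(2) by (auto simp: differentiable_def)
qed

lemma cont_diff_on_imp_continuous_on: "cont_diff_on S k f \<Longrightarrow> continuous_on S f"
proof (cases k)
  case (Suc j)
  assume "cont_diff_on S k f"
  then show ?thesis unfolding Suc
    using has_derivative_continuous[OF cont_diff_on_SucD] continuous_at_imp_continuous_on by blast
qed simp

lemma cont_diff_on_Suc_imp: "cont_diff_on S (Suc k) f \<Longrightarrow> cont_diff_on S k f"
proof (induction k arbitrary: f)
  case 0
  then show ?case using cont_diff_on_imp_continuous_on[of S "Suc 0" f] by simp
next
  case (Suc k)
  then show ?case by auto
qed

lemma cont_diff_on_subset: "cont_diff_on S k f \<Longrightarrow> T \<subseteq> S \<Longrightarrow> cont_diff_on T k f"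
proof (induction k arbitrary: f)
  case 0
  then show ?case using continuous_on_subset by simp
next
  case (Suc k)
  then show ?case by (simp add: subset_eq)
qed

lemma cont_diff_on_const: "cont_diff_on S k (\<lambda>x. c)"
  by (induction k arbitrary: c) simp_all

lemma cont_diff_on_linear:
  assumes "bounded_linear f"
  shows "cont_diff_on S k f"
proof (cases k)
  case 0
  then show ?thesis using assms by (simp add: linear_continuous_on)
next
  case (Suc j)
  have d: "(f has_derivative f) (at x)" for x using assms bounded_linear_imp_has_derivative by blast
  then have D: "Diff f x = f" for x using Diff_eq by blast
  show ?thesis unfolding Suc using d by (auto simp: differentiable_def D cont_diff_on_const)
qed

lemma cont_diff_on_linear_compose:
  assumes "open S" "bounded_linear L" "cont_diff_on S k f"
  shows "cont_diff_on S k (\<lambda>x. L (f x))"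
  using assms(3)
proof (induction k arbitrary: f)
  case 0
  then show ?case using assms(2) by (simp add: bounded_linear.continuous_on)
next
  case (Suc k)
  show ?case
  proof (rule cont_diff_on_SucI[OF assms(1)])
    show "((\<lambda>x. L (f x)) has_derivative (\<lambda>v. L (Diff f x v))) (at x)" if "x \<in> S" for x
      using bounded_linear.has_derivative[OF assms(2) cont_diff_on_SucD[OF Suc.prems that]] .
    show "cont_diff_on S k (\<lambda>x. L (Diff f x v))" for v
      by (rule Suc.IH) (use Suc.prems in simp)
  qed
qed

lemma cont_diff_on_add:
  assumes "open S" "cont_diff_on S k f" "cont_diff_on S k g"
  shows "cont_diff_on S k (\<lambda>x. f x + g x)"
  using assms(2,3)
proof (induction k arbitrary: f g)
  case 0
  then show ?case by (simp add: continuous_on_add)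
next
  case (Suc k)
  show ?case
  proof (rule cont_diff_on_SucI[OF assms(1)])
    show "((\<lambda>x. f x + g x) has_derivative (\<lambda>v. Diff f x v + Diff g x v)) (at x)" if "x \<in> S" for x
      using cont_diff_on_SucD[OF Suc.prems(1) that] cont_diff_on_SucD[OF Suc.prems(2) that] by (rule has_derivative_add)
    show "cont_diff_on S k (\<lambda>x. Diff f x v + Diff g x v)" for v
      by (rule Suc.IH) (use Suc.prems in simp_all)
  qed
qed

lemma cont_diff_on_minus:
  assumes "open S" "cont_diff_on S k f"
  shows "cont_diff_on S k (\<lambda>x. - f x)"
  by (rule cont_diff_on_linear_compose[OF assms(1) _ assms(2)])
    (rule bounded_linear_minus[OF bounded_linear_ident])

lemma cont_diff_on_diff:
  assumes "open S" "cont_diff_on S k f" "cont_diff_on S k g"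
  shows "cont_diff_on S k (\<lambda>x. f x - g x)"
  using cont_diff_on_add[OF assms(1,2) cont_diff_on_minus[OF assms(1,3)]] by simp

lemma cont_diff_on_sum:
  assumes "open S" "\<And>i. i \<in> I \<Longrightarrow> cont_diff_on S k (f i)"
  shows "cont_diff_on S k (\<lambda>x. \<Sum>i\<in>I. f i x)"
  using assms(2)
proof (induction I rule: infinite_finite_induct)
  case (insert i I)
  have "cont_diff_on S k (\<lambda>x. f i x + (\<Sum>j\<in>I. f j x))"
    using insert.prems by (intro cont_diff_on_add[OF assms(1)] insert.IH) blast+
  then show ?case using insert.hyps by simp
qed (simp_all add: cont_diff_on_const)

lemma cont_diff_on_scaleR:
  assumes "open S" "cont_diff_on S k f" "cont_diff_on S k g"
  shows "cont_diff_on S k (\<lambda>x. f x *\<^sub>R g x)"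
  using assms(2,3)
proof (induction k arbitrary: f g)
  case 0
  then show ?case by (simp add: continuous_on_scaleR)
next
  case (Suc k)
  show ?case
  proof (rule cont_diff_on_SucI[OF assms(1)])
    show "((\<lambda>x. f x *\<^sub>R g x) has_derivative (\<lambda>v. f x *\<^sub>R Diff g x v + Diff f x v *\<^sub>R g x)) (at x)" if "x \<in> S" for x
      using cont_diff_on_SucD[OF Suc.prems(1) that] cont_diff_on_SucD[OF Suc.prems(2) that] by (rule has_derivative_scaleR)
    show "cont_diff_on S k (\<lambda>x. f x *\<^sub>R Diff g x v + Diff f x v *\<^sub>R g x)" for v
    proof (rule cont_diff_on_add[OF assms(1)])
      show "cont_diff_on S k (\<lambda>x. f x *\<^sub>R Diff g x v)"
        by (rule Suc.IH[OF cont_diff_on_Suc_imp[OF Suc.prems(1)]]) (use Suc.prems in simp)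
      show "cont_diff_on S k (\<lambda>x. Diff f x v *\<^sub>R g x)"
        by (rule Suc.IH[OF _ cont_diff_on_Suc_imp[OF Suc.prems(2)]]) (use Suc.prems in simp)
    qed
  qed
qed

text \<open>Expanding \<open>u x\<close> in an orthonormal basis turns \<open>P x (u x)\<close> into a finite sum of products of
  functions of class \<open>C\<^sup>k\<close>, although \<open>P\<close> is only known to be of class \<open>C\<^sup>k\<close> one argument at a
  time. This is how the definition of smoothness through directional derivatives is compatible
  with the chain rule.\<close>

lemma cont_diff_on_apply:
  fixes P :: "'a::real_normed_vector \<Rightarrow> 'b::real_inner \<Rightarrow> 'c::real_normed_vector" and B :: "'b set"
  assumes "open S" "orthonormal_basis B"
    and "\<And>x. x \<in> S \<Longrightarrow> linear (P x)" "\<And>v. cont_diff_on S k (\<lambda>x. P x v)" "cont_diff_on S k u"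
  shows "cont_diff_on S k (\<lambda>x. P x (u x))"
proof (rule cont_diff_on_cong[OF assms(1)])
  show "(\<Sum>b\<in>B. (u x \<bullet> b) *\<^sub>R P x b) = P x (u x)" if "x \<in> S" for x
    by (rule orthonormal_basis_expand[OF assms(2) assms(3)[OF that], symmetric])
  show "cont_diff_on S k (\<lambda>x. \<Sum>b\<in>B. (u x \<bullet> b) *\<^sub>R P x b)"
  proof (rule cont_diff_on_sum[OF assms(1)])
    fix b
    have "cont_diff_on S k (\<lambda>x. u x \<bullet> b)"
      by (rule cont_diff_on_linear_compose[OF assms(1) bounded_linear_inner_left assms(5)])
    then show "cont_diff_on S k (\<lambda>x. (u x \<bullet> b) *\<^sub>R P x b)"
      by (rule cont_diff_on_scaleR[OF assms(1) _ assms(4)])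
  qed
qed

lemma linear_Diff: "cont_diff_on S (Suc k) f \<Longrightarrow> x \<in> S \<Longrightarrow> linear (Diff f x)"
  by (rule has_derivative_linear[OF cont_diff_on_SucD])

lemma cont_diff_on_compose:
  fixes g :: "'a::real_normed_vector \<Rightarrow> 'b::real_inner" and f :: "'b \<Rightarrow> 'c::real_normed_vector" and B :: "'b set"
  assumes "open S" "open T" "orthonormal_basis B" "g ` S \<subseteq> T"
    and "cont_diff_on S k g" "cont_diff_on T k f"
  shows "cont_diff_on S k (\<lambda>x. f (g x))"
  using assms(5,6)
proof (induction k arbitrary: f)
  case 0
  then have "continuous_on S g" "continuous_on T f" by simp_all
  from continuous_on_compose2[OF this(2,1) assms(4)] show ?case by simp
next
  case (Suc k)
  have gS: "g x \<in> T" if "x \<in> S" for x using assms(4) that by auto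
  show ?case
  proof (rule cont_diff_on_SucI[OF assms(1)])
    show "((\<lambda>x. f (g x)) has_derivative (\<lambda>v. Diff f (g x) (Diff g x v))) (at x)" if "x \<in> S" for x
      using has_derivative_compose[OF cont_diff_on_SucD[OF Suc.prems(1) that]
         cont_diff_on_SucD[OF Suc.prems(2) gS[OF that]]] .
    show "cont_diff_on S k (\<lambda>x. Diff f (g x) (Diff g x v))" for v
    proof (rule cont_diff_on_apply[OF assms(1,3)])
      show "linear (Diff f (g x))" if "x \<in> S" for x using linear_Diff[OF Suc.prems(2)] gS that by blast
      show "cont_diff_on S k (\<lambda>x. Diff f (g x) w)" for w
        by (rule Suc.IH[OF cont_diff_on_Suc_imp[OF Suc.prems(1)]]) (use Suc.prems(2) in simp)
      show "cont_diff_on S k (\<lambda>x. Diff g x v)" using Suc.prems by simp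
    qed
  qed
qed

lemma smooth_onD:
  assumes "smooth_on S f" "x \<in> S"
  shows "(f has_derivative Diff f x) (at x)"
  by (rule cont_diff_on_SucD[of S 0]) (use assms in \<open>unfold smooth_on_def, blast+\<close>)

lemma smooth_on_Diff: "smooth_on S f \<Longrightarrow> smooth_on S (\<lambda>x. Diff f x v)"
  unfolding smooth_on_def
proof
  fix k assume "\<forall>k. cont_diff_on S k f"
  then have "cont_diff_on S (Suc k) f" by blast
  then show "cont_diff_on S k (\<lambda>x. Diff f x v)" by simp
qed

lemma smooth_on_linear_Diff: "smooth_on S f \<Longrightarrow> x \<in> S \<Longrightarrow> linear (Diff f x)"
  by (rule has_derivative_linear[OF smooth_onD])

lemma smooth_on_continuous: "smooth_on S f \<Longrightarrow> continuous_on S f"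
  unfolding smooth_on_def using cont_diff_on_imp_continuous_on by blast

lemma smooth_on_cong: "smooth_on S f \<Longrightarrow> open S \<Longrightarrow> (\<And>x. x \<in> S \<Longrightarrow> f x = g x) \<Longrightarrow> smooth_on S g"
  unfolding smooth_on_def using cont_diff_on_cong[of S f g] by blast

lemma smooth_on_subset: "smooth_on S f \<Longrightarrow> T \<subseteq> S \<Longrightarrow> smooth_on T f"
  unfolding smooth_on_def using cont_diff_on_subset by blast

lemma smooth_on_compose:
  fixes g :: "'a::real_normed_vector \<Rightarrow> 'b::real_inner" and f :: "'b \<Rightarrow> 'c::real_normed_vector" and B :: "'b set"
  assumes "orthonormal_basis B" "open S" "open T" "g ` S \<subseteq> T" "smooth_on S g" "smooth_on T f"
  shows "smooth_on S (\<lambda>x. f (g x))"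
  unfolding smooth_on_def
  by (rule allI, rule cont_diff_on_compose[OF assms(2,3,1,4)])
    (use assms(5,6) in \<open>simp_all add: smooth_on_def\<close>)

lemma smooth_on_apply:
  fixes P :: "'a::real_normed_vector \<Rightarrow> 'b::real_inner \<Rightarrow> 'c::real_normed_vector" and B :: "'b set"
  assumes "open S" "orthonormal_basis B"
    and "\<And>x. x \<in> S \<Longrightarrow> linear (P x)" "\<And>v. smooth_on S (\<lambda>x. P x v)" "smooth_on S u"
  shows "smooth_on S (\<lambda>x. P x (u x))"
  unfolding smooth_on_def
  by (rule allI, rule cont_diff_on_apply[OF assms(1,2,3)])
    (use assms(4,5) in \<open>simp_all add: smooth_on_def\<close>)

lemma smooth_on_linear: "bounded_linear f \<Longrightarrow> smooth_on S f"
  unfolding smooth_on_def using cont_diff_on_linear by blast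

lemma smooth_on_const: "smooth_on S (\<lambda>x. c)"
  unfolding smooth_on_def using cont_diff_on_const by blast

lemma smooth_on_linear_compose:
  "open S \<Longrightarrow> bounded_linear L \<Longrightarrow> smooth_on S f \<Longrightarrow> smooth_on S (\<lambda>x. L (f x))"
  unfolding smooth_on_def using cont_diff_on_linear_compose by blast

lemma smooth_on_add: "open S \<Longrightarrow> smooth_on S f \<Longrightarrow> smooth_on S g \<Longrightarrow> smooth_on S (\<lambda>x. f x + g x)"
  unfolding smooth_on_def using cont_diff_on_add by blast

lemma smooth_on_diff: "open S \<Longrightarrow> smooth_on S f \<Longrightarrow> smooth_on S g \<Longrightarrow> smooth_on S (\<lambda>x. f x - g x)"
  unfolding smooth_on_def using cont_diff_on_diff by blast

lemma Diff_linear_compose: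
  assumes "bounded_linear L" "smooth_on S f" "x \<in> S"
  shows "Diff (\<lambda>x. L (f x)) x = (\<lambda>v. L (Diff f x v))"
  by (rule Diff_eq[OF bounded_linear.has_derivative[OF assms(1) smooth_onD[OF assms(2,3)]]])

text \<open>The derivative is continuous in the operator norm, since this norm is bounded by the sum of the
  norms of the values on a basis. The mean value inequality then gives strict differentiability,
  which is the form in which smoothness enters the inverse function theorem.\<close>

lemma smooth_on_strict:
  fixes f :: "'a::real_inner \<Rightarrow> 'b::real_normed_vector" and B :: "'a set"
  assumes "open S" "orthonormal_basis B" "smooth_on S f" "x0 \<in> S" "e > 0"
  shows "\<exists>r>0. ball x0 r \<subseteq> S \<and> (\<forall>x\<in>ball x0 r. \<forall>y\<in>ball x0 r.
     norm ((f x - Diff f x0 x) - (f y - Diff f x0 y)) \<le> e * norm (x - y)) \<and>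
     (\<forall>x\<in>ball x0 r. \<forall>v. norm (Diff f x v - Diff f x0 v) \<le> e * norm v)"
proof -
  define h where "h x = (\<Sum>b\<in>B. norm (Diff f x b - Diff f x0 b))" for x
  have "continuous_on S (\<lambda>x. Diff f x b)" for b
    by (rule smooth_on_continuous[OF smooth_on_Diff[OF assms(3)]])
  then have "continuous_on S h"
    unfolding h_def[abs_def] by (intro continuous_on_sum continuous_on_norm continuous_on_diff continuous_on_const) auto
  then have "isCont h x0" using assms(1,4) by (simp add: continuous_on_eq_continuous_at)
  moreover have "h x0 = 0" by (simp add: h_def)
  ultimately obtain d where d: "d > 0" "\<And>x. dist x x0 < d \<Longrightarrow> dist (h x) 0 < e"
    using \<open>e > 0\<close> unfolding continuous_at_eps_delta by auto
  obtain r0 where r0: "r0 > 0" "ball x0 r0 \<subseteq> S" using assms openE by blast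
  define r where "r = min d r0"
  have "r > 0" and "ball x0 r \<subseteq> S" using d r0 by (auto simp: r_def)
  have on: "onorm (\<lambda>v. Diff f z v - Diff f x0 v) \<le> e" and bl: "bounded_linear (\<lambda>v. Diff f z v - Diff f x0 v)"
    if z: "z \<in> ball x0 r" for z
  proof -
    have zS: "z \<in> S" using z \<open>ball x0 r \<subseteq> S\<close> by auto
    have lin: "linear (\<lambda>v. Diff f z v - Diff f x0 v)"
      using smooth_on_linear_Diff[OF assms(3)] zS assms(4) by (intro linear_compose_sub) auto
    then show "bounded_linear (\<lambda>v. Diff f z v - Diff f x0 v)" by (rule linear_imp_bounded_linear[OF assms(2)])
    have "onorm (\<lambda>v. Diff f z v - Diff f x0 v) \<le> h z"
      unfolding h_def by (rule onorm_le_sum_basis[OF assms(2) lin])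
    also have "h z \<le> e" using d(2)[of z] z by (auto simp: r_def dist_real_def dist_commute)
    finally show "onorm (\<lambda>v. Diff f z v - Diff f x0 v) \<le> e" .
  qed
  have "norm (Diff f z v - Diff f x0 v) \<le> e * norm v" if "z \<in> ball x0 r" for z v
    using onorm[OF bl[OF that], of v] on[OF that] mult_right_mono[OF on[OF that], of "norm v"] by simp
  moreover have "norm ((f x - Diff f x0 x) - (f y - Diff f x0 y)) \<le> e * norm (x - y)"
    if xy: "x \<in> ball x0 r" "y \<in> ball x0 r" for x y
  proof (rule differentiable_bound[of "ball x0 r" _ "\<lambda>z v. Diff f z v - Diff f x0 v"])
    have bl: "bounded_linear (Diff f x0)" using smooth_onD[OF assms(3,4)] has_derivative_bounded_linear by blast
    fix z assume z: "z \<in> ball x0 r"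
    then have zS: "z \<in> S" using \<open>ball x0 r \<subseteq> S\<close> by auto
    show "((\<lambda>x. f x - Diff f x0 x) has_derivative (\<lambda>v. Diff f z v - Diff f x0 v)) (at z within ball x0 r)"
      by (rule has_derivative_at_withinI)
        (intro has_derivative_diff smooth_onD[OF assms(3) zS] bounded_linear_imp_has_derivative bl)
    show "onorm (\<lambda>v. Diff f z v - Diff f x0 v) \<le> e" by (rule on[OF z])
  qed (use xy in auto)
  ultimately show ?thesis using \<open>r > 0\<close> \<open>ball x0 r \<subseteq> S\<close> by blast
qed

lemma smooth_on_locally_lipschitz:
  fixes f :: "'a::real_inner \<Rightarrow> 'b::real_normed_vector" and B :: "'a set"
  assumes "open S" "orthonormal_basis B" "smooth_on S f" "x0 \<in> S"
  shows "\<exists>r>0. \<exists>C>0. ball x0 r \<subseteq> S \<and> (\<forall>x\<in>ball x0 r. \<forall>y\<in>ball x0 r.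
     norm (f x - f y) \<le> C * norm (x - y))"
proof -
  obtain r where r: "r > 0" "ball x0 r \<subseteq> S" and
    *: "\<forall>x\<in>ball x0 r. \<forall>y\<in>ball x0 r.
     norm ((f x - Diff f x0 x) - (f y - Diff f x0 y)) \<le> 1 * norm (x - y)"
    using smooth_on_strict[OF assms, of 1] by force
  have bl: "bounded_linear (Diff f x0)" using smooth_onD[OF assms(3,4)] has_derivative_bounded_linear by blast
  define C where "C = 1 + onorm (Diff f x0)"
  have "C > 0" using onorm_pos_le[OF bl] by (simp add: C_def)
  moreover have "norm (f x - f y) \<le> C * norm (x - y)" if "x \<in> ball x0 r" "y \<in> ball x0 r" for x y
  proof -
    have "f x - f y = ((f x - Diff f x0 x) - (f y - Diff f x0 y)) + Diff f x0 (x - y)"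
      by (simp add: linear_diff[OF bounded_linear.linear[OF bl]])
    then have "norm (f x - f y) \<le> norm ((f x - Diff f x0 x) - (f y - Diff f x0 y)) + norm (Diff f x0 (x - y))"
      by (metis norm_triangle_ineq)
    also have "\<dots> \<le> 1 * norm (x - y) + onorm (Diff f x0) * norm (x - y)"
      using * that onorm[OF bl] by (intro add_mono) auto
    finally show ?thesis by (simp add: C_def algebra_simps)
  qed
  ultimately show ?thesis using r by blast
qed

section \<open>The inverse function theorem\<close>

text \<open>If \<open>f\<close> differs from the identity by a map with Lipschitz constant \<open>1/2\<close>, then \<open>f u = w\<close> says that \<open>u\<close> is
  a fixed point of the contraction \<open>u \<mapsto> w - (f u - u)\<close>. All applications below can be arranged so
  that the derivative at the base point is the identity.\<close>

lemma perturbed_identity_surj: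
  fixes f :: "'a::banach \<Rightarrow> 'a"
  assumes lip: "\<And>x y. x \<in> D \<Longrightarrow> y \<in> D \<Longrightarrow> norm ((f x - x) - (f y - y)) \<le> 1/2 * norm (x - y)"
    and "cball x s \<subseteq> D" "s \<ge> 0"
  shows "cball (f x) (s/2) \<subseteq> f ` cball x s"
proof
  fix w assume w: "w \<in> cball (f x) (s/2)"
  define T where "T u = w - (f u - u)" for u
  have xD: "x \<in> D" using assms by auto
  have "\<exists>!u. u \<in> cball x s \<and> T u = u"
  proof (rule Banach_fix[of "cball x s" "1/2"])
    show "complete (cball x s)" by (simp add: complete_eq_closed)
    show "cball x s \<noteq> {}" using \<open>s \<ge> 0\<close> by auto
    show "T ` cball x s \<subseteq> cball x s"
    proof clarify
      fix u assume u: "u \<in> cball x s"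
      have "x - T u = ((f u - u) - (f x - x)) + (f x - w)" by (simp add: T_def)
      also have "norm \<dots> \<le> 1/2 * norm (u - x) + norm (f x - w)"
        using lip[of u x] u assms(2) xD by (intro norm_triangle_mono) auto
      also have "\<dots> \<le> 1/2 * s + s/2"
        using u w by (intro add_mono) (auto simp: dist_norm norm_minus_commute)
      finally show "T u \<in> cball x s" by (simp add: dist_norm)
    qed
    show "dist (T u) (T v) \<le> 1/2 * dist u v" if "u \<in> cball x s" "v \<in> cball x s" for u v
    proof -
      have "T u - T v = - ((f u - u) - (f v - v))" by (simp add: T_def)
      then have "norm (T u - T v) = norm ((f u - u) - (f v - v))" using norm_minus_cancel by metis
      also have "\<dots> \<le> 1/2 * norm (u - v)" using that assms(2) by (intro lip) auto
      finally show ?thesis by (simp add: dist_norm)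
    qed
  qed auto
  then obtain u where "u \<in> cball x s" "T u = u" by blast
  then show "w \<in> f ` cball x s" by (intro image_eqI[of _ _ u]) (auto simp: T_def algebra_simps)
qed

lemma perturbed_identity_inj:
  fixes f :: "'a::real_normed_vector \<Rightarrow> 'a"
  assumes "norm ((f x - x) - (f y - y)) \<le> 1/2 * norm (x - y)"
  shows "norm (x - y) \<le> 2 * norm (f x - f y)"
proof -
  have "x - y = (f x - f y) - ((f x - x) - (f y - y))" by simp
  then have "norm (x - y) \<le> norm (f x - f y) + norm ((f x - x) - (f y - y))"
    by (metis norm_triangle_ineq4)
  then show ?thesis using assms by linarith
qed

lemma perturbed_identity_open:
  fixes f :: "'a::banach \<Rightarrow> 'a"
  assumes lip: "\<And>x y. x \<in> D \<Longrightarrow> y \<in> D \<Longrightarrow> norm ((f x - x) - (f y - y)) \<le> 1/2 * norm (x - y)"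
    and "open U" "U \<subseteq> D"
  shows "open (f ` U)"
  unfolding open_contains_cball
proof
  fix y assume "y \<in> f ` U"
  then obtain x where x: "x \<in> U" "y = f x" by blast
  obtain s where s: "s > 0" "cball x s \<subseteq> U" using \<open>open U\<close> x open_contains_cball by blast
  have "cball (f x) (s/2) \<subseteq> f ` cball x s"
    using s assms by (intro perturbed_identity_surj[of D]) auto
  then show "\<exists>e>0. cball y e \<subseteq> f ` U" using x s by (intro exI[of _ "s/2"]) auto
qed

text \<open>A product is differentiable at a zero of one differentiable factor as soon as the other factor is
  continuous. This gives the derivative of a family of inverse operators, for which only continuity
  is known beforehand.\<close>

lemma has_derivative_scaleR_vanishing:
  fixes f :: "'a::real_normed_vector \<Rightarrow> real" and g :: "'a \<Rightarrow> 'b::real_normed_vector"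
  assumes f: "(f has_derivative f') (at x)" and "f x = 0" and g: "isCont g x"
  shows "((\<lambda>z. f z *\<^sub>R g z) has_derivative (\<lambda>h. f' h *\<^sub>R g x)) (at x)"
proof -
  have bl: "bounded_linear f'" using f has_derivative_bounded_linear by blast
  then obtain K where K: "\<And>h. norm (f' h) \<le> norm h * K" using bounded_linear.bounded by blast
  have q: "((\<lambda>z. norm (f z - f' (z - x)) / norm (z - x)) \<longlongrightarrow> 0) (at x)"
    using f \<open>f x = 0\<close> by (simp add: has_derivative_iff_norm)
  have G: "(g \<longlongrightarrow> g x) (at x)" using g by (simp add: isCont_def)
  have "((\<lambda>z. norm (f z - f' (z - x)) / norm (z - x) * norm (g z) + \<bar>K\<bar> * norm (g z - g x)) \<longlongrightarrow> 0 * norm (g x) + \<bar>K\<bar> * norm (g x - g x)) (at x)"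
    by (intro tendsto_intros q G)
  then have lim: "((\<lambda>z. norm (f z - f' (z - x)) / norm (z - x) * norm (g z) + \<bar>K\<bar> * norm (g z - g x)) \<longlongrightarrow> 0) (at x)"
    by simp
  have "((\<lambda>z. norm (f z *\<^sub>R g z - f x *\<^sub>R g x - f' (z - x) *\<^sub>R g x) / norm (z - x)) \<longlongrightarrow> 0) (at x)"
  proof (rule tendsto_sandwich[OF _ _ tendsto_const lim])
    show "\<forall>\<^sub>F z in at x. norm (f z *\<^sub>R g z - f x *\<^sub>R g x - f' (z - x) *\<^sub>R g x) / norm (z - x)
        \<le> norm (f z - f' (z - x)) / norm (z - x) * norm (g z) + \<bar>K\<bar> * norm (g z - g x)"
    proof (rule eventually_at_ball[of 1, THEN eventually_mono])
      fix z
      show "norm (f z *\<^sub>R g z - f x *\<^sub>R g x - f' (z - x) *\<^sub>R g x) / norm (z - x)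
        \<le> norm (f z - f' (z - x)) / norm (z - x) * norm (g z) + \<bar>K\<bar> * norm (g z - g x)"
      proof (cases "z = x")
        case False
        have "f z *\<^sub>R g z - f x *\<^sub>R g x - f' (z - x) *\<^sub>R g x =
          (f z - f' (z - x)) *\<^sub>R g z + f' (z - x) *\<^sub>R (g z - g x)"
          using \<open>f x = 0\<close> by (simp add: algebra_simps)
        then have "norm (f z *\<^sub>R g z - f x *\<^sub>R g x - f' (z - x) *\<^sub>R g x) \<le>
          norm ((f z - f' (z - x)) *\<^sub>R g z) + norm (f' (z - x) *\<^sub>R (g z - g x))"
          by (metis norm_triangle_ineq)
        also have "\<dots> \<le> norm (f z - f' (z - x)) * norm (g z) + (norm (z - x) * \<bar>K\<bar>) * norm (g z - g x)"
        proof -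
          have "norm (f' (z - x)) \<le> norm (z - x) * \<bar>K\<bar>"
            using K[of "z - x"] mult_left_mono[OF abs_ge_self[of K], of "norm (z - x)"] by simp
          then show ?thesis unfolding norm_scaleR by (intro add_mono mult_right_mono) auto
        qed
        finally have "norm (f z *\<^sub>R g z - f x *\<^sub>R g x - f' (z - x) *\<^sub>R g x) / norm (z - x) \<le>
          (norm (f z - f' (z - x)) * norm (g z) + (norm (z - x) * \<bar>K\<bar>) * norm (g z - g x)) / norm (z - x)"
          by (rule divide_right_mono) simp
        also have "\<dots> = norm (f z - f' (z - x)) / norm (z - x) * norm (g z) + \<bar>K\<bar> * norm (g z - g x)"
          using False by (simp add: add_divide_distrib)
        finally show ?thesis .
      qed simp
    qed simp
  qed simp
  moreover have "bounded_linear (\<lambda>h. f' h *\<^sub>R g x)" by (rule bounded_linear_scaleR_const[OF bl])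
  ultimately show ?thesis using \<open>f x = 0\<close> by (simp add: has_derivative_iff_norm)
qed

text \<open>The derivative of \<open>N = M\<^sup>-\<^sup>1\<close> in direction \<open>h\<close> is \<open>- N (D\<^sub>h M) N\<close>, an expression in \<open>N\<close> itself.
  Hence if all \<open>N x v\<close> are of class \<open>C\<^sup>k\<close>, they are of class \<open>C\<^sup>k\<^sup>+\<^sup>1\<close>; the induction starts with
  continuity, which follows from the bound on \<open>N\<close>.\<close>

lemma smooth_on_inverse_operator:
  fixes M N :: "'a::real_normed_vector \<Rightarrow> 'b::real_inner \<Rightarrow> 'b" and B :: "'b set"
  assumes S: "open S" and B: "orthonormal_basis B"
    and linM: "\<And>x. x \<in> S \<Longrightarrow> linear (M x)" and linN: "\<And>x. x \<in> S \<Longrightarrow> linear (N x)"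
    and MN: "\<And>x v. x \<in> S \<Longrightarrow> M x (N x v) = v" and NM: "\<And>x v. x \<in> S \<Longrightarrow> N x (M x v) = v"
    and bdd: "\<And>x v. x \<in> S \<Longrightarrow> norm (N x v) \<le> c * norm v"
    and smooth: "\<And>u. smooth_on S (\<lambda>x. M x u)"
  shows "smooth_on S (\<lambda>x. N x v)"
proof -
  \<comment> \<open>the resolvent identity \<open>N z - N x = - N z (M z - M x) N x\<close>, applied to \<open>v\<close>\<close>
  have Ndiff: "N z v - N x v = - N z (M z (N x v) - v)" if "z \<in> S" "x \<in> S" for z x v
    using that by (simp add: linear_diff[OF linN] NM)
  have cont: "isCont (\<lambda>z. N z v) x" if "x \<in> S" for x v
  proof -
    have "isCont (\<lambda>z. M z (N x v)) x"
      using smooth_on_continuous[OF smooth] S that by (simp add: continuous_on_eq_continuous_at)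
    then have "((\<lambda>z. M z (N x v)) \<longlongrightarrow> v) (at x)" using MN[OF that, of v] by (simp add: isCont_def)
    then have "((\<lambda>z. \<bar>c\<bar> * norm (M z (N x v) - v)) \<longlongrightarrow> \<bar>c\<bar> * norm (v - v)) (at x)"
      by (intro tendsto_intros)
    then have lim: "((\<lambda>z. \<bar>c\<bar> * norm (M z (N x v) - v)) \<longlongrightarrow> 0) (at x)" by simp
    have "\<forall>\<^sub>F z in at x. norm (N z v - N x v) \<le> \<bar>c\<bar> * norm (M z (N x v) - v)"
      using eventually_at_in_open'[OF S that]
    proof (rule eventually_mono)
      fix z assume z: "z \<in> S"
      have "norm (N z v - N x v) = norm (N z (M z (N x v) - v))"
        using Ndiff[OF z that, of v] by (simp add: norm_minus_cancel)
      also have "\<dots> \<le> c * norm (M z (N x v) - v)" by (rule bdd[OF z])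
      also have "\<dots> \<le> \<bar>c\<bar> * norm (M z (N x v) - v)" by (intro mult_right_mono) auto
      finally show "norm (N z v - N x v) \<le> \<bar>c\<bar> * norm (M z (N x v) - v)" .
    qed
    then have "((\<lambda>z. N z v - N x v) \<longlongrightarrow> 0) (at x)" by (rule Lim_null_comparison[OF _ lim])
    then show ?thesis by (simp add: isCont_def LIM_zero_iff)
  qed
  define Q where "Q h x u = Diff (\<lambda>z. M z u) x h" for h x u
  have linQ: "linear (Q h x)" if "x \<in> S" for h x
  proof (rule linearI)
    have D: "((\<lambda>z. M z u) has_derivative Diff (\<lambda>z. M z u) x) (at x)" for u
      by (rule smooth_onD[OF smooth that])
    fix u w :: 'b and r :: real
    have "((\<lambda>z. M z (u + w)) has_derivative (\<lambda>h. Q h x u + Q h x w)) (at x)"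
      unfolding Q_def by (rule has_derivative_transform_within_open[OF has_derivative_add[OF D D] S that])
        (simp add: linear_add[OF linM])
    from Diff_eq[OF this] show "Q h x (u + w) = Q h x u + Q h x w" by (simp add: Q_def)
    have "((\<lambda>z. M z (r *\<^sub>R u)) has_derivative (\<lambda>h. r *\<^sub>R Q h x u)) (at x)"
      unfolding Q_def by (rule has_derivative_transform_within_open[OF has_derivative_scaleR_right[OF D] S that])
        (simp add: linear_scale[OF linM])
    from Diff_eq[OF this] show "Q h x (r *\<^sub>R u) = r *\<^sub>R Q h x u" by (simp add: Q_def)
  qed
  have smQ: "smooth_on S (\<lambda>x. Q h x u)" for h u unfolding Q_def by (rule smooth_on_Diff[OF smooth])
  have deriv: "((\<lambda>z. N z v) has_derivative (\<lambda>h. - N x (Q h x (N x v)))) (at x)" if x: "x \<in> S" for x v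
  proof -
    define p where "p z = M z (N x v) - v" for z
    have p: "(p has_derivative (\<lambda>h. Q h x (N x v))) (at x)"
      unfolding p_def[abs_def] Q_def using has_derivative_diff[OF smooth_onD[OF smooth x] has_derivative_const] by simp
    have p0: "p x = 0" by (simp add: p_def MN[OF x])
    \<comment> \<open>\<open>N z v = N x v - N z (p z)\<close>, where \<open>p\<close> vanishes at \<open>x\<close> and only \<open>p\<close> needs to be differentiated\<close>
    have "((\<lambda>z. N x v - (\<Sum>b\<in>B. (p z \<bullet> b) *\<^sub>R N z b)) has_derivative
       (\<lambda>h. 0 - (\<Sum>b\<in>B. (Q h x (N x v) \<bullet> b) *\<^sub>R N x b))) (at x)"
      by (intro has_derivative_diff has_derivative_const has_derivative_sum has_derivative_scaleR_vanishing
          has_derivative_inner_left p cont x) (simp add: p0)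
    moreover have "(\<Sum>b\<in>B. (u \<bullet> b) *\<^sub>R N z b) = N z u" if "z \<in> S" for u z
      by (rule orthonormal_basis_expand[OF B linN[OF that], symmetric])
    ultimately have "((\<lambda>z. N x v - (\<Sum>b\<in>B. (p z \<bullet> b) *\<^sub>R N z b)) has_derivative
       (\<lambda>h. - N x (Q h x (N x v)))) (at x)" using x by simp
    then show ?thesis
    proof (rule has_derivative_transform_within_open[OF _ S x])
      fix z assume z: "z \<in> S"
      have "(\<Sum>b\<in>B. (p z \<bullet> b) *\<^sub>R N z b) = N z (p z)"
        by (rule orthonormal_basis_expand[OF B linN[OF z], symmetric])
      then show "N x v - (\<Sum>b\<in>B. (p z \<bullet> b) *\<^sub>R N z b) = N z v"
        using Ndiff[OF z x, of v] by (simp add: p_def algebra_simps)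
    qed
  qed
  have "cont_diff_on S k (\<lambda>x. N x v)" for k v
  proof (induction k arbitrary: v)
    case 0
    then show ?case using cont by (simp add: continuous_at_imp_continuous_on)
  next
    case (Suc k)
    show ?case
    proof (rule cont_diff_on_SucI[OF S deriv])
      fix h
      have "cont_diff_on S k (\<lambda>x. Q h x (N x v))"
        using smQ unfolding smooth_on_def
        by (intro cont_diff_on_apply[OF S B linQ _ Suc.IH]) auto
      then have "cont_diff_on S k (\<lambda>x. N x (Q h x (N x v)))"
        by (intro cont_diff_on_apply[OF S B linN Suc.IH])
      then show "cont_diff_on S k (\<lambda>x. - N x (Q h x (N x v)))" by (rule cont_diff_on_minus[OF S])
    qed
  qed
  then show ?thesis by (simp add: smooth_on_def)
qed

lemma perturbed_identity_linear_inverse: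
  fixes M :: "'a::banach \<Rightarrow> 'a"
  assumes "linear M" "\<And>v. norm (M v - v) \<le> 1/2 * norm v"
  shows "linear (inv M)" "M (inv M v) = v" "inv M (M v) = v" "norm (inv M v) \<le> 2 * norm v"
proof -
  have lip: "norm ((M x - x) - (M y - y)) \<le> 1/2 * norm (x - y)" for x y
    using assms(2)[of "x - y"] by (simp add: linear_diff[OF assms(1)] algebra_simps)
  have inj: "inj M"
  proof (rule injI)
    fix x y assume "M x = M y"
    then show "x = y" using perturbed_identity_inj[of M x y, OF lip] by simp
  qed
  have surj: "\<exists>x. M x = w" for w
  proof -
    have "w \<in> cball (M 0) (2 * norm w / 2)" using linear_0[OF assms(1)] by simp
    moreover have "cball (M 0) (2 * norm w / 2) \<subseteq> M ` cball 0 (2 * norm w)"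
      by (rule perturbed_identity_surj[of UNIV, OF lip]) auto
    ultimately have "w \<in> M ` cball 0 (2 * norm w)" by blast
    then show "\<exists>x. M x = w" by blast
  qed
  then have "surj M" by (metis surjI)
  then show MN: "M (inv M v) = v" for v by (rule surj_f_inv_f)
  show NM: "inv M (M v) = v" for v by (rule inv_f_f[OF inj])
  show "linear (inv M)"
  proof (rule linearI)
    fix x y r
    have "inv M (M (inv M x + inv M y)) = inv M x + inv M y" by (rule NM)
    then show "inv M (x + y) = inv M x + inv M y" by (simp add: linear_add[OF assms(1)] MN)
    have "inv M (M (r *\<^sub>R inv M x)) = r *\<^sub>R inv M x" by (rule NM)
    then show "inv M (r *\<^sub>R x) = r *\<^sub>R inv M x" by (simp add: linear_scale[OF assms(1)] MN)
  qed
  show "norm (inv M v) \<le> 2 * norm v"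
    using perturbed_identity_inj[of M "inv M v" 0, OF lip] by (simp add: MN linear_0[OF assms(1)])
qed

text \<open>The inverse function theorem at a point where the derivative is the identity. Smoothness of the
  inverse \<open>g\<close> follows by induction from \<open>Dg y = (Df (g y))\<^sup>-\<^sup>1\<close>.\<close>

lemma inverse_function_smooth:
  fixes f :: "'a::{real_inner, banach} \<Rightarrow> 'a" and B :: "'a set"
  assumes S: "open S" and B: "orthonormal_basis B" and f: "smooth_on S f" and "x0 \<in> S"
    and id: "\<And>v. Diff f x0 v = v"
  obtains r g where "r > 0" "ball x0 r \<subseteq> S" "\<And>x. x \<in> ball x0 r \<Longrightarrow> g (f x) = x"
    "\<And>U. open U \<Longrightarrow> U \<subseteq> ball x0 r \<Longrightarrow> open (f ` U)" "smooth_on (f ` ball x0 r) g"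
proof -
  obtain r where r: "r > 0" "ball x0 r \<subseteq> S" and
    l: "\<forall>x\<in>ball x0 r. \<forall>y\<in>ball x0 r.
     norm ((f x - Diff f x0 x) - (f y - Diff f x0 y)) \<le> 1/2 * norm (x - y)"
    and d: "\<forall>x\<in>ball x0 r. \<forall>v. norm (Diff f x v - Diff f x0 v) \<le> 1/2 * norm v"
    using smooth_on_strict[OF S B f \<open>x0 \<in> S\<close>, of "1/2"] by auto
  let ?U = "ball x0 r"
  have lip: "norm ((f x - x) - (f y - y)) \<le> 1/2 * norm (x - y)" if "x \<in> ?U" "y \<in> ?U" for x y
    using l that by (simp add: id)
  have inj: "inj_on f ?U"
    using perturbed_identity_inj[of f, OF lip] by (intro inj_onI) fastforce
  have opn: "open (f ` U)" if "open U" "U \<subseteq> ?U" for U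
    using lip that by (intro perturbed_identity_open[of ?U]) auto
  define g where "g = the_inv_into ?U f"
  have gf: "g (f x) = x" if "x \<in> ?U" for x unfolding g_def by (rule the_inv_into_f_f[OF inj that])
  have V: "open (f ` ?U)" by (rule opn) auto
  have gcont: "continuous_on (f ` ?U) g"
  proof (rule continuous_on_open_vimage[OF V, THEN iffD2], intro allI impI)
    fix W :: "'a set" assume "open W"
    have "g -` W \<inter> f ` ?U = f ` (W \<inter> ?U)" using gf by force
    then show "open (g -` W \<inter> f ` ?U)" using opn[of "W \<inter> ?U"] open_Int[OF \<open>open W\<close> open_ball[of x0 r]] by simp
  qed
  define N where "N x = inv (Diff f x)" for x
  have linM: "linear (Diff f x)" if "x \<in> ?U" for x using smooth_on_linear_Diff[OF f] that r by blast
  have b: "norm (Diff f x v - v) \<le> 1/2 * norm v" if "x \<in> ?U" for x v using d that by (simp add: id)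
  note N = perturbed_identity_linear_inverse[OF linM b, folded N_def]
  have smN: "smooth_on ?U (\<lambda>x. N x v)" for v
    by (rule smooth_on_inverse_operator[of ?U B "Diff f" N 2])
      (use B N linM smooth_on_subset[OF smooth_on_Diff[OF f] r(2)] in auto)
  have derg: "(g has_derivative N (g y)) (at y)" if y: "y \<in> f ` ?U" for y
  proof -
    obtain x where x: "x \<in> ?U" "y = f x" using y by blast
    have gy: "g y = x" using gf x by simp
    show ?thesis unfolding gy
    proof (rule has_derivative_inverse_basic[OF _ _ _ _ V y])
      show "(f has_derivative Diff f x) (at (g y))" using smooth_onD[OF f, of x] x r gy by auto
      show "bounded_linear (N x)" by (rule linear_imp_bounded_linear[OF B N(1)[OF x(1) x(1)]])
      show "N x \<circ> Diff f x = id" using N(3)[OF x(1) x(1)] by auto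
      show "continuous (at y) g" using gcont y unfolding continuous_on_eq_continuous_at[OF V] by blast
      show "f (g z) = z" if "z \<in> f ` ?U" for z using that gf by auto
    qed
  qed
  have "cont_diff_on (f ` ?U) k g" for k
  proof (induction k)
    case 0
    then show ?case using gcont by simp
  next
    case (Suc k)
    show ?case
    proof (rule cont_diff_on_SucI[OF V derg])
      fix v
      show "cont_diff_on (f ` ?U) k (\<lambda>x. N (g x) v)"
        by (rule cont_diff_on_compose[OF V open_ball[of x0 r] B _ Suc.IH])
          (use smN gf in \<open>auto simp: smooth_on_def\<close>)
    qed
  qed
  then have "smooth_on (f ` ?U) g" by (simp add: smooth_on_def)
  then show thesis using that r gf opn by blast
qed

section \<open>Symmetry of second derivatives\<close>

text \<open>The mean value theorem, applied first in direction \<open>u\<close> and then in direction \<open>w\<close>, writes the second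
  difference over a small parallelogram as a second derivative at an intermediate point. The second
  difference is symmetric in \<open>u\<close> and \<open>w\<close>, and so letting the parallelogram shrink gives the symmetry of
  second derivatives.\<close>

lemma second_difference_mvt:
  fixes f :: "'a::real_normed_vector \<Rightarrow> real"
  assumes S: "open S" and f: "smooth_on S f" and "s > 0"
    and rect: "\<And>a b. a \<in> {0..s} \<Longrightarrow> b \<in> {0..s} \<Longrightarrow> x + a *\<^sub>R u + b *\<^sub>R w \<in> S"
  shows "\<exists>a\<in>{0..s}. \<exists>b\<in>{0..s}. f (x + s *\<^sub>R u + s *\<^sub>R w) - f (x + s *\<^sub>R u) - f (x + s *\<^sub>R w) + f x
     = s * s * Diff (\<lambda>y. Diff f y u) (x + a *\<^sub>R u + b *\<^sub>R w) w"
proof -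
  have fD: "(f has_derivative Diff f y) (at y)" if "y \<in> S" for y using smooth_onD[OF f that] .
  have gD: "((\<lambda>y. Diff f y u) has_derivative Diff (\<lambda>y. Diff f y u) y) (at y)" if "y \<in> S" for y
    using smooth_onD[OF smooth_on_Diff[OF f] that] .
  have line: "((\<lambda>t. y + t *\<^sub>R v) has_derivative (\<lambda>h. h *\<^sub>R v)) (at t)" for y v :: 'a and t :: real
    by (auto intro!: derivative_eq_intros)
  have "\<exists>a. 0 < a \<and> a < s \<and> (f (x + s *\<^sub>R u + s *\<^sub>R w) - f (x + s *\<^sub>R u)) - (f (x + 0 *\<^sub>R u + s *\<^sub>R w) - f (x + 0 *\<^sub>R u))
      = (s - 0) * (Diff f (x + a *\<^sub>R u + s *\<^sub>R w) u - Diff f (x + a *\<^sub>R u) u)"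
  proof (rule MVT2[OF \<open>s > 0\<close>])
    fix a assume a: "0 \<le> a" "a \<le> s"
    have 1: "x + s *\<^sub>R w + a *\<^sub>R u \<in> S" "x + a *\<^sub>R u \<in> S"
      using rect[of a s] rect[of a 0] a \<open>s > 0\<close> by (auto simp: algebra_simps)
    have "((\<lambda>t. f (x + s *\<^sub>R w + t *\<^sub>R u) - f (x + t *\<^sub>R u)) has_derivative
      (\<lambda>h. Diff f (x + s *\<^sub>R w + a *\<^sub>R u) (h *\<^sub>R u) - Diff f (x + a *\<^sub>R u) (h *\<^sub>R u))) (at a)"
      by (intro has_derivative_diff has_derivative_compose[OF line fD] 1)
    then have "((\<lambda>t. f (x + t *\<^sub>R u + s *\<^sub>R w) - f (x + t *\<^sub>R u)) has_derivative
      (\<lambda>h. (Diff f (x + a *\<^sub>R u + s *\<^sub>R w) u - Diff f (x + a *\<^sub>R u) u) * h)) (at a)"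
      using linear_scale[OF smooth_on_linear_Diff[OF f 1(1)]] linear_scale[OF smooth_on_linear_Diff[OF f 1(2)]]
      by (simp add: algebra_simps)
    then show "((\<lambda>t. f (x + t *\<^sub>R u + s *\<^sub>R w) - f (x + t *\<^sub>R u)) has_real_derivative
      Diff f (x + a *\<^sub>R u + s *\<^sub>R w) u - Diff f (x + a *\<^sub>R u) u) (at a)"
      by (simp add: has_field_derivative_def)
  qed
  then obtain a where a: "0 < a" "a < s" and A: "f (x + s *\<^sub>R u + s *\<^sub>R w) - f (x + s *\<^sub>R u) - f (x + s *\<^sub>R w) + f x
      = s * (Diff f (x + a *\<^sub>R u + s *\<^sub>R w) u - Diff f (x + a *\<^sub>R u) u)" by auto
  have "\<exists>b. 0 < b \<and> b < s \<and> Diff f (x + a *\<^sub>R u + s *\<^sub>R w) u - Diff f (x + a *\<^sub>R u + 0 *\<^sub>R w) u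
     = (s - 0) * Diff (\<lambda>y. Diff f y u) (x + a *\<^sub>R u + b *\<^sub>R w) w"
  proof (rule MVT2[OF \<open>s > 0\<close>])
    fix b assume b: "0 \<le> b" "b \<le> s"
    have 1: "x + a *\<^sub>R u + b *\<^sub>R w \<in> S" using rect a b by auto
    have "((\<lambda>t. Diff f (x + a *\<^sub>R u + t *\<^sub>R w) u) has_derivative
      (\<lambda>h. Diff (\<lambda>y. Diff f y u) (x + a *\<^sub>R u + b *\<^sub>R w) (h *\<^sub>R w))) (at b)"
      by (rule has_derivative_compose[OF line gD[OF 1]])
    then show "((\<lambda>t. Diff f (x + a *\<^sub>R u + t *\<^sub>R w) u) has_real_derivative
      Diff (\<lambda>y. Diff f y u) (x + a *\<^sub>R u + b *\<^sub>R w) w) (at b)"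
      using linear_scale[OF smooth_on_linear_Diff[OF smooth_on_Diff[OF f] 1]]
      by (simp add: has_field_derivative_def mult.commute[of _ "Diff _ _ _"])
  qed
  then obtain b where "0 < b" "b < s" and "Diff f (x + a *\<^sub>R u + s *\<^sub>R w) u - Diff f (x + a *\<^sub>R u) u
     = s * Diff (\<lambda>y. Diff f y u) (x + a *\<^sub>R u + b *\<^sub>R w) w" by auto
  then show ?thesis using A a by (intro bexI[of _ a] bexI[of _ b]) auto
qed

lemma second_derivative_symmetric_real:
  fixes f :: "'a::real_normed_vector \<Rightarrow> real"
  assumes S: "open S" and f: "smooth_on S f" and x: "x \<in> S"
  shows "Diff (\<lambda>y. Diff f y u) x w = Diff (\<lambda>y. Diff f y w) x u"
proof (rule ccontr)
  define P where "P y = Diff (\<lambda>y. Diff f y u) y w" for y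
  define Q where "Q y = Diff (\<lambda>y. Diff f y w) y u" for y
  assume "\<not> ?thesis"
  then have ne: "\<bar>P x - Q x\<bar> > 0" by (simp add: P_def Q_def)
  have "isCont P x" "isCont Q x"
    using smooth_on_continuous[OF smooth_on_Diff[OF smooth_on_Diff[OF f]]] S x
    unfolding P_def[abs_def] Q_def[abs_def] by (auto simp: continuous_on_eq_continuous_at)
  moreover have "\<bar>P x - Q x\<bar> / 3 > 0" using ne by simp
  ultimately obtain d1 d2 where d1: "d1 > 0" "\<And>y. dist y x < d1 \<Longrightarrow> dist (P y) (P x) < \<bar>P x - Q x\<bar> / 3"
    and d2: "d2 > 0" "\<And>y. dist y x < d2 \<Longrightarrow> dist (Q y) (Q x) < \<bar>P x - Q x\<bar> / 3"
    unfolding continuous_at_eps_delta by metis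
  obtain d3 where d3: "d3 > 0" "ball x d3 \<subseteq> S" using S x openE by blast
  define d where "d = min d1 (min d2 d3)"
  define s where "s = d / (norm u + norm w + 1)"
  have "norm u + norm w + 1 > 0" by (simp add: add_nonneg_pos)
  moreover have d: "d > 0" using d1 d2 d3 by (simp add: d_def)
  ultimately have s: "s > 0" and sd: "s * (norm u + norm w) < d"
    by (auto simp: s_def pos_divide_less_eq)
  have near: "dist (x + a *\<^sub>R u' + b *\<^sub>R w') x < d" if "a \<in> {0..s}" "b \<in> {0..s}" "norm u' + norm w' = norm u + norm w" for a b u' w'
  proof -
    have "dist (x + a *\<^sub>R u' + b *\<^sub>R w') x = norm (a *\<^sub>R u' + b *\<^sub>R w')" by (simp add: dist_norm)
    also have "\<dots> \<le> norm (a *\<^sub>R u') + norm (b *\<^sub>R w')" by (rule norm_triangle_ineq)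
    also have "\<dots> \<le> s * norm u' + s * norm w'" using that by (auto intro!: add_mono mult_right_mono)
    also have "\<dots> < d" using sd that(3) by (simp add: distrib_left[symmetric])
    finally show ?thesis .
  qed
  have inS: "y \<in> S" if "dist y x < d" for y using that d3 by (auto simp: d_def dist_commute)
  obtain a b where ab: "a \<in> {0..s}" "b \<in> {0..s}" and 1: "f (x + s *\<^sub>R u + s *\<^sub>R w) - f (x + s *\<^sub>R u) - f (x + s *\<^sub>R w) + f x
     = s * s * P (x + a *\<^sub>R u + b *\<^sub>R w)"
    using second_difference_mvt[OF S f s, of x u w] inS near unfolding P_def by blast
  obtain a' b' where ab': "a' \<in> {0..s}" "b' \<in> {0..s}" and 2: "f (x + s *\<^sub>R w + s *\<^sub>R u) - f (x + s *\<^sub>R w) - f (x + s *\<^sub>R u) + f x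
     = s * s * Q (x + a' *\<^sub>R w + b' *\<^sub>R u)"
    using second_difference_mvt[OF S f s, of x w u] inS near unfolding Q_def by (metis add.commute)
  have "s * s * P (x + a *\<^sub>R u + b *\<^sub>R w) = s * s * Q (x + a' *\<^sub>R w + b' *\<^sub>R u)"
    unfolding 1[symmetric] 2[symmetric] by (simp add: add.commute add.left_commute)
  then have eq: "P (x + a *\<^sub>R u + b *\<^sub>R w) = Q (x + a' *\<^sub>R w + b' *\<^sub>R u)" using s by simp
  have "dist (P (x + a *\<^sub>R u + b *\<^sub>R w)) (P x) < \<bar>P x - Q x\<bar> / 3"
    using near[OF ab, of u w] by (intro d1) (simp add: d_def)
  moreover have "dist (Q (x + a' *\<^sub>R w + b' *\<^sub>R u)) (Q x) < \<bar>P x - Q x\<bar> / 3"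
    using near[OF ab', of w u] by (intro d2) (simp add: d_def add.commute)
  ultimately show False using eq ne unfolding dist_real_def by (auto simp: abs_if split: if_splits)
qed

lemma second_derivative_symmetric:
  fixes f :: "'a::real_normed_vector \<Rightarrow> 'b::real_inner"
  assumes S: "open S" and f: "smooth_on S f" and x: "x \<in> S"
  shows "Diff (\<lambda>y. Diff f y u) x w = Diff (\<lambda>y. Diff f y w) x u"
proof -
  \<comment> \<open>testing against the difference itself reduces to the real-valued case\<close>
  define d where "d = Diff (\<lambda>y. Diff f y u) x w - Diff (\<lambda>y. Diff f y w) x u"
  define p where "p y = f y \<bullet> d" for y
  have p: "smooth_on S p"
    unfolding p_def[abs_def] by (rule smooth_on_linear_compose[OF S bounded_linear_inner_left f])
  have Dp: "Diff p y v = Diff f y v \<bullet> d" if "y \<in> S" for y v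
    unfolding p_def[abs_def] Diff_linear_compose[OF bounded_linear_inner_left f that] ..
  have "Diff (\<lambda>y. Diff p y v) x v' = Diff (\<lambda>y. Diff f y v) x v' \<bullet> d" for v v'
  proof -
    have "((\<lambda>y. Diff f y v \<bullet> d) has_derivative (\<lambda>v'. Diff (\<lambda>y. Diff f y v) x v' \<bullet> d)) (at x)"
      by (rule bounded_linear.has_derivative[OF bounded_linear_inner_left smooth_onD[OF smooth_on_Diff[OF f] x]])
    then have "((\<lambda>y. Diff p y v) has_derivative (\<lambda>v'. Diff (\<lambda>y. Diff f y v) x v' \<bullet> d)) (at x)"
      by (rule has_derivative_transform_within_open[OF _ S x]) (simp add: Dp)
    then show ?thesis by (simp add: Diff_eq)
  qed
  then have "d \<bullet> d = 0"
    using second_derivative_symmetric_real[OF S p x, of u w] by (simp add: d_def inner_diff_left)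
  then show ?thesis by (simp add: d_def)
qed

section \<open>Lagrangian subspaces\<close>

definition symplectic_form :: "'e::real_inner \<times> 'e \<Rightarrow> 'e \<times> 'e \<Rightarrow> real" where
  "symplectic_form w w' = fst w \<bullet> snd w' - snd w \<bullet> fst w'"

text \<open>The isometry \<open>J (q, y) = (- y, q)\<close> satisfies \<open>J w \<bullet> w' = \<omega>(w, w')\<close>. An orthonormal basis \<open>C\<close> of an
  isotropic subspace is therefore orthogonal to \<open>J ` C\<close>, and \<open>C \<union> J ` C\<close> is an orthonormal set in a
  space of dimension \<open>2 * card B\<close>.\<close>

lemma isotropic_card_le:
  fixes B :: "'e::real_inner set" and S :: "('e \<times> 'e) set"
  assumes B: "orthonormal_basis B" and S: "finite S" "independent S"
    and iso: "\<And>w w'. w \<in> span S \<Longrightarrow> w' \<in> span S \<Longrightarrow> symplectic_form w w' = 0"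
  shows "card S \<le> card B"
proof -
  obtain C where C: "orthonormal_set C" "span C = span S" using ex_orthonormal_set[OF S(1)] by blast
  have finC: "finite C" using C by (simp add: orthonormal_set_def)
  have cS: "card S \<le> card C"
    using independent_span_bound[OF finC S(2)] C(2) span_superset[of S] by simp
  define J :: "'e \<times> 'e \<Rightarrow> 'e \<times> 'e" where "J w = (- snd w, fst w)" for w
  have J0: "J w \<bullet> w' = symplectic_form w w'" and J0': "w \<bullet> J w' = - symplectic_form w w'" and J1: "J w \<bullet> J w' = w \<bullet> w'" for w w'
    by (simp_all add: J_def symplectic_form_def inner_prod_def inner_commute)
  have "inj J" by (rule injI) (simp add: J_def prod_eq_iff)
  have iso': "symplectic_form c d = 0" if "c \<in> C" "d \<in> C" for c d
    using iso C(2) that span_base by blast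
  have C1: "c \<bullet> d = (if c = d then 1 else 0)" if "c \<in> C" "d \<in> C" for c d
    using C(1) that by (simp add: orthonormal_set_def)
  have disj: "c \<noteq> J d" if "c \<in> C" "d \<in> C" for c d
  proof
    assume "c = J d"
    then have "c \<bullet> c = 0" using J0'[of c d] iso'[OF that] by simp
    then show False using C1[OF that(1,1)] by simp
  qed
  have "orthonormal_set (C \<union> J ` C)"
    unfolding orthonormal_set_def
  proof (intro conjI ballI)
    fix w w' assume "w \<in> C \<union> J ` C" "w' \<in> C \<union> J ` C"
    then show "w \<bullet> w' = (if w = w' then 1 else 0)"
    proof (elim UnE imageE)
      fix d assume "w \<in> C" "w' = J d" "d \<in> C"
      then show ?thesis using disj[of w d] J0'[of w d] iso'[of w d] by simp
    next
      fix c assume "w = J c" "c \<in> C" "w' \<in> C"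
      then show ?thesis using disj[of w' c] J0[of c w'] iso'[of c w'] by simp
    next
      fix c d assume "w = J c" "c \<in> C" "w' = J d" "d \<in> C"
      then show ?thesis using J1[of c d] C1[of c d] inj_eq[OF \<open>inj J\<close>, of c d] by simp
    qed (rule C1)
  qed (use finC in simp)
  then have ind: "independent (C \<union> J ` C)" by (rule orthonormal_set_independent)
  let ?BB = "(\<lambda>b. (b, 0)) ` B \<union> (\<lambda>b. (0, b)) ` B :: ('e \<times> 'e) set"
  have BB: "orthonormal_basis ?BB" by (rule orthonormal_basis_prod[OF B B])
  have "card (C \<union> J ` C) \<le> card ?BB"
    using independent_span_bound[OF orthonormal_basis_finite[OF BB] ind] BB
    by (simp add: orthonormal_basis_def)
  also have "\<dots> \<le> card B + card B"
    by (rule order_trans[OF card_Un_le]) (intro add_mono card_image_le orthonormal_basis_finite[OF B])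
  finally have "card (C \<union> J ` C) \<le> card B + card B" .
  moreover have "card (C \<union> J ` C) = card C + card C"
    using disj by (subst card_Un_disjoint) (auto simp: finC card_image[OF inj_on_subset[OF \<open>inj J\<close>]])
  ultimately show ?thesis using cS by linarith
qed

lemma symplectic_form_linear_right: "linear (symplectic_form w)" and symplectic_form_linear_left: "linear (\<lambda>w. symplectic_form w w')"
  by (auto intro!: linearI simp: symplectic_form_def inner_add_left inner_add_right algebra_simps)

lemma symplectic_form_self: "symplectic_form w w = 0" by (simp add: symplectic_form_def inner_commute)
lemma symplectic_form_swap: "symplectic_form w' w = - symplectic_form w w'" by (simp add: symplectic_form_def inner_commute)

text \<open>Adding to an isotropic subspace a vector that is \<open>\<omega>\<close>-orthogonal to it leaves it isotropic, because
  \<open>\<omega>(z, z) = 0\<close>. In the maximal dimension such a vector is therefore already contained in it.\<close>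

lemma lagrangian_maximal:
  fixes B :: "'e::real_inner set" and S :: "('e \<times> 'e) set"
  assumes B: "orthonormal_basis B" and S: "finite S" "independent S" "card S = card B"
    and iso: "\<And>w w'. w \<in> span S \<Longrightarrow> w' \<in> span S \<Longrightarrow> symplectic_form w w' = 0"
    and z: "\<And>w. w \<in> span S \<Longrightarrow> symplectic_form z w = 0"
  shows "z \<in> span S"
proof (rule ccontr)
  assume nz: "z \<notin> span S"
  have "card (insert z S) \<le> card B"
  proof (rule isotropic_card_le[OF B])
    show "independent (insert z S)" using nz S by (simp add: independent_insertI)
    fix w w' assume "w \<in> span (insert z S)" "w' \<in> span (insert z S)"
    then obtain a b where a: "w - a *\<^sub>R z \<in> span S" and b: "w' - b *\<^sub>R z \<in> span S"
      by (auto simp: span_insert)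
    define u u' where "u = w - a *\<^sub>R z" and "u' = w' - b *\<^sub>R z"
    have w: "w = u + a *\<^sub>R z" "w' = u' + b *\<^sub>R z" by (simp_all add: u_def u'_def)
    have "symplectic_form u u' = 0" "symplectic_form z u' = 0" "symplectic_form u z = 0" "symplectic_form z z = 0"
      using iso z a b symplectic_form_swap[of u z] by (simp_all add: u_def u'_def symplectic_form_self)
    then show "symplectic_form w w' = 0"
      unfolding w by (simp add: linear_add[OF symplectic_form_linear_left] linear_add[OF symplectic_form_linear_right]
          linear_scale[OF symplectic_form_linear_left] linear_scale[OF symplectic_form_linear_right])
  qed (use S in simp)
  moreover have "z \<notin> S" using nz span_base by blast
  ultimately show False using S by simp
qed

section \<open>Conditions along curves\<close>

lemma derivative_along_curve_in_span:
  fixes f :: "'a::real_normed_vector \<Rightarrow> 'b::real_inner"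
  assumes C: "orthonormal_set C" and f: "(f has_derivative f') (at (\<gamma> 0))"
    and \<gamma>: "(\<gamma> has_vector_derivative w) (at 0 within {0..})"
    and "e > 0" and 0: "\<And>t. 0 \<le> t \<Longrightarrow> t < e \<Longrightarrow> f (\<gamma> t) \<in> span C"
  shows "f' w \<in> span C"
proof -
  define p where "p x = x - oproj C x" for x
  have p: "bounded_linear p" unfolding p_def[abs_def]
    by (intro bounded_linear_sub bounded_linear_ident bounded_linear_oproj)
  have lf: "linear f'" using f has_derivative_linear by blast
  have "((\<lambda>t. p (f (\<gamma> t))) has_derivative (\<lambda>h. p (f' (h *\<^sub>R w)))) (at 0 within {0..})"
    using \<gamma> unfolding has_vector_derivative_def
    by (intro bounded_linear.has_derivative[OF p] has_derivative_compose[of \<gamma> _ 0 "{0..}" f, OF _ f])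
  then have 1: "((\<lambda>t. p (f (\<gamma> t))) has_vector_derivative p (f' w)) (at 0 within {0..})"
    by (simp add: has_vector_derivative_def linear_scale[OF lf] linear_scale[OF bounded_linear.linear[OF p]])
  have 2: "((\<lambda>t. p (f (\<gamma> t))) has_vector_derivative 0) (at 0 within {0..})"
  proof (rule has_vector_derivative_transform_within[OF _ \<open>e > 0\<close>])
    show "((\<lambda>t. 0) has_vector_derivative 0) (at 0 within {0..})" by (rule has_vector_derivative_const)
    show "0 = p (f (\<gamma> t))" if "t \<in> {0..}" "dist t 0 < e" for t
      using 0[of t] that oproj_id[OF C] by (simp add: p_def)
  qed simp
  have "at (0::real) within {0..} \<noteq> bot" by (simp add: at_within_Ici_at_right)
  then have "p (f' w) = 0" using vector_derivative_unique_within[OF _ 1 2] by blast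
  then show ?thesis using oproj_eq_iff[OF C, of "f' w"] by (simp add: p_def)
qed

lemma isCont_eventually_nhds:
  assumes "isCont f a" "open U" "f a \<in> U"
  shows "\<forall>\<^sub>F x in nhds a. f x \<in> U"
  using assms topological_tendstoD[of f "f a" "at a" U]
  by (auto simp: isCont_def eventually_nhds_conv_at)

text \<open>If the derivative is bounded by \<open>c\<close> times the function, then on an interval of radius \<open>e\<close> around a
  zero the maximum \<open>m\<close> of the norm satisfies \<open>m \<le> c * e * m\<close>, so \<open>m = 0\<close> for small \<open>e\<close>.\<close>

lemma gronwall_locally_zero:
  fixes g :: "real \<Rightarrow> 'b::real_normed_vector"
  assumes "0 < d" and g: "\<And>s. \<bar>s - a\<bar> < d \<Longrightarrow> (g has_vector_derivative g' s) (at s)"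
    and le: "\<And>s. \<bar>s - a\<bar> < d \<Longrightarrow> norm (g' s) \<le> c * norm (g s)" and "c > 0" and "g a = 0"
  shows "\<exists>e>0. e \<le> d \<and> (\<forall>s. \<bar>s - a\<bar> < e \<longrightarrow> g s = 0)"
proof -
  \<comment> \<open>this radius makes \<open>c * e \<le> 1/2\<close>\<close>
  define e where "e = min (d / 2) (1 / (2 * c))"
  have "c * e \<le> c * (1 / (2 * c))"
    using \<open>c > 0\<close> by (intro mult_left_mono) (simp_all add: e_def)
  then have "c * e \<le> 1/2" using \<open>c > 0\<close> by simp
  moreover have "e > 0" "e < d" using \<open>0 < d\<close> \<open>c > 0\<close> by (auto simp: e_def)
  ultimately have e: "e > 0" "e < d" "c * e \<le> 1/2" by blast+
  have "continuous_on (cball a e) (\<lambda>s. norm (g s))"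
  proof (intro continuous_on_norm continuous_at_imp_continuous_on ballI)
    fix s assume "s \<in> cball a e"
    then have "\<bar>s - a\<bar> < d" using e by (simp add: dist_real_def abs_minus_commute)
    then show "isCont g s" using has_vector_derivative_continuous[OF g] by simp
  qed
  then obtain m where m: "m \<in> cball a e" "\<And>s. s \<in> cball a e \<Longrightarrow> norm (g s) \<le> norm (g m)"
    using continuous_attains_sup[of "cball a e" "\<lambda>s. norm (g s)"] e(1) compact_cball by force
  have "norm (g m - g a) \<le> (c * norm (g m)) * norm (m - a)"
  proof (rule differentiable_bound[of "cball a e" g "\<lambda>s h. h *\<^sub>R g' s"])
    fix s assume s: "s \<in> cball a e"
    then have sd: "\<bar>s - a\<bar> < d" using e by (auto simp: dist_real_def)
    show "(g has_derivative (\<lambda>h. h *\<^sub>R g' s)) (at s within cball a e)"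
      using g[OF sd] unfolding has_vector_derivative_def by (rule has_derivative_at_withinI)
    have "norm (g' s) \<le> c * norm (g m)"

      using order_trans[OF le[OF sd] mult_left_mono[OF m(2)[OF s], of c]] \<open>c > 0\<close> by simp
    then have le': "\<bar>h\<bar> * norm (g' s) \<le> c * norm (g m) * \<bar>h\<bar>" for h
      using mult_left_mono[of "norm (g' s)" "c * norm (g m)" "\<bar>h\<bar>"] by (simp only: mult.commute abs_ge_zero simp_thms)
    have "0 \<le> c * norm (g m)" using \<open>c > 0\<close> by simp
    then show "onorm (\<lambda>h. h *\<^sub>R g' s) \<le> c * norm (g m)"
      by (rule onorm_bound) (simp only: norm_scaleR real_norm_def le')
  qed (use m e in auto)
  also have "\<dots> \<le> (c * norm (g m)) * e"
    using m(1) \<open>c > 0\<close> by (intro mult_left_mono) (auto simp: dist_real_def)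
  also have "\<dots> = (c * e) * norm (g m)" by simp
  also have "\<dots> \<le> 1/2 * norm (g m)" using e by (intro mult_right_mono) auto
  finally have "norm (g m) = 0" using \<open>g a = 0\<close> by simp
  then have "\<forall>s. \<bar>s - a\<bar> < e \<longrightarrow> g s = 0"
    using m(2) by (simp add: dist_real_def abs_minus_commute)
  with e(1) less_imp_le[OF e(2)] show ?thesis by blast
qed

text \<open>A connectedness argument: the last assumption says that \<open>A\<close> is open in \<open>I\<close>, expressed
  multiplicatively since it will come from an action by dilations.\<close>

lemma multiplicative_continuation:
  fixes A I :: "real set"
  assumes I: "connected I" "I \<subseteq> {0<..}" and "s0 \<in> A" "s0 \<in> I"
    and closed: "closedin (top_of_set I) (A \<inter> I)"
    and opn: "\<And>s. s \<in> A \<Longrightarrow> s \<in> I \<Longrightarrow> \<exists>e>0. \<forall>t. \<bar>t - 1\<bar> < e \<longrightarrow> t * s \<in> A"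
  shows "I \<subseteq> A"
proof -
  have "openin (top_of_set I) (A \<inter> I)"
    unfolding openin_euclidean_subtopology_iff
  proof (intro conjI ballI)
    fix s assume s: "s \<in> A \<inter> I"
    then have "s > 0" using I by auto
    obtain e where e: "e > 0" "\<And>t. \<bar>t - 1\<bar> < e \<Longrightarrow> t * s \<in> A" using opn s by blast
    show "\<exists>e>0. \<forall>t\<in>I. dist t s < e \<longrightarrow> t \<in> A \<inter> I"
    proof (intro exI[of _ "e * s"] conjI ballI impI)
      show "e * s > 0" using e \<open>s > 0\<close> by simp
      fix t assume t: "t \<in> I" "dist t s < e * s"
      have "\<bar>t / s - 1\<bar> = \<bar>t - s\<bar> / s" using \<open>s > 0\<close> by (simp add: abs_div_pos diff_divide_distrib)
      also have "\<dots> < e" using t \<open>s > 0\<close> by (simp add: dist_real_def pos_divide_less_eq)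
      finally have "t / s * s \<in> A" by (rule e(2))
      then show "t \<in> A \<inter> I" using t \<open>s > 0\<close> by simp
    qed
  qed auto
  then have "A \<inter> I = {} \<or> A \<inter> I = I" using closed I(1) connected_clopen by blast
  then show ?thesis using assms(3,4) by blast
qed

section \<open>Vanishing of the Liouville form in coordinates\<close>

text \<open>The local picture of a submanifold on which \<open>\<theta>\<close> vanishes. Points of \<open>S\<close> are pairs \<open>(q, y)\<close> of base
  and fibre coordinates on the cotangent bundle, so that \<open>\<theta>\<close> is \<open>y \<bullet> dq\<close>. The map \<open>\<phi>\<close>, with inverse \<open>\<psi>\<close>,
  passes to a slice chart in which the submanifold \<open>Lam\<close> becomes the linear subspace \<open>span CF\<close>, of half
  the dimension. The last assumption says that \<open>\<theta>\<close> vanishes on the tangent vectors \<open>D\<psi> u\<close> of \<open>Lam\<close>.\<close>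

locale theta_null_chart =
  fixes B :: "'e::{real_inner, banach} set" and S \<Omega> :: "('e \<times> 'e) set"
    and \<phi> \<psi> :: "'e \<times> 'e \<Rightarrow> 'e \<times> 'e" and CF :: "('e \<times> 'e) set"
  assumes B: "orthonormal_basis B" and S: "open S" and \<Omega>: "open \<Omega>"
    and \<phi>: "smooth_on S \<phi>" and \<psi>: "smooth_on \<Omega> \<psi>"
    and \<phi>_in: "x \<in> S \<Longrightarrow> \<phi> x \<in> \<Omega>" and \<psi>_in: "z \<in> \<Omega> \<Longrightarrow> \<psi> z \<in> S"
    and \<psi>\<phi>: "x \<in> S \<Longrightarrow> \<psi> (\<phi> x) = x" and \<phi>\<psi>: "z \<in> \<Omega> \<Longrightarrow> \<phi> (\<psi> z) = z"
    and CF: "orthonormal_set CF" "card CF = card B"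
    and null: "z \<in> \<Omega> \<Longrightarrow> z \<in> span CF \<Longrightarrow> u \<in> span CF \<Longrightarrow> snd (\<psi> z) \<bullet> fst (Diff \<psi> z u) = 0"
begin

definition Lam where "Lam = {x \<in> S. \<phi> x \<in> span CF}"

definition Tan where "Tan x = {w. Diff \<phi> x w \<in> span CF}"

definition BB :: "('e \<times> 'e) set" where "BB = (\<lambda>b. (b, 0)) ` B \<union> (\<lambda>b. (0, b)) ` B"

lemma BB: "orthonormal_basis BB" unfolding BB_def by (rule orthonormal_basis_prod[OF B B])

text \<open>The component normal to \<open>span CF\<close>: the composition \<open>perp \<circ> \<phi>\<close> is a defining function of \<open>Lam\<close>.\<close>

definition perp where "perp x = x - oproj CF x"

lemma perp_bounded_linear: "bounded_linear perp"
  unfolding perp_def[abs_def] by (intro bounded_linear_sub bounded_linear_ident bounded_linear_oproj)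

lemmas perp_linear = bounded_linear.linear[OF perp_bounded_linear]

lemma perp_eq_0: "perp x = 0 \<longleftrightarrow> x \<in> span CF"
  using oproj_eq_iff[OF CF(1), of x] by (auto simp: perp_def)

lemma Lam_iff: "x \<in> S \<Longrightarrow> x \<in> Lam \<longleftrightarrow> perp (\<phi> x) = 0"
  by (simp add: Lam_def perp_eq_0)

lemma Lam_in_S: "x \<in> Lam \<Longrightarrow> x \<in> S" by (simp add: Lam_def)

lemma Diff_\<phi>: "x \<in> S \<Longrightarrow> (\<phi> has_derivative Diff \<phi> x) (at x)" by (rule smooth_onD[OF \<phi>])
lemma Diff_\<psi>: "z \<in> \<Omega> \<Longrightarrow> (\<psi> has_derivative Diff \<psi> z) (at z)" by (rule smooth_onD[OF \<psi>])
lemma linear_Diff_\<phi>: "x \<in> S \<Longrightarrow> linear (Diff \<phi> x)" by (rule smooth_on_linear_Diff[OF \<phi>])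
lemma linear_Diff_\<psi>: "z \<in> \<Omega> \<Longrightarrow> linear (Diff \<psi> z)" by (rule smooth_on_linear_Diff[OF \<psi>])

lemma Diff_\<psi>_\<phi>:
  assumes "x \<in> S" shows "Diff \<psi> (\<phi> x) (Diff \<phi> x w) = w"
proof -
  have "((\<lambda>x. \<psi> (\<phi> x)) has_derivative (\<lambda>w. Diff \<psi> (\<phi> x) (Diff \<phi> x w))) (at x)"
    by (rule has_derivative_compose[OF Diff_\<phi>[OF assms] Diff_\<psi>[OF \<phi>_in[OF assms]]])
  then have "((\<lambda>x. x) has_derivative (\<lambda>w. Diff \<psi> (\<phi> x) (Diff \<phi> x w))) (at x)"
    by (rule has_derivative_transform_within_open[OF _ S assms]) (simp add: \<psi>\<phi>)
  from has_derivative_unique[OF this has_derivative_ident] show ?thesis by (rule fun_cong)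
qed

lemma Diff_\<phi>_\<psi>:
  assumes "z \<in> \<Omega>" shows "Diff \<phi> (\<psi> z) (Diff \<psi> z w) = w"
proof -
  have "((\<lambda>x. \<phi> (\<psi> x)) has_derivative (\<lambda>w. Diff \<phi> (\<psi> z) (Diff \<psi> z w))) (at z)"
    by (rule has_derivative_compose[OF Diff_\<psi>[OF assms] Diff_\<phi>[OF \<psi>_in[OF assms]]])
  then have "((\<lambda>x. x) has_derivative (\<lambda>w. Diff \<phi> (\<psi> z) (Diff \<psi> z w))) (at z)"
    by (rule has_derivative_transform_within_open[OF _ \<Omega> assms]) (simp add: \<phi>\<psi>)
  from has_derivative_unique[OF this has_derivative_ident] show ?thesis by (rule fun_cong)
qed

lemma subspace_Tan: "x \<in> S \<Longrightarrow> subspace (Tan x)"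
  using linear_subspace_vimage[OF linear_Diff_\<phi> subspace_span] by (simp add: Tan_def vimage_def)

text \<open>This is \<open>d\<theta> = 0\<close> on \<open>Lam\<close>. Differentiating \<open>y \<bullet> Dq u = 0\<close> in a direction \<open>v\<close> tangent to \<open>span CF\<close> gives
  \<open>Dy v \<bullet> Dq u + y \<bullet> D\<^sup>2q(u, v) = 0\<close>. The second term is symmetric in \<open>u\<close> and \<open>v\<close>, hence so is the first.\<close>

lemma Tan_isotropic:
  assumes x: "x \<in> Lam" and w: "w \<in> Tan x" "w' \<in> Tan x"
  shows "symplectic_form w w' = 0"
proof -
  define z where "z = \<phi> x"
  have xS: "x \<in> S" using x by (rule Lam_in_S)
  have z: "z \<in> \<Omega>" "z \<in> span CF" using x \<phi>_in by (auto simp: z_def Lam_def)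
  have \<psi>z: "\<psi> z = x" using xS by (simp add: z_def \<psi>\<phi>)
  define D where "D u v = fst (Diff (\<lambda>y. Diff \<psi> y u) z v)" for u v
  have sym: "D u v = D v u" for u v
    unfolding D_def by (simp add: second_derivative_symmetric[OF \<Omega> \<psi> z(1)])
  have *: "snd (Diff \<psi> z v) \<bullet> fst (Diff \<psi> z u) + snd x \<bullet> D u v = 0"
    if u: "u \<in> span CF" and v: "v \<in> span CF" for u v
  proof -
    define f where "f y = snd (\<psi> y) \<bullet> fst (Diff \<psi> y u)" for y
    have f: "(f has_derivative (\<lambda>v. snd (\<psi> z) \<bullet> D u v + snd (Diff \<psi> z v) \<bullet> fst (Diff \<psi> z u))) (at z)"
      unfolding f_def[abs_def] D_def
      by (intro has_derivative_inner has_derivative_snd has_derivative_fst Diff_\<psi> z smooth_onD[OF smooth_on_Diff[OF \<psi>]])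
    obtain e where e: "e > 0" "ball z e \<subseteq> \<Omega>" using z \<Omega> openE by blast
    have "snd (\<psi> z) \<bullet> D u v + snd (Diff \<psi> z v) \<bullet> fst (Diff \<psi> z u) \<in> span {}"
    proof (rule derivative_along_curve_in_span[where f = f and \<gamma> = "\<lambda>t. z + t *\<^sub>R v" and e = "e / (norm v + 1)" and w = v])
      show "((\<lambda>t. z + t *\<^sub>R v) has_vector_derivative v) (at 0 within {0..})"
        by (auto intro!: derivative_eq_intros)
      fix t :: real assume t: "0 \<le> t" "t < e / (norm v + 1)"
      have "norm v + 1 > 0" by (simp add: add_nonneg_pos)
      then have "t * (norm v + 1) < e" using t by (simp add: pos_less_divide_eq)
      moreover have "t * norm v \<le> t * (norm v + 1)" using t by (simp add: mult_left_mono)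
      ultimately have "z + t *\<^sub>R v \<in> \<Omega>" using e t by (auto simp: dist_norm subset_eq)
      moreover have "z + t *\<^sub>R v \<in> span CF" using z v by (intro span_add span_scale)
      ultimately show "f (z + t *\<^sub>R v) \<in> span {}" using null u by (simp add: f_def)
    qed (use f e in \<open>auto simp: orthonormal_set_def intro!: divide_pos_pos add_nonneg_pos\<close>)
    then show ?thesis by (simp add: \<psi>z)
  qed
  define u v where "u = Diff \<phi> x w" and "v = Diff \<phi> x w'"
  have "u \<in> span CF" "v \<in> span CF" using w by (simp_all add: Tan_def u_def v_def)
  note * = *[OF this] *[OF this(2,1)]
  have "Diff \<psi> z u = w" "Diff \<psi> z v = w'" by (simp_all add: u_def v_def z_def Diff_\<psi>_\<phi>[OF xS])
  then show ?thesis using * sym[of u v] by (simp add: symplectic_form_def inner_commute)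
qed

text \<open>The tangent space is the isomorphic image of \<open>span CF\<close> under \<open>D\<psi>\<close>, so it has the dimension \<open>card B\<close> of a
  maximal isotropic subspace.\<close>

lemma Tan_maximal:
  assumes x: "x \<in> Lam" and w: "\<And>w'. w' \<in> Tan x \<Longrightarrow> symplectic_form w w' = 0"
  shows "w \<in> Tan x"
proof -
  define z where "z = \<phi> x"
  have xS: "x \<in> S" using x by (rule Lam_in_S)
  have z: "z \<in> \<Omega>" "z \<in> span CF" using x \<phi>_in by (auto simp: z_def Lam_def)
  have \<psi>z: "\<psi> z = x" using xS by (simp add: z_def \<psi>\<phi>)
  have lin: "linear (Diff \<psi> z)" by (rule linear_Diff_\<psi>[OF z(1)])
  have inj: "inj (Diff \<psi> z)" using Diff_\<phi>_\<psi>[OF z(1)] by (rule inj_on_inverseI)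
  let ?S = "Diff \<psi> z ` CF"
  have span: "span ?S = Tan x"
  proof -
    have "span ?S = Diff \<psi> z ` span CF" by (rule linear_span_image[OF lin])
    also have "\<dots> = Tan x"
    proof (intro equalityI subsetI)
      fix w assume "w \<in> Diff \<psi> z ` span CF"
      then show "w \<in> Tan x" using Diff_\<phi>_\<psi>[OF z(1)] by (auto simp: Tan_def \<psi>z)
    next
      fix w assume "w \<in> Tan x"
      then show "w \<in> Diff \<psi> z ` span CF" using Diff_\<psi>_\<phi>[OF xS, of w]
        by (intro image_eqI[of _ _ "Diff \<phi> x w"]) (auto simp: Tan_def z_def)
    qed
    finally show ?thesis .
  qed
  have "w \<in> span ?S"
  proof (rule lagrangian_maximal[OF B])
    show "finite ?S" using CF by (simp add: orthonormal_set_def)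
    show "independent ?S"
      by (rule linear_independent_injective_image[OF lin orthonormal_set_independent[OF CF(1)] inj_on_subset[OF inj subset_UNIV]])
    show "card ?S = card B" using CF(2) card_image[OF inj_on_subset[OF inj]] by simp
  qed (use w Tan_isotropic[OF x] in \<open>auto simp: span\<close>)
  then show ?thesis by (simp add: span)
qed

text \<open>The Liouville vector field \<open>(0, y)\<close> satisfies \<open>\<omega>((0, y), w) = - \<theta>(w)\<close>, so it is \<open>\<omega>\<close>-orthogonal to
  \<open>Lam\<close>, and therefore tangent to \<open>Lam\<close> by maximality.\<close>

lemma Tan_vertical:
  assumes "(q, y) \<in> Lam"
  shows "(0, y) \<in> Tan (q, y)"
proof (rule Tan_maximal[OF assms])
  fix w assume w: "w \<in> Tan (q, y)"
  have "(q, y) \<in> S" and "\<phi> (q, y) \<in> span CF" using assms by (auto simp: Lam_def)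
  then have "snd (\<psi> (\<phi> (q, y))) \<bullet> fst (Diff \<psi> (\<phi> (q, y)) (Diff \<phi> (q, y) w)) = 0"
    using w by (intro null \<phi>_in) (auto simp: Tan_def)
  then show "symplectic_form (0, y) w = 0" using \<open>(q, y) \<in> S\<close> by (simp add: symplectic_form_def \<psi>\<phi> Diff_\<psi>_\<phi>)
qed

lemma Tan_curve:
  assumes "\<gamma> 0 = x" "x \<in> S" "(\<gamma> has_vector_derivative w) (at 0 within {0..})" "e > 0"
    "\<And>t. 0 \<le> t \<Longrightarrow> t < e \<Longrightarrow> \<gamma> t \<in> Lam"
  shows "w \<in> Tan x"
  using derivative_along_curve_in_span[OF CF(1), of \<phi> "Diff \<phi> x" \<gamma> w e] assms Diff_\<phi>
  by (auto simp: Tan_def Lam_def)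

text \<open>The Liouville vector field generates the fibrewise dilations. As it is tangent to \<open>Lam\<close>, its flow
  preserves \<open>Lam\<close> locally. No flow is needed for this, since its trajectories are known: along
  \<open>s \<mapsto> (q, s y)\<close> the function \<open>g = perp \<circ> \<phi>\<close> has the derivative \<open>K / s\<close>, where \<open>K\<close> is the image under
  \<open>perp\<close> of the Liouville field in slice coordinates. Because \<open>K\<close> is Lipschitz and zero on \<open>span CF\<close>,
  it is bounded by a multiple of \<open>g\<close>, and \<open>g\<close> vanishes by Gronwall's argument.\<close>

lemma dilation_local:
  assumes x: "(q, y) \<in> Lam"
  shows "\<exists>e>0. \<forall>s. \<bar>s - 1\<bar> < e \<longrightarrow> (q, s *\<^sub>R y) \<in> Lam"
proof -
  define K where "K z = perp (Diff \<phi> (\<psi> z) (0, snd (\<psi> z)))" for z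
  have smK: "smooth_on \<Omega> K"
    unfolding K_def[abs_def]
  proof (rule smooth_on_linear_compose[OF \<Omega> perp_bounded_linear],
      rule smooth_on_apply[OF \<Omega> BB linear_Diff_\<phi>[OF \<psi>_in]])
    show "smooth_on \<Omega> (\<lambda>z. Diff \<phi> (\<psi> z) v)" for v
      using \<psi>_in by (intro smooth_on_compose[OF BB \<Omega> S _ \<psi> smooth_on_Diff[OF \<phi>]]) auto
    have "bounded_linear (\<lambda>w::'e \<times> 'e. (0 :: 'e, snd w))"
      by (intro bounded_linear_Pair bounded_linear_zero bounded_linear_snd)
    from smooth_on_linear_compose[OF \<Omega> this \<psi>] show "smooth_on \<Omega> (\<lambda>z. (0 :: 'e, snd (\<psi> z)))" .
  qed
  have K0: "K z = 0" if "z \<in> \<Omega>" "z \<in> span CF" for z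
  proof -
    have "\<psi> z \<in> Lam" using that by (simp add: Lam_def \<psi>_in \<phi>\<psi>)
    then have "(0, snd (\<psi> z)) \<in> Tan (\<psi> z)" using Tan_vertical[of "fst (\<psi> z)" "snd (\<psi> z)"] by simp
    then show ?thesis by (simp add: K_def Tan_def perp_eq_0)
  qed
  define z0 where "z0 = \<phi> (q, y)"
  have xS: "(q, y) \<in> S" using x by (rule Lam_in_S)
  have z0: "z0 \<in> \<Omega>" "z0 \<in> span CF" using x \<phi>_in by (auto simp: z0_def Lam_def)
  obtain r C where r: "r > 0" "ball z0 r \<subseteq> \<Omega>" and "C > 0"
    and lip: "\<And>x y. x \<in> ball z0 r \<Longrightarrow> y \<in> ball z0 r \<Longrightarrow> norm (K x - K y) \<le> C * norm (x - y)"
    using smooth_on_locally_lipschitz[OF \<Omega> BB smK z0(1)] by blast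
  \<comment> \<open>compare \<open>z\<close> with its orthogonal projection to \<open>span CF\<close>, where \<open>K\<close> vanishes\<close>
  have Kle: "norm (K z) \<le> C * norm (perp z)" if z: "z \<in> ball z0 r" for z
  proof -
    have "oproj CF z - z0 = oproj CF (z - z0)"
      using oproj_id[OF CF(1) z0(2)] by (simp add: linear_diff[OF linear_oproj])
    then have "norm (oproj CF z - z0) \<le> norm (z - z0)" using norm_oproj_le[OF CF(1), of "z - z0"] by simp
    then have p: "oproj CF z \<in> ball z0 r" using z by (simp add: dist_norm norm_minus_commute)
    then have "K (oproj CF z) = 0" using r by (intro K0 oproj_in_span) auto
    then show ?thesis using lip[OF z p] by (simp add: perp_def)
  qed
  have lineD: "((\<lambda>s. (q, s *\<^sub>R y)) has_vector_derivative (0, y)) (at s)" for s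
    by (auto intro!: derivative_eq_intros)
  have "isCont (\<lambda>s. (q, s *\<^sub>R y)) 1" using has_vector_derivative_continuous[OF lineD] by simp
  moreover have "isCont \<phi> (q, 1 *\<^sub>R y)" using has_derivative_continuous[OF Diff_\<phi>[OF xS]] by simp
  ultimately have "isCont (\<lambda>s. \<phi> (q, s *\<^sub>R y)) 1" by (rule isCont_o2)
  then have "\<forall>\<^sub>F s in nhds 1. \<phi> (q, s *\<^sub>R y) \<in> ball z0 r"
    by (rule isCont_eventually_nhds) (simp_all add: z0_def r(1))
  moreover have "\<forall>\<^sub>F s in nhds 1. (q, s *\<^sub>R y) \<in> S"
    using \<open>isCont (\<lambda>s. (q, s *\<^sub>R y)) 1\<close> by (rule isCont_eventually_nhds) (simp_all add: S xS)
  ultimately have "\<forall>\<^sub>F s in nhds 1. \<phi> (q, s *\<^sub>R y) \<in> ball z0 r \<and> (q, s *\<^sub>R y) \<in> S"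
    by (rule eventually_conj)
  then obtain d0 where d0: "d0 > 0" "\<And>s. dist s 1 < d0 \<Longrightarrow> \<phi> (q, s *\<^sub>R y) \<in> ball z0 r \<and> (q, s *\<^sub>R y) \<in> S"
    unfolding eventually_nhds_metric by blast
  define d where "d = min d0 (1/2)"
  have d: "d > 0" using d0 by (simp add: d_def)
  have near: "\<phi> (q, s *\<^sub>R y) \<in> ball z0 r" "(q, s *\<^sub>R y) \<in> S" "s \<ge> 1/2" if "\<bar>s - 1\<bar> < d" for s
  proof -
    have "\<bar>s - 1\<bar> < d0" "\<bar>s - 1\<bar> < 1/2" using that by (simp_all add: d_def)
    then show "\<phi> (q, s *\<^sub>R y) \<in> ball z0 r" "(q, s *\<^sub>R y) \<in> S"
      using d0(2)[of s] by (simp_all add: dist_real_def)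
    show "s \<ge> 1/2" using \<open>\<bar>s - 1\<bar> < 1/2\<close> by linarith
  qed
  define g where "g s = perp (\<phi> (q, s *\<^sub>R y))" for s
  have "\<exists>e>0. e \<le> d \<and> (\<forall>s. \<bar>s - 1\<bar> < e \<longrightarrow> g s = 0)"
  proof (rule gronwall_locally_zero[where g' = "\<lambda>s. perp (Diff \<phi> (q, s *\<^sub>R y) (0, y))" and c = "2 * C"])
    fix s assume s: "\<bar>s - 1\<bar> < d"
    note sS = near(2)[OF s]
    have "(g has_derivative (\<lambda>h. perp (Diff \<phi> (q, s *\<^sub>R y) (h *\<^sub>R (0, y))))) (at s)"
      unfolding g_def[abs_def]
      by (rule bounded_linear.has_derivative[OF perp_bounded_linear], rule has_derivative_compose[of "\<lambda>s. (q, s *\<^sub>R y)" _ s UNIV \<phi>, OF _ Diff_\<phi>[OF sS]])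
        (use lineD in \<open>simp add: has_vector_derivative_def\<close>)
    moreover have "perp (Diff \<phi> (q, s *\<^sub>R y) (h *\<^sub>R (0, y))) = h *\<^sub>R perp (Diff \<phi> (q, s *\<^sub>R y) (0, y))" for h
      by (simp only: linear_scale[OF linear_Diff_\<phi>[OF sS]] linear_scale[OF perp_linear])
    ultimately show "(g has_vector_derivative perp (Diff \<phi> (q, s *\<^sub>R y) (0, y))) (at s)"
      by (simp only: has_vector_derivative_def)
    have "K (\<phi> (q, s *\<^sub>R y)) = perp (Diff \<phi> (q, s *\<^sub>R y) (s *\<^sub>R (0, y)))"
      using \<psi>\<phi>[OF sS] by (simp add: K_def)
    also have "\<dots> = s *\<^sub>R perp (Diff \<phi> (q, s *\<^sub>R y) (0, y))"
      by (simp only: linear_scale[OF linear_Diff_\<phi>[OF sS]] linear_scale[OF perp_linear])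
    finally have "s * norm (perp (Diff \<phi> (q, s *\<^sub>R y) (0, y))) = norm (K (\<phi> (q, s *\<^sub>R y)))"
      using near(3)[OF s] by simp
    also have "\<dots> \<le> C * norm (g s)" unfolding g_def by (rule Kle[OF near(1)[OF s]])
    finally have "s * norm (perp (Diff \<phi> (q, s *\<^sub>R y) (0, y))) \<le> C * norm (g s)" .
    moreover have "1/2 * norm (perp (Diff \<phi> (q, s *\<^sub>R y) (0, y))) \<le> s * norm (perp (Diff \<phi> (q, s *\<^sub>R y) (0, y)))"
      using near(3)[OF s] by (intro mult_right_mono) auto
    ultimately show "norm (perp (Diff \<phi> (q, s *\<^sub>R y) (0, y))) \<le> 2 * C * norm (g s)" by linarith
  qed (use d \<open>C > 0\<close> z0 in \<open>auto simp: g_def z0_def perp_eq_0\<close>)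
  then obtain e where "e > 0" "e \<le> d" "\<And>s. \<bar>s - 1\<bar> < e \<Longrightarrow> g s = 0" by blast
  then show ?thesis using near(2) Lam_iff by (intro exI[of _ e]) (auto simp: g_def)
qed

text \<open>The local statement holds at every point of the segment that lies in \<open>Lam\<close>, and \<open>Lam\<close> is closed in \<open>S\<close>,
  so continuation along the segment reaches every \<open>s > 0\<close>, and by closedness also \<open>s = 0\<close>.\<close>

lemma dilation_box:
  assumes box: "\<And>s. 0 \<le> s \<Longrightarrow> s \<le> 1 \<Longrightarrow> (q, s *\<^sub>R y) \<in> S" and x: "(q, y) \<in> Lam"
    and s: "0 \<le> s" "s \<le> 1"
  shows "(q, s *\<^sub>R y) \<in> Lam"
proof -
  define g where "g s = perp (\<phi> (q, s *\<^sub>R y))" for s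
  have g: "continuous_on {0..1} g"
    unfolding g_def[abs_def]
    using box by (intro continuous_on_compose2[OF smooth_on_continuous[OF smooth_on_linear_compose[OF S perp_bounded_linear \<phi>]]]
        continuous_intros) auto
  define A where "A = {s. (q, s *\<^sub>R y) \<in> Lam}"
  have A: "s \<in> A \<longleftrightarrow> g s = 0" if "0 \<le> s" "s \<le> 1" for s
    using Lam_iff[OF box[OF that]] by (simp add: A_def g_def)
  have sub: "{0<..1} \<subseteq> A"
  proof (rule multiplicative_continuation[of _ 1])
    have "s \<in> {s \<in> {0<..1}. g s = 0} \<longleftrightarrow> s \<in> A \<inter> {0<..1}" for s using A[of s] by auto
    then have "{s \<in> {0<..1}. g s = 0} = A \<inter> {0<..1}" by blast
    moreover have "continuous_on {0<..1} g" by (rule continuous_on_subset[OF g]) auto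
    ultimately show "closedin (top_of_set {0<..1}) (A \<inter> {0<..1})"
      using continuous_closedin_preimage_constant[of "{0<..1}" g 0] by simp
    show "1 \<in> A" using x by (simp add: A_def)
    fix s assume "s \<in> A"
    then have "(q, s *\<^sub>R y) \<in> Lam" by (simp add: A_def)
    from dilation_local[OF this] show "\<exists>e>0. \<forall>t. \<bar>t - 1\<bar> < e \<longrightarrow> t * s \<in> A" by (simp add: A_def)
  qed auto
  have "closed {s \<in> {0..1}. g s = 0}" by (rule continuous_closed_preimage_constant[OF g]) simp
  moreover have "{0<..1} \<subseteq> {s \<in> {0..1}. g s = 0}"
  proof
    fix s :: real assume "s \<in> {0<..1}"
    then show "s \<in> {s \<in> {0..1}. g s = 0}" using A[of s] subsetD[OF sub, of s] by simp
  qed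
  ultimately have "closure {0<..1} \<subseteq> {s \<in> {0..1}. g s = 0}" by (rule closure_minimal[rotated])
  then have "g s = 0" using s by auto
  then show ?thesis using A[OF s] by (simp add: A_def)
qed

end

section \<open>The local model at the zero-section\<close>

text \<open>At a point \<open>(q0, 0)\<close> of \<open>Lam\<close>, let \<open>H = span CH\<close> be the space of tangent vectors along the
  zero-section, and \<open>H'\<close> its orthogonal complement. The tangent space of \<open>Lam\<close> will turn out to be
  \<open>H \<times> H'\<close>, where \<open>H\<close> is tangent to the intersection with the zero-section, and \<open>H'\<close> is the fibre of
  the conormal bundle of this intersection.\<close>

locale theta_null_chart_at_zero = theta_null_chart B S \<Omega> \<phi> \<psi> CF
  for B :: "'e::{real_inner, banach} set" and S \<Omega> :: "('e \<times> 'e) set"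
    and \<phi> \<psi> :: "'e \<times> 'e \<Rightarrow> 'e \<times> 'e" and CF :: "('e \<times> 'e) set" +
  fixes q0 :: 'e and CH :: "'e set"
  assumes zero: "(q0, 0) \<in> Lam" and CH: "orthonormal_set CH" "span CH = {h. (h, 0) \<in> Tan (q0, 0)}"
begin

lemma zero_S: "(q0, 0) \<in> S" using zero by (rule Lam_in_S)

lemma box_exists: "\<exists>r>0. \<forall>q y. dist q q0 < r \<longrightarrow> norm y < r \<longrightarrow> (q, y) \<in> S"
proof -
  obtain e where e: "e > 0" "ball (q0, 0) e \<subseteq> S" by (rule openE[OF S zero_S])
  have "(q, y) \<in> S" if "dist q q0 < e / 2" "norm y < e / 2" for q y
  proof -
    have "dist (q0, 0) (q, y) \<le> dist q0 q + dist 0 y"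
      unfolding dist_prod_def by (simp add: sqrt_sum_squares_le_sum)
    also have "\<dots> < e" using that by (simp add: dist_commute dist_norm)
    finally show ?thesis using e(2) by auto
  qed
  moreover have "e / 2 > 0" using e(1) by simp
  ultimately show ?thesis by blast
qed

text \<open>The size of a product neighbourhood of \<open>(q0, 0)\<close> in \<open>S\<close>. Such a neighbourhood is invariant under the
  dilations with factors in \<open>[0, 1]\<close>.\<close>

definition r0 where "r0 = (SOME r. r > 0 \<and> (\<forall>q y. dist q q0 < r \<longrightarrow> norm y < r \<longrightarrow> (q, y) \<in> S))"

lemma r0: "r0 > 0" and r0_box: "dist q q0 < r0 \<Longrightarrow> norm y < r0 \<Longrightarrow> (q, y) \<in> S"
  using someI_ex[OF box_exists] unfolding r0_def by blast+

lemma dilation_near_zero: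
  assumes "dist q q0 < r0" "norm y < r0" "(q, y) \<in> Lam" "0 \<le> s" "s \<le> 1"
  shows "(q, s *\<^sub>R y) \<in> Lam"
proof (rule dilation_box[OF _ assms(3-5)])
  fix s :: real assume "0 \<le> s" "s \<le> 1"
  then have "norm (s *\<^sub>R y) \<le> norm y" by (simp add: mult_left_le_one_le)
  then show "(q, s *\<^sub>R y) \<in> S" using assms by (intro r0_box) auto
qed

text \<open>The dilation by \<open>0\<close> maps \<open>Lam\<close> near \<open>(q0, 0)\<close> into itself, so its derivative \<open>(h, y) \<mapsto> (h, 0)\<close>
  preserves the tangent space.\<close>

lemma Tan_horizontal_part:
  assumes "(h, y) \<in> Tan (q0, 0)"
  shows "h \<in> span CH"
proof -
  define z0 where "z0 = \<phi> (q0, 0)"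
  define u where "u = Diff \<phi> (q0, 0) (h, y)"
  have u: "u \<in> span CF" using assms by (simp add: Tan_def u_def)
  have z0: "z0 \<in> \<Omega>" "z0 \<in> span CF" using zero \<phi>_in by (auto simp: z0_def Lam_def)
  have \<psi>z0: "\<psi> z0 = (q0, 0)" by (simp add: z0_def \<psi>\<phi> zero_S)
  \<comment> \<open>a curve in \<open>Lam\<close> with velocity \<open>(h, y)\<close>\<close>
  define c where "c t = \<psi> (z0 + t *\<^sub>R u)" for t
  have "((\<lambda>t. z0 + t *\<^sub>R u) has_derivative (\<lambda>h. h *\<^sub>R u)) (at 0)" by (auto intro!: derivative_eq_intros)
  moreover have "(\<psi> has_derivative Diff \<psi> z0) (at (z0 + 0 *\<^sub>R u))" using Diff_\<psi>[OF z0(1)] by simp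
  ultimately have "(c has_derivative (\<lambda>h. Diff \<psi> z0 (h *\<^sub>R u))) (at 0)"
    unfolding c_def[abs_def] by (rule has_derivative_compose)
  moreover have "Diff \<psi> z0 (t *\<^sub>R u) = t *\<^sub>R (h, y)" for t
    unfolding linear_scale[OF linear_Diff_\<psi>[OF z0(1)]] by (simp add: u_def z0_def Diff_\<psi>_\<phi> zero_S)
  ultimately have c: "(c has_derivative (\<lambda>t. t *\<^sub>R (h, y))) (at 0)" by simp
  have c0: "c 0 = (q0, 0)" by (simp add: c_def \<psi>z0)
  have "isCont (\<lambda>t. z0 + t *\<^sub>R u) 0" by (intro continuous_intros)
  then have "\<forall>\<^sub>F t in nhds 0. z0 + t *\<^sub>R u \<in> \<Omega>" by (rule isCont_eventually_nhds) (simp_all add: \<Omega> z0)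
  moreover have "\<forall>\<^sub>F t in nhds 0. c t \<in> ball q0 r0 \<times> ball 0 r0"
    by (rule isCont_eventually_nhds[OF has_derivative_continuous[OF c]]) (simp_all add: open_Times c0 r0)
  ultimately have "\<forall>\<^sub>F t in nhds 0. z0 + t *\<^sub>R u \<in> \<Omega> \<and> c t \<in> ball q0 r0 \<times> ball 0 r0"
    by (rule eventually_conj)
  then obtain e where e: "e > 0" "\<And>t. dist t 0 < e \<Longrightarrow> z0 + t *\<^sub>R u \<in> \<Omega> \<and> c t \<in> ball q0 r0 \<times> ball 0 r0"
    unfolding eventually_nhds_metric by blast
  have "(h, 0) \<in> Tan (q0, 0)"
  proof (rule Tan_curve[where \<gamma> = "\<lambda>t. (fst (c t), 0)" and e = e])
    have "((\<lambda>t. (fst (c t), 0 :: 'e)) has_derivative (\<lambda>t. (fst (t *\<^sub>R (h, y)), 0))) (at 0)"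
      by (intro has_derivative_Pair has_derivative_fst c has_derivative_const)
    moreover have "(\<lambda>t. (fst (t *\<^sub>R (h, y)), 0 :: 'e)) = (\<lambda>t. t *\<^sub>R (h, 0))"
      by (simp add: fun_eq_iff)
    ultimately show "((\<lambda>t. (fst (c t), 0 :: 'e)) has_vector_derivative (h, 0)) (at 0 within {0..})"
      unfolding has_vector_derivative_def by (simp only: has_derivative_at_withinI)
    fix t :: real assume t: "0 \<le> t" "t < e"
    then have 1: "z0 + t *\<^sub>R u \<in> \<Omega>" "c t \<in> ball q0 r0 \<times> ball 0 r0" using e(2)[of t] by auto
    have "z0 + t *\<^sub>R u \<in> span CF" by (intro span_add span_scale z0 u)
    then have "c t \<in> Lam" using 1 by (simp add: c_def Lam_def \<phi>\<psi> \<psi>_in)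
    then show "(fst (c t), 0) \<in> Lam"
      using dilation_near_zero[of "fst (c t)" "snd (c t)" 0] 1 by (auto simp: dist_commute mem_Times_iff)
  qed (use c0 zero_S e in auto)
  then show ?thesis by (simp add: CH)
qed

lemma Tan_vertical_orthogonal:
  assumes "h \<in> span CH" "(0, y) \<in> Tan (q0, 0)"
  shows "h \<bullet> y = 0"
  using Tan_isotropic[OF zero, of "(h, 0)" "(0, y)"] assms by (simp add: CH symplectic_form_def)

lemma orthogonal_vertical_Tan:
  assumes "\<And>h. h \<in> span CH \<Longrightarrow> h \<bullet> y = 0"
  shows "(0, y) \<in> Tan (q0, 0)"
proof (rule Tan_maximal[OF zero])
  fix w assume "w \<in> Tan (q0, 0)"
  then have "fst w \<in> span CH" using Tan_horizontal_part[of "fst w" "snd w"] by simp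
  then show "symplectic_form (0, y) w = 0" using assms[of "fst w"] inner_commute[of y "fst w"] by (simp add: symplectic_form_def)
qed

lemma fibre_Tan:
  assumes "e > 0" "\<And>t. 0 \<le> t \<Longrightarrow> t < e \<Longrightarrow> (q0, t *\<^sub>R y) \<in> Lam"
  shows "(0, y) \<in> Tan (q0, 0)"
proof (rule Tan_curve[where \<gamma> = "\<lambda>t. (q0, t *\<^sub>R y)" and e = e])
  show "((\<lambda>t. (q0, t *\<^sub>R y)) has_vector_derivative (0, y)) (at 0 within {0..})"
    by (auto intro!: derivative_eq_intros)
qed (use assms zero_S in auto)

text \<open>A parametrization of \<open>Lam\<close> by its tangent space at \<open>(q0, 0)\<close>, followed by the orthogonal projection \<open>T\<close> to
  this tangent space, has derivative the identity, and is therefore onto a neighbourhood of \<open>0\<close>.\<close>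

lemma Lam_onto_tangent:
  assumes "\<rho> > 0"
  shows "\<exists>\<delta>>0. \<forall>h v. h \<in> span CH \<longrightarrow> (\<forall>h'\<in>span CH. h' \<bullet> v = 0) \<longrightarrow> norm h < \<delta> \<longrightarrow> norm v < \<delta> \<longrightarrow>
    (\<exists>q y. (q, y) \<in> Lam \<and> dist q q0 < \<rho> \<and> norm y < \<rho> \<and> oproj CH (q - q0) = h \<and> y - oproj CH y = v)"
proof -
  define T where "T w = (oproj CH (fst w), snd w - oproj CH (snd w))" for w :: "'e \<times> 'e"
  have bl_T: "bounded_linear T"
    unfolding T_def[abs_def]
    by (intro bounded_linear_Pair bounded_linear_sub bounded_linear_compose[OF bounded_linear_oproj]
        bounded_linear_fst bounded_linear_snd)
  note lin_T = bounded_linear.linear[OF bl_T]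
  have orth: "h' \<bullet> (v - oproj CH v) = 0" if "h' \<in> span CH" for h' v
    using oproj_orthogonal[OF CH(1) that, of v] by (simp add: inner_commute)
  have T_Tan: "T w \<in> Tan (q0, 0)" for w
  proof -
    have "(oproj CH (fst w), 0) \<in> Tan (q0, 0)" using oproj_in_span[of CH "fst w"] by (simp add: CH)
    moreover have "(0, snd w - oproj CH (snd w)) \<in> Tan (q0, 0)" by (rule orthogonal_vertical_Tan[OF orth])
    ultimately have "(oproj CH (fst w), 0) + (0, snd w - oproj CH (snd w)) \<in> Tan (q0, 0)"
      by (rule subspace_add[OF subspace_Tan[OF zero_S]])
    then show ?thesis by (simp add: T_def)
  qed
  have T_id: "T (h, v) = (h, v)" if "h \<in> span CH" "\<forall>h'\<in>span CH. h' \<bullet> v = 0" for h v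
  proof -
    have "oproj CH v = 0" using that(2) by (intro oproj_eq_0) (simp add: span_base inner_commute)
    then show ?thesis using oproj_id[OF CH(1) that(1)] by (simp add: T_def)
  qed
  define z0 where "z0 = \<phi> (q0, 0)"
  have z0: "z0 \<in> \<Omega>" "z0 \<in> span CF" using zero \<phi>_in by (auto simp: z0_def Lam_def)
  have \<psi>z0: "\<psi> z0 = (q0, 0)" by (simp add: z0_def \<psi>\<phi> zero_S)
  define A where "A w = Diff \<phi> (q0, 0) (T w)" for w
  have blA: "bounded_linear A"
    unfolding A_def[abs_def]
    by (rule bounded_linear_compose[OF has_derivative_bounded_linear[OF Diff_\<phi>[OF zero_S]] bl_T])
  have AF: "A w \<in> span CF" for w using T_Tan[of w] by (simp add: A_def Tan_def)
  define W where "W = {w. z0 + A w \<in> \<Omega>}"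
  have W: "open W"
    using open_vimage[OF \<Omega>, of "\<lambda>w. z0 + A w"] by (simp add: W_def vimage_def continuous_on_add linear_continuous_on[OF blA])
  have A0: "A 0 = 0" by (rule linear_0[OF bounded_linear.linear[OF blA]])
  have W0: "0 \<in> W" using z0 by (simp add: W_def A0)
  define P where "P w = \<psi> (z0 + A w)" for w
  have smA: "smooth_on W (\<lambda>w. z0 + A w)" by (intro smooth_on_add[OF W] smooth_on_const smooth_on_linear blA)
  have smP: "smooth_on W P"
    unfolding P_def[abs_def] by (rule smooth_on_compose[OF BB W \<Omega> _ smA \<psi>]) (auto simp: W_def)
  have P0: "P 0 = (q0, 0)" by (simp add: P_def A0 \<psi>z0)
  \<comment> \<open>on the tangent space \<open>f\<close> is the projected parametrization of \<open>Lam\<close>; the term \<open>w - T w\<close> extends it to a local diffeomorphism of the whole space\<close>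
  define f where "f w = w - T w + T (P w - (q0, 0))" for w
  have smf: "smooth_on W f"
    unfolding f_def[abs_def]
    by (intro smooth_on_add[OF W] smooth_on_diff[OF W] smooth_on_linear_compose[OF W bl_T] smP
        smooth_on_const smooth_on_linear bl_T bounded_linear_ident)
  have DP: "(P has_derivative (\<lambda>w. T w)) (at 0)"
  proof -
    have 1: "((\<lambda>w. z0 + A w) has_derivative A) (at 0)"
      using has_derivative_add[OF has_derivative_const[of z0] bounded_linear_imp_has_derivative[OF blA]] by simp
    have 2: "(\<psi> has_derivative Diff \<psi> z0) (at (z0 + A 0))" using Diff_\<psi>[OF z0(1)] by (simp add: A0)
    have "(P has_derivative (\<lambda>w. Diff \<psi> z0 (A w))) (at 0)"
      unfolding P_def[abs_def] by (rule has_derivative_compose[OF 1 2])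
    then show ?thesis by (simp add: A_def z0_def Diff_\<psi>_\<phi>[OF zero_S])
  qed
  have T_idem: "T (T w) = T w" for w
  proof -
    have "fst (T w) \<in> span CH" by (simp add: T_def oproj_in_span)
    moreover have "\<forall>h'\<in>span CH. h' \<bullet> snd (T w) = 0" using orth by (simp add: T_def)
    ultimately show ?thesis using T_id[of "fst (T w)" "snd (T w)"] by simp
  qed
  have "(f has_derivative (\<lambda>w. w - T w + T (T w - 0))) (at 0)"
    unfolding f_def[abs_def]
    by (intro has_derivative_add has_derivative_diff has_derivative_ident bounded_linear.has_derivative[OF bl_T]
        DP has_derivative_const bounded_linear_imp_has_derivative[OF bl_T])
  then have Df: "Diff f 0 = (\<lambda>w. w)" by (simp add: Diff_eq T_idem)
  obtain r where r: "r > 0" "ball 0 r \<subseteq> W" and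
    lip: "\<And>x y. x \<in> ball 0 r \<Longrightarrow> y \<in> ball 0 r \<Longrightarrow> norm ((f x - x) - (f y - y)) \<le> 1/2 * norm (x - y)"
    using smooth_on_strict[OF W BB smf W0 half_gt_zero[OF zero_less_one]] unfolding Df by blast
  have "isCont P 0" by (rule has_derivative_continuous[OF DP])
  then have "\<forall>\<^sub>F w in nhds 0. P w \<in> ball q0 \<rho> \<times> ball 0 \<rho>"
    by (rule isCont_eventually_nhds) (simp_all add: open_Times P0 \<open>\<rho> > 0\<close>)
  then obtain s1 where s1: "s1 > 0" "\<And>w. dist w 0 < s1 \<Longrightarrow> P w \<in> ball q0 \<rho> \<times> ball 0 \<rho>"
    unfolding eventually_nhds_metric by blast
  define s where "s = min r s1 / 2"
  have s: "s > 0" "s < r" "s < s1" using r s1 by (auto simp: s_def)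
  \<comment> \<open>the norm of \<open>(h, v)\<close> is then at most \<open>s / 2\<close>, the radius of the ball covered by the image of \<open>cball 0 s\<close>\<close>
  show ?thesis
  proof (intro exI[of _ "s / 4"] conjI allI impI)
    show "s / 4 > 0" using s by simp
    fix h v assume h: "h \<in> span CH" and v: "\<forall>h'\<in>span CH. h' \<bullet> v = 0" and hv: "norm h < s / 4" "norm v < s / 4"
    have "norm (h, v) \<le> norm h + norm v" by (rule norm_Pair_le)
    moreover have f0: "f 0 = 0" by (simp add: f_def P0 linear_0[OF lin_T])
    ultimately have "(h, v) \<in> cball (f 0) (s / 2)" using hv by simp
    moreover have "cball (f 0) (s / 2) \<subseteq> f ` cball 0 s"
    proof (rule perturbed_identity_surj)
      show "cball 0 s \<subseteq> ball 0 r" using s by (simp add: subset_eq)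
    qed (use lip s in auto)
    ultimately obtain w where w: "w \<in> cball 0 s" "f w = (h, v)" by auto
    have "T (f w) = T (P w - (q0, 0))"
      unfolding f_def by (simp only: linear_add[OF lin_T] linear_diff[OF lin_T] T_idem) simp
    then have 1: "T (P w - (q0, 0)) = (h, v)" using w T_id[OF h v] by simp
    obtain q y where qy: "P w = (q, y)" by fastforce
    have "z0 + A w \<in> \<Omega>" using w s r by (auto simp: W_def subset_eq)
    then have "(q, y) \<in> Lam"
      unfolding qy[symmetric] using span_add[OF z0(2) AF[of w]] by (simp add: Lam_def P_def \<psi>_in \<phi>\<psi>)
    moreover have "P w \<in> ball q0 \<rho> \<times> ball 0 \<rho>" using w s by (intro s1(2)) auto
    ultimately show "\<exists>q y. (q, y) \<in> Lam \<and> dist q q0 < \<rho> \<and> norm y < \<rho> \<and> oproj CH (q - q0) = h \<and> y - oproj CH y = v"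
      using 1 by (intro exI[of _ q] exI[of _ y]) (auto simp: qy T_def dist_commute)
  qed
qed

text \<open>The set of all \<open>q\<close> with \<open>(q, 0) \<in> Lam\<close> is the zero set of \<open>q \<mapsto> perp (\<phi> (q, 0))\<close>, whose derivative \<open>A\<close>
  at \<open>q0\<close> has kernel \<open>span CH\<close>. Composing with a left inverse \<open>\<iota>\<close> of \<open>A\<close> on the orthogonal complement and
  adding the projection onto \<open>span CH\<close> gives a local diffeomorphism \<open>\<kappa>\<close> with derivative the identity at
  \<open>q0\<close>. It maps this zero set into \<open>span CH\<close>.\<close>

lemma straightening:
  obtains r \<kappa> g where "r > 0" "r \<le> r0" "smooth_on (ball q0 r) \<kappa>" "\<And>q. q \<in> ball q0 r \<Longrightarrow> g (\<kappa> q) = q"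
    "\<And>U. open U \<Longrightarrow> U \<subseteq> ball q0 r \<Longrightarrow> open (\<kappa> ` U)" "smooth_on (\<kappa> ` ball q0 r) g"
    "(\<kappa> has_derivative (\<lambda>h. h)) (at q0)"
    "\<And>q. (q, 0) \<in> Lam \<Longrightarrow> \<kappa> q = oproj CH (q - q0)"
proof -
  define S0 where "S0 = {q. (q, 0) \<in> S}"
  have S0: "open S0" using open_vimage[OF S, of "\<lambda>q. (q, 0)"] by (simp add: S0_def vimage_def continuous_on_Pair)
  have q0: "q0 \<in> S0" using zero_S by (simp add: S0_def)
  define A where "A h = perp (Diff \<phi> (q0, 0) (h, 0))" for h
  have bl0: "bounded_linear (\<lambda>h::'e. (h, 0::'e))" by (intro bounded_linear_Pair bounded_linear_ident bounded_linear_zero)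
  have blA: "bounded_linear A"
    unfolding A_def[abs_def]
    by (intro bounded_linear_compose[OF perp_bounded_linear] bounded_linear_compose[OF has_derivative_bounded_linear[OF Diff_\<phi>[OF zero_S]] bl0])
  note linA = bounded_linear.linear[OF blA]
  have A0: "A h = 0 \<longleftrightarrow> h \<in> span CH" for h by (simp add: A_def perp_eq_0 CH Tan_def)
  define K where "K = {k. \<forall>h\<in>span CH. k \<bullet> h = 0}"
  have subK: "subspace K" by (auto simp: K_def subspace_def inner_add_left)
  then have spanK: "span K = K" by (simp add: span_eq_iff)
  have "inj_on A (span K)"
    unfolding spanK
  proof (rule inj_onI)
    fix k k' assume k: "k \<in> K" "k' \<in> K" and "A k = A k'"
    then have "A (k - k') = 0" by (simp add: linear_diff[OF linA])
    then have "k - k' \<in> span CH" by (simp add: A0)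
    moreover have "k - k' \<in> K" by (rule subspace_diff[OF subK k])
    ultimately have "(k - k') \<bullet> (k - k') = 0" by (simp add: K_def)
    then show "k = k'" by simp
  qed
  then obtain \<iota> where \<iota>: "linear \<iota>" "\<And>k. k \<in> K \<Longrightarrow> \<iota> (A k) = k"
    using linear_inj_on_left_inverse[OF linA, of K] spanK by blast
  have bl\<iota>: "bounded_linear \<iota>" by (rule linear_imp_bounded_linear[OF BB \<iota>(1)])
  define \<kappa> where "\<kappa> q = oproj CH (q - q0) + \<iota> (perp (\<phi> (q, 0)))" for q
  have sm\<phi>0: "smooth_on S0 (\<lambda>q. \<phi> (q, 0))"
    by (rule smooth_on_compose[OF BB S0 S _ smooth_on_linear[OF bl0] \<phi>]) (auto simp: S0_def)
  have sm: "smooth_on S0 \<kappa>"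
    unfolding \<kappa>_def[abs_def]
    by (intro smooth_on_add[OF S0] smooth_on_linear_compose[OF S0 bl\<iota>] smooth_on_linear_compose[OF S0 perp_bounded_linear]
        smooth_on_linear_compose[OF S0 bounded_linear_oproj] smooth_on_diff[OF S0] sm\<phi>0 smooth_on_linear bounded_linear_ident smooth_on_const)
  have D: "(\<kappa> has_derivative (\<lambda>h. h)) (at q0)"
  proof -
    have "(\<kappa> has_derivative (\<lambda>h. oproj CH (h - 0) + \<iota> (perp (Diff \<phi> (q0, 0) (h, 0))))) (at q0)"
      unfolding \<kappa>_def[abs_def]
      by (intro has_derivative_add bounded_linear.has_derivative[OF bl\<iota>] bounded_linear.has_derivative[OF perp_bounded_linear]
          bounded_linear.has_derivative[OF bounded_linear_oproj] has_derivative_diff has_derivative_ident has_derivative_const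
          has_derivative_compose[of "\<lambda>q. (q, 0)" _ q0 UNIV \<phi>, OF bounded_linear_imp_has_derivative[OF bl0] Diff_\<phi>[OF zero_S]])
    moreover have "oproj CH (h - 0) + \<iota> (perp (Diff \<phi> (q0, 0) (h, 0))) = h" for h
    proof -
      have "h - oproj CH h \<in> K" using oproj_orthogonal[OF CH(1)] by (auto simp: K_def)
      moreover have "A (h - oproj CH h) = A h"
        using A0[of "oproj CH h"] oproj_in_span by (simp add: linear_diff[OF linA])
      ultimately have "\<iota> (A h) = h - oproj CH h" using \<iota>(2) by metis
      then show ?thesis by (simp add: A_def)
    qed
    ultimately show ?thesis by simp
  qed
  have "Diff \<kappa> q0 v = v" for v using Diff_eq[OF D] by simp
  then obtain r g where r: "r > 0" "ball q0 r \<subseteq> S0" "\<And>x. x \<in> ball q0 r \<Longrightarrow> g (\<kappa> x) = x"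
    "\<And>U. open U \<Longrightarrow> U \<subseteq> ball q0 r \<Longrightarrow> open (\<kappa> ` U)" "smooth_on (\<kappa> ` ball q0 r) g"
    using inverse_function_smooth[OF S0 B sm q0] by blast
  define r' where "r' = min r r0"
  have sub: "ball q0 r' \<subseteq> ball q0 r" by (auto simp: r'_def)
  show thesis
  proof (rule that[of r' \<kappa> g])
    show "r' > 0" "r' \<le> r0" using r r0 by (auto simp: r'_def)
    show "smooth_on (ball q0 r') \<kappa>" using smooth_on_subset[OF sm] sub r(2) by blast
    show "smooth_on (\<kappa> ` ball q0 r') g" by (rule smooth_on_subset[OF r(5) image_mono[OF sub]])
    show "g (\<kappa> q) = q" if "q \<in> ball q0 r'" for q using r(3) sub that by blast
    show "open (\<kappa> ` U)" if "open U" "U \<subseteq> ball q0 r'" for U using r(4)[of U] that sub by blast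
    show "\<kappa> q = oproj CH (q - q0)" if "(q, 0) \<in> Lam" for q
      using that Lam_iff[OF Lam_in_S[OF that]] by (simp add: \<kappa>_def linear_0[OF \<iota>(1)])
  qed (rule D)
qed

text \<open>The straightened zero set fills \<open>span CH\<close> near \<open>0\<close>. For \<open>h \<in> span CH\<close> small there is \<open>(q, y) \<in> Lam\<close> with
  \<open>q - q0\<close> projecting to \<open>h\<close>. By dilation \<open>(q, 0) \<in> Lam\<close>, and then \<open>\<kappa> q = h\<close>. So constancy of the rank of the
  defining function is replaced by the retraction \<open>(q, y) \<mapsto> (q, 0)\<close> of \<open>Lam\<close>.\<close>

lemma zero_section_slice:
  obtains U \<kappa> g where "open U" "q0 \<in> U" "\<And>q. q \<in> U \<Longrightarrow> (q, 0) \<in> S" "smooth_on U \<kappa>" "\<And>q. q \<in> U \<Longrightarrow> g (\<kappa> q) = q" "open (\<kappa> ` U)"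
    "smooth_on (\<kappa> ` U) g" "(\<kappa> has_derivative (\<lambda>h. h)) (at q0)"
    "\<kappa> ` {q \<in> U. (q, 0) \<in> Lam} = \<kappa> ` U \<inter> span CH"
proof -
  obtain r \<kappa> g where r: "r > 0" "r \<le> r0" and sm: "smooth_on (ball q0 r) \<kappa>" and g: "\<And>q. q \<in> ball q0 r \<Longrightarrow> g (\<kappa> q) = q"
    and opn: "\<And>U. open U \<Longrightarrow> U \<subseteq> ball q0 r \<Longrightarrow> open (\<kappa> ` U)" and smg: "smooth_on (\<kappa> ` ball q0 r) g"
    and D: "(\<kappa> has_derivative (\<lambda>h. h)) (at q0)"
    and \<kappa>: "\<And>q. (q, 0) \<in> Lam \<Longrightarrow> \<kappa> q = oproj CH (q - q0)"
    by (rule straightening, rule that)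
  obtain \<delta> where \<delta>: "\<delta> > 0" and surj: "\<And>h v. h \<in> span CH \<Longrightarrow> \<forall>h'\<in>span CH. h' \<bullet> v = 0 \<Longrightarrow> norm h < \<delta> \<Longrightarrow> norm v < \<delta> \<Longrightarrow>
    \<exists>q y. (q, y) \<in> Lam \<and> dist q q0 < r \<and> norm y < r \<and> oproj CH (q - q0) = h \<and> y - oproj CH y = v"
    using Lam_onto_tangent[OF r(1)] by (elim exE conjE) (rule that, blast+)
  define U where "U = ball q0 r \<inter> \<kappa> -` ball 0 \<delta>"
  have U: "open U" unfolding U_def
    by (rule continuous_open_preimage[OF smooth_on_continuous[OF sm]]) auto
  have sub: "U \<subseteq> ball q0 r" by (simp add: U_def)
  have \<kappa>0: "\<kappa> q0 = 0" using \<kappa>[OF zero] by (simp add: linear_0[OF linear_oproj])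
  show thesis
  proof (rule that[of U \<kappa> g])
    show "q0 \<in> U" using r \<delta> by (simp add: U_def \<kappa>0)
    show "(q, 0) \<in> S" if "q \<in> U" for q
      using that r r0 by (intro r0_box) (auto simp: U_def dist_commute)
    show "\<kappa> ` {q \<in> U. (q, 0) \<in> Lam} = \<kappa> ` U \<inter> span CH"
    proof (intro equalityI subsetI)
      fix h assume "h \<in> \<kappa> ` {q \<in> U. (q, 0) \<in> Lam}"
      then obtain q where q: "q \<in> U" "(q, 0) \<in> Lam" "h = \<kappa> q" by blast
      then show "h \<in> \<kappa> ` U \<inter> span CH" using \<kappa>[OF q(2)] oproj_in_span[of CH "q - q0"] by (metis IntI imageI)
    next
      fix h assume h: "h \<in> \<kappa> ` U \<inter> span CH"
      then have "norm h < \<delta>" by (auto simp: U_def)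
      then obtain q y where qy: "(q, y) \<in> Lam" "dist q q0 < r" "norm y < r" "oproj CH (q - q0) = h"
        using surj[of h 0] h \<delta> by auto
      then have "(q, 0) \<in> Lam" using dilation_near_zero[of q y 0] r by simp
      moreover from this have "\<kappa> q = h" using \<kappa> qy by simp
      ultimately show "h \<in> \<kappa> ` {q \<in> U. (q, 0) \<in> Lam}"
        using qy \<open>norm h < \<delta>\<close> by (intro image_eqI[of _ _ q]) (auto simp: U_def dist_commute)
    qed
    show "smooth_on U \<kappa>" by (rule smooth_on_subset[OF sm sub])
    show "smooth_on (\<kappa> ` U) g" by (rule smooth_on_subset[OF smg image_mono[OF sub]])
    show "open (\<kappa> ` U)" by (rule opn[OF U sub])
    show "g (\<kappa> q) = q" if "q \<in> U" for q using g sub that by blast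
  qed (rule U D)+
qed

text \<open>Surjectivity onto the tangent space gives \<open>(q, y') \<in> Lam\<close> with tangential projection \<open>(0, s y)\<close>. Then
  \<open>(q, 0) \<in> Lam\<close> and \<open>\<kappa> q = 0 = \<kappa> q0\<close>, so \<open>q = q0\<close>. Now the fibre segment through \<open>(q0, y')\<close> lies in \<open>Lam\<close>, and
  therefore \<open>y'\<close> is orthogonal to \<open>span CH\<close>, which leaves \<open>y' = s y\<close>.\<close>

lemma orthogonal_fibre_in_Lam:
  assumes y: "\<And>h. h \<in> span CH \<Longrightarrow> h \<bullet> y = 0"
  shows "\<exists>s>0. (q0, s *\<^sub>R y) \<in> Lam"
proof -
  obtain r \<kappa> g where r: "r > 0" "r \<le> r0" and "smooth_on (ball q0 r) \<kappa>" and g: "\<And>q. q \<in> ball q0 r \<Longrightarrow> g (\<kappa> q) = q"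
    and "\<And>U. open U \<Longrightarrow> U \<subseteq> ball q0 r \<Longrightarrow> open (\<kappa> ` U)" and "smooth_on (\<kappa> ` ball q0 r) g"
    and "(\<kappa> has_derivative (\<lambda>h. h)) (at q0)"
    and \<kappa>: "\<And>q. (q, 0) \<in> Lam \<Longrightarrow> \<kappa> q = oproj CH (q - q0)"
    by (rule straightening, rule that)
  obtain \<delta> where \<delta>: "\<delta> > 0" and surj: "\<And>h v. h \<in> span CH \<Longrightarrow> \<forall>h'\<in>span CH. h' \<bullet> v = 0 \<Longrightarrow> norm h < \<delta> \<Longrightarrow> norm v < \<delta> \<Longrightarrow>
    \<exists>q y. (q, y) \<in> Lam \<and> dist q q0 < r \<and> norm y < r \<and> oproj CH (q - q0) = h \<and> y - oproj CH y = v"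
    using Lam_onto_tangent[OF r(1)] by (elim exE conjE) (rule that, blast+)
  define s where "s = \<delta> / (norm y + 1)"
  have n: "norm y + 1 > 0" using norm_ge_zero[of y] by linarith
  have "s > 0" unfolding s_def by (rule divide_pos_pos[OF \<delta> n])
  moreover have "s * (norm y + 1) = \<delta>" using n by (simp add: s_def)
  ultimately have s: "s > 0" "s * norm y < \<delta>" by (auto simp: distrib_left)
  have sy: "\<forall>h'\<in>span CH. h' \<bullet> (s *\<^sub>R y) = 0" using y by simp
  obtain q y' where q: "(q, y') \<in> Lam" "dist q q0 < r" "norm y' < r" "oproj CH (q - q0) = 0" "y' - oproj CH y' = s *\<^sub>R y"
    using surj[OF span_zero sy] s \<delta> by auto
  have "(q, 0) \<in> Lam" using dilation_near_zero[of q y' 0] q r by simp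
  then have "\<kappa> q = 0" using \<kappa>[of q] q(4) by simp
  moreover have "\<kappa> q0 = 0" using \<kappa>[OF zero] by (simp add: linear_0[OF linear_oproj])
  ultimately have "\<kappa> q = \<kappa> q0" by simp
  moreover have "g (\<kappa> q) = q" by (rule g) (use q(2) in \<open>simp add: dist_commute\<close>)
  moreover have "g (\<kappa> q0) = q0" by (rule g) (use r(1) in simp)
  ultimately have "q = q0" by metis
  then have "(0, y') \<in> Tan (q0, 0)"
    using dilation_near_zero[of q0 y'] q r r0 by (intro fibre_Tan[of 1]) auto
  then have "oproj CH y' = 0"
    using Tan_vertical_orthogonal[OF span_base] by (intro oproj_eq_0) (simp add: inner_commute)
  then show ?thesis using q(1,5) \<open>q = q0\<close> s by auto
qed

end

section \<open>Charts and tangent vectors\<close>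

lemma is_chart_inj: "is_chart X c \<Longrightarrow> inj_on (snd c) (fst c)"
  unfolding is_chart_def
  by (metis homeomorphic_imp_injective_map openin_subset topspace_subtopology_subset)

lemma is_chart_open_image:
  assumes "is_chart X c" "openin X V"
  shows "open (snd c ` (fst c \<inter> V))"
proof -
  have o: "openin X (fst c)" "open (snd c ` fst c)"
    and h: "homeomorphic_map (subtopology X (fst c)) (top_of_set (snd c ` fst c)) (snd c)"
    using assms(1) by (simp_all add: is_chart_def)
  have "openin (subtopology X (fst c)) (fst c \<inter> V)"
    using assms(2) by (simp add: openin_subtopology_Int2)
  then have "openin (top_of_set (snd c ` fst c)) (snd c ` (fst c \<inter> V))"
    using homeomorphic_imp_open_map[OF h] by (simp add: open_map_def)
  then show ?thesis using o(2) openin_open_trans by blast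
qed

lemma is_chart_open_vimage:
  assumes "is_chart X c" "open W"
  shows "openin X {p \<in> fst c. snd c p \<in> W}"
proof -
  have o: "openin X (fst c)"
    and h: "homeomorphic_map (subtopology X (fst c)) (top_of_set (snd c ` fst c)) (snd c)"
    using assms(1) by (simp_all add: is_chart_def)
  have ts: "topspace (subtopology X (fst c)) = fst c"
    using openin_subset[OF o] by (rule topspace_subtopology_subset)
  have "openin (top_of_set (snd c ` fst c)) (snd c ` fst c \<inter> W)"
    using assms(2) by (simp add: openin_open_Int)
  then have "openin (subtopology X (fst c)) {p \<in> topspace (subtopology X (fst c)). snd c p \<in> snd c ` fst c \<inter> W}"
    by (rule openin_continuous_map_preimage[OF homeomorphic_imp_continuous_map[OF h]])
  then have "openin X {p \<in> fst c. snd c p \<in> snd c ` fst c \<inter> W}"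
    unfolding ts by (rule openin_trans_full[OF _ o])
  moreover have "{p \<in> fst c. snd c p \<in> snd c ` fst c \<inter> W} = {p \<in> fst c. snd c p \<in> W}" by auto
  ultimately show ?thesis by simp
qed

lemma transition_apply: "inj_on (snd c) (fst c) \<Longrightarrow> p \<in> fst c \<Longrightarrow> transition c d (snd c p) = snd d p"
  by (simp add: transition_def)

lemma transition_chain:
  assumes inj: "inj_on (snd c) (fst c)" "inj_on (snd e) (fst e)"
    and op: "open (snd c ` (fst c \<inter> fst e))" and p: "p \<in> fst c" "p \<in> fst e"
    and D1: "(transition c e has_derivative D1) (at (snd c p))" and D2: "(transition e d has_derivative D2) (at (snd e p))"
  shows "(transition c d has_derivative (\<lambda>v. D2 (D1 v))) (at (snd c p))"
proof (rule has_derivative_transform_within_open[OF _ op])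
  have "transition c e (snd c p) = snd e p" using p inj by (simp add: transition_apply)
  then show "((\<lambda>z. transition e d (transition c e z)) has_derivative (\<lambda>v. D2 (D1 v))) (at (snd c p))"
    using D2 by (intro has_derivative_compose[OF D1]) simp
  show "snd c p \<in> snd c ` (fst c \<inter> fst e)" using p by blast
  show "transition e d (transition c e z) = transition c d z" if "z \<in> snd c ` (fst c \<inter> fst e)" for z
    using that inj by (auto simp: transition_apply)
qed

lemma tangent_spaceI:
  assumes "\<And>c. c \<notin> charts_at A p \<Longrightarrow> v c = 0"
    and "\<And>c d. c \<in> charts_at A p \<Longrightarrow> d \<in> charts_at A p \<Longrightarrow> v d = Diff (transition c d) (snd c p) (v c)"
  shows "v \<in> tangent_space A p"
  using assms unfolding tangent_space_def by blast

lemma tangent_space_coordinates: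
  "v \<in> tangent_space A p \<Longrightarrow> c \<in> charts_at A p \<Longrightarrow> d \<in> charts_at A p \<Longrightarrow>
    v d = Diff (transition c d) (snd c p) (v c)"
  unfolding tangent_space_def by blast

lemma tangent_space_outside: "v \<in> tangent_space A p \<Longrightarrow> c \<notin> charts_at A p \<Longrightarrow> v c = 0"
  unfolding tangent_space_def by blast

lemma sub_tangent_spaceI:
  assumes "v \<in> tangent_space A p" "slice_chart A S p c F" "v c \<in> F"
  shows "v \<in> sub_tangent_space A S p"
  unfolding sub_tangent_space_def mem_Collect_eq using assms by (intro conjI exI[of _ c] exI[of _ F])

text \<open>The tangent vector at \<open>p\<close> that has the coordinates \<open>u\<close> in the chart \<open>c\<close>.\<close>

definition tangent_of :: "('m, 'e::real_normed_vector) chart set \<Rightarrow> 'm \<Rightarrow> ('m, 'e) chart \<Rightarrow> 'e \<Rightarrow> ('m, 'e) chart \<Rightarrow> 'e" where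
  "tangent_of A p c u = (\<lambda>d. if d \<in> charts_at A p then Diff (transition c d) (snd c p) u else 0)"

text \<open>The properties of an atlas from which tangent vectors can be built out of their coordinates in a
  single chart. They are shared by the atlas of the base and by the structure of the cotangent
  bundle, where differentiability of the transitions is only known through the induced charts.\<close>

locale transition_family =
  fixes A :: "('m, 'e::real_normed_vector) chart set"
  assumes inj: "c \<in> A \<Longrightarrow> inj_on (snd c) (fst c)"
    and open_overlap: "c \<in> A \<Longrightarrow> d \<in> A \<Longrightarrow> open (snd c ` (fst c \<inter> fst d))"
    and transition_diff: "c \<in> charts_at A p \<Longrightarrow> d \<in> charts_at A p \<Longrightarrow> transition c d differentiable (at (snd c p))"
begin

lemma transition_has_derivative:
  "c \<in> charts_at A p \<Longrightarrow> d \<in> charts_at A p \<Longrightarrow> (transition c d has_derivative Diff (transition c d) (snd c p)) (at (snd c p))"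
  using transition_diff frechet_derivative_works by blast

lemma Diff_transition_chain:
  assumes "c \<in> charts_at A p" "d \<in> charts_at A p" "e \<in> charts_at A p"
  shows "Diff (transition c d) (snd c p) v = Diff (transition e d) (snd e p) (Diff (transition c e) (snd c p) v)"
proof -
  have "(transition c d has_derivative (\<lambda>v. Diff (transition e d) (snd e p) (Diff (transition c e) (snd c p) v))) (at (snd c p))"
    by (rule transition_chain[OF inj inj open_overlap _ _ transition_has_derivative transition_has_derivative])
      (use assms in \<open>auto simp: charts_at_def\<close>)
  then show ?thesis using Diff_eq by metis
qed

lemma Diff_transition_self:
  assumes "c \<in> charts_at A p"
  shows "Diff (transition c c) (snd c p) v = v"
proof -
  have c: "c \<in> A" "p \<in> fst c" using assms by (auto simp: charts_at_def)
  have "open (snd c ` fst c)" using open_overlap[OF c(1) c(1)] by simp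
  then have "(transition c c has_derivative (\<lambda>v. v)) (at (snd c p))"
    by (rule has_derivative_transform_within_open[OF has_derivative_ident])
      (use c inj in \<open>auto simp: transition_apply\<close>)
  then show ?thesis using Diff_eq by metis
qed

lemma tangent_of_in_tangent_space:
  assumes "c \<in> charts_at A p"
  shows "tangent_of A p c u \<in> tangent_space A p"
proof (rule tangent_spaceI)
  show "tangent_of A p c u d' = Diff (transition d d') (snd d p) (tangent_of A p c u d)"
    if "d \<in> charts_at A p" "d' \<in> charts_at A p" for d d'
    using Diff_transition_chain[OF assms that(2,1), of u] that by (simp add: tangent_of_def)
qed (simp add: tangent_of_def)

lemma tangent_of_same: "c \<in> charts_at A p \<Longrightarrow> tangent_of A p c u c = u"
  using Diff_transition_self by (simp add: tangent_of_def)

lemma tangent_of_coordinate: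
  assumes "v \<in> tangent_space A p" "c \<in> charts_at A p"
  shows "tangent_of A p c (v c) = v"
proof
  show "tangent_of A p c (v c) d = v d" for d
    using tangent_space_coordinates[OF assms, of d] tangent_space_outside[OF assms(1), of d]
    by (simp add: tangent_of_def)
qed

lemma linear_Diff_transition:
  "c \<in> charts_at A p \<Longrightarrow> d \<in> charts_at A p \<Longrightarrow> linear (Diff (transition c d) (snd c p))"
  using transition_has_derivative has_derivative_linear by blast

lemma tangent_of_add:
  assumes "c \<in> charts_at A p"
  shows "tangent_of A p c (u + v) = (\<lambda>d. tangent_of A p c u d + tangent_of A p c v d)"
  using linear_add[OF linear_Diff_transition[OF assms]] by (auto simp: tangent_of_def)

lemma tangent_of_scale:
  assumes "c \<in> charts_at A p"
  shows "tangent_of A p c (a *\<^sub>R u) = (\<lambda>d. a *\<^sub>R tangent_of A p c u d)"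
  using linear_scale[OF linear_Diff_transition[OF assms]] by (auto simp: tangent_of_def)

end

lemma inner_basis_sum: "(\<Sum>b\<in>B. a b *\<^sub>R b) \<bullet> u = (\<Sum>b\<in>B. (u \<bullet> b) * a b)"
  unfolding inner_sum_left by (intro sum.cong refl) (metis inner_commute inner_scaleR_left mult.commute)

text \<open>The model space has finite dimension by virtue of the orthonormal basis \<open>B\<close>, which is finite.\<close>

locale manifold =
  fixes X :: "'m topology" and A :: "('m, 'e::{real_inner, banach}) chart set" and B :: "'e set"
  assumes B: "orthonormal_basis B"
    and cover: "\<Union> (fst ` A) = topspace X" and maximal: "A = maximal_atlas X A"
begin

lemma chart: "c \<in> A \<Longrightarrow> is_chart X c" and compat: "c \<in> A \<Longrightarrow> d \<in> A \<Longrightarrow> compatible c d"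
  using maximal unfolding maximal_atlas_def by blast+

lemma chart_in_atlas: "is_chart X c \<Longrightarrow> (\<And>d. d \<in> A \<Longrightarrow> compatible c d) \<Longrightarrow> c \<in> A"
  using maximal unfolding maximal_atlas_def by blast

lemma chart_open: "c \<in> A \<Longrightarrow> openin X (fst c)" using chart by (simp add: is_chart_def)

lemma transition_smooth: "c \<in> A \<Longrightarrow> d \<in> A \<Longrightarrow> smooth_on (snd c ` (fst c \<inter> fst d)) (transition c d)"
  using compat by (simp add: compatible_def)

sublocale transition_family A
proof
  show "inj_on (snd c) (fst c)" if "c \<in> A" for c using is_chart_inj chart that by blast
  show "open (snd c ` (fst c \<inter> fst d))" if "c \<in> A" "d \<in> A" for c d
    using is_chart_open_image chart chart_open that by blast
  show "transition c d differentiable (at (snd c p))" if "c \<in> charts_at A p" "d \<in> charts_at A p" for c d p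
    using smooth_onD[OF transition_smooth[of c d], of "snd c p"] that
    by (auto simp: charts_at_def differentiable_def)
qed

lemma charts_at_exists: "p \<in> topspace X \<Longrightarrow> \<exists>c. c \<in> charts_at A p"
  unfolding charts_at_def cover[symmetric] by blast

lemma charts_at_topspace: "c \<in> charts_at A p \<Longrightarrow> p \<in> topspace X"
  using cover by (auto simp: charts_at_def)

text \<open>Composing a chart with a diffeomorphism of an open part of its image gives a chart of the same
  maximal atlas.\<close>

lemma straightened_chart:
  assumes c: "c \<in> A" and U: "open U" "U \<subseteq> snd c ` fst c" and \<kappa>: "smooth_on U \<kappa>"
    and g: "\<And>q. q \<in> U \<Longrightarrow> g (\<kappa> q) = q" "open (\<kappa> ` U)" "smooth_on (\<kappa> ` U) g"
  shows "({y \<in> fst c. snd c y \<in> U}, \<lambda>y. \<kappa> (snd c y)) \<in> A" (is "?c1 \<in> A")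
proof (rule chart_in_atlas)
  define U1 where "U1 = {y \<in> fst c. snd c y \<in> U}"
  define c1 where "c1 = (U1, \<lambda>y. \<kappa> (snd c y))"
  have c1: "?c1 = c1" by (simp add: c1_def U1_def)
  have f1: "fst c1 = U1" and s1: "snd c1 y = \<kappa> (snd c y)" for y by (simp_all add: c1_def)
  have U1: "openin X U1" unfolding U1_def by (rule is_chart_open_vimage[OF chart[OF c] U(1)])
  have U1c: "U1 \<subseteq> fst c" by (auto simp: U1_def)
  have im: "snd c ` U1 = U" using U(2) by (auto simp: U1_def)
  have im1: "snd c1 ` U1 = \<kappa> ` U" unfolding im[symmetric] by (auto simp: s1)
  have ch: "is_chart X c1"
    unfolding is_chart_def f1 im1
  proof (intro conjI U1 g(2))
    have h: "homeomorphic_map (subtopology X (fst c)) (top_of_set (snd c ` fst c)) (snd c)"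
      using chart[OF c] by (simp add: is_chart_def)
    have ts: "topspace (subtopology X (fst c)) = fst c"
      using openin_subset[OF chart_open[OF c]] by (rule topspace_subtopology_subset)
    have "snd c ` (topspace (subtopology X (fst c)) \<inter> U1) = topspace (top_of_set (snd c ` fst c)) \<inter> U"
    proof -
      have "fst c \<inter> U1 = U1" "snd c ` fst c \<inter> U = U" using U1c U(2) by blast+
      then show ?thesis by (simp only: ts im topspace_euclidean_subtopology)
    qed
    from homeomorphic_map_subtopologies[OF h this]
    have "homeomorphic_map (subtopology X (fst c \<inter> U1)) (top_of_set (snd c ` fst c \<inter> U)) (snd c)"
      by (simp add: subtopology_subtopology)
    moreover have "fst c \<inter> U1 = U1" "snd c ` fst c \<inter> U = U" using U1c U(2) by blast+
    ultimately have 1: "homeomorphic_map (subtopology X U1) (top_of_set U) (snd c)" by simp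
    have "homeomorphic_maps (top_of_set U) (top_of_set (\<kappa> ` U)) \<kappa> g"
      unfolding homeomorphic_maps_def
      using smooth_on_continuous[OF \<kappa>] smooth_on_continuous[OF g(3)] g(1) by auto
    then have 2: "homeomorphic_map (top_of_set U) (top_of_set (\<kappa> ` U)) \<kappa>" by (rule homeomorphic_maps_map[THEN iffD1, THEN conjunct1])
    have "snd c1 = \<kappa> \<circ> snd c" by (simp add: fun_eq_iff s1)
    then show "homeomorphic_map (subtopology X U1) (top_of_set (\<kappa> ` U)) (snd c1)"
      using homeomorphic_map_compose[OF 1 2] by simp
  qed
  then show "is_chart X ?c1" unfolding c1 .
  fix d assume d: "d \<in> A"
  have V: "open (snd c ` (U1 \<inter> fst d))"
  proof -
    have "fst c \<inter> (U1 \<inter> fst d) = U1 \<inter> fst d" using U1c by blast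
    then show ?thesis using is_chart_open_image[OF chart[OF c] openin_Int[OF U1 chart_open[OF d]]] by simp
  qed
  have Vsub: "snd c ` (U1 \<inter> fst d) \<subseteq> snd c ` (fst c \<inter> fst d)" "snd c ` (U1 \<inter> fst d) \<subseteq> U"
    using U1c im by blast+
  have img: "snd c1 ` (U1 \<inter> fst d) = \<kappa> ` (snd c ` (U1 \<inter> fst d))" by (auto simp: s1)
  have W: "open (snd c1 ` (U1 \<inter> fst d))"
  proof -
    have "\<kappa> ` (snd c ` (U1 \<inter> fst d)) = \<kappa> ` U \<inter> g -` (snd c ` (U1 \<inter> fst d))"
    proof (intro equalityI subsetI)
      fix z assume "z \<in> \<kappa> ` (snd c ` (U1 \<inter> fst d))"
      then obtain q where "q \<in> snd c ` (U1 \<inter> fst d)" "z = \<kappa> q" by blast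
      then show "z \<in> \<kappa> ` U \<inter> g -` (snd c ` (U1 \<inter> fst d))" using g(1)[of q] Vsub(2) by auto
    next
      fix z assume z: "z \<in> \<kappa> ` U \<inter> g -` (snd c ` (U1 \<inter> fst d))"
      then obtain q where "q \<in> U" "z = \<kappa> q" by blast
      then show "z \<in> \<kappa> ` (snd c ` (U1 \<inter> fst d))" using g(1)[of q] z by auto
    qed
    then show ?thesis
      unfolding img using continuous_open_preimage[OF smooth_on_continuous[OF g(3)] g(2) V] by simp
  qed
  have inj1: "inj_on (snd c1) (fst c1)" using is_chart_inj[OF ch] .
  show "compatible ?c1 d"
    unfolding c1 compatible_def f1
  proof
    show "smooth_on (snd c1 ` (U1 \<inter> fst d)) (transition c1 d)"
    proof (rule smooth_on_cong[OF _ W])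
      show "smooth_on (snd c1 ` (U1 \<inter> fst d)) (\<lambda>z. transition c d (g z))"
      proof (rule smooth_on_compose[OF B W open_overlap[OF c d] _ _ transition_smooth[OF c d]])
        show "g ` (snd c1 ` (U1 \<inter> fst d)) \<subseteq> snd c ` (fst c \<inter> fst d)"
        proof
          fix q assume "q \<in> g ` (snd c1 ` (U1 \<inter> fst d))"
          then obtain q' where "q' \<in> snd c ` (U1 \<inter> fst d)" "q = g (\<kappa> q')" unfolding img by blast
          then show "q \<in> snd c ` (fst c \<inter> fst d)" using g(1)[of q'] Vsub by auto
        qed
        have "snd c1 ` (U1 \<inter> fst d) \<subseteq> \<kappa> ` U" unfolding img by (rule image_mono[OF Vsub(2)])
        then show "smooth_on (snd c1 ` (U1 \<inter> fst d)) g" by (rule smooth_on_subset[OF g(3)])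
      qed
      fix z assume "z \<in> snd c1 ` (U1 \<inter> fst d)"
      then obtain y where y: "y \<in> U1" "z = snd c1 y" by blast
      then have "snd c y \<in> U" "y \<in> fst c" by (simp_all add: U1_def)
      then have "transition c d (g z) = snd d y" using transition_apply[OF inj[OF c], of y d] g(1) by (simp add: y s1)
      also have "snd d y = transition c1 d z" using transition_apply[OF inj1, of y d] y by (simp add: f1)
      finally show "transition c d (g z) = transition c1 d z" .
    qed
    have V': "open (snd d ` (U1 \<inter> fst d))"
      using is_chart_open_image[OF chart[OF d] U1] by (simp add: Int_commute)
    have tr: "transition d c (snd d y) = snd c y" if "y \<in> fst d" for y by (rule transition_apply[OF inj[OF d] that])
    show "smooth_on (snd d ` (U1 \<inter> fst d)) (transition d c1)"
    proof (rule smooth_on_cong[OF _ V'])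
      show "smooth_on (snd d ` (U1 \<inter> fst d)) (\<lambda>z. \<kappa> (transition d c z))"
      proof (rule smooth_on_compose[OF B V' U(1) _ _ \<kappa>])
        show "transition d c ` snd d ` (U1 \<inter> fst d) \<subseteq> U"
        proof
          fix q assume "q \<in> transition d c ` snd d ` (U1 \<inter> fst d)"
          then obtain y where y: "y \<in> U1" "y \<in> fst d" "q = transition d c (snd d y)" by blast
          then show "q \<in> U" using tr[OF y(2)] by (simp add: U1_def)
        qed
        show "smooth_on (snd d ` (U1 \<inter> fst d)) (transition d c)"
          by (rule smooth_on_subset[OF transition_smooth[OF d c]]) (use U1c in blast)
      qed
      fix z assume "z \<in> snd d ` (U1 \<inter> fst d)"
      then obtain y where y: "y \<in> fst d" "z = snd d y" by blast
      have "transition d c1 z = snd c1 y" unfolding y(2) by (rule transition_apply[OF inj[OF d] y(1)])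
      then show "\<kappa> (transition d c z) = transition d c1 z" unfolding y(2) tr[OF y(1)] by (simp add: s1)
    qed
  qed
qed

section \<open>Induced coordinates on the cotangent bundle\<close>

definition rep :: "('m, 'e) chart \<Rightarrow> ('m, 'e) covector \<Rightarrow> 'm \<Rightarrow> 'e" where
  "rep c \<xi> p = (THE g. \<forall>v\<in>tangent_space A p. \<xi> v = g \<bullet> v c)"

lemma rep_unique:
  assumes "c \<in> charts_at A p" "\<forall>v\<in>tangent_space A p. \<xi> v = g \<bullet> v c"
  shows "rep c \<xi> p = g"
  unfolding rep_def
proof (rule the_equality)
  fix g' assume g': "\<forall>v\<in>tangent_space A p. \<xi> v = g' \<bullet> v c"
  let ?v = "tangent_of A p c (g' - g)"
  have "g' \<bullet> ?v c = g \<bullet> ?v c"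
    using g' assms(2) tangent_of_in_tangent_space[OF assms(1), of "g' - g"] by metis
  then have "(g' - g) \<bullet> (g' - g) = 0" by (simp add: tangent_of_same[OF assms(1)] inner_diff_left)
  then show "g' = g" by simp
qed (rule assms(2))

text \<open>The Riesz representation, with the explicit vector \<open>\<Sum>b\<in>B. l b b\<close> for the functional \<open>l\<close> that \<open>\<xi>\<close>
  induces on coordinate vectors.\<close>

lemma rep:
  assumes c: "c \<in> charts_at A p" and \<xi>: "\<xi> \<in> cotangent_space A p" and v: "v \<in> tangent_space A p"
  shows "\<xi> v = rep c \<xi> p \<bullet> v c"
proof -
  define l where "l u = \<xi> (tangent_of A p c u)" for u
  have "linear l"
    using \<xi> tangent_of_in_tangent_space[OF c]
    by (intro linearI) (simp_all add: l_def tangent_of_add[OF c] tangent_of_scale[OF c] cotangent_space_def)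
  then have l: "l u = (\<Sum>b\<in>B. l b *\<^sub>R b) \<bullet> u" for u
    using orthonormal_basis_expand[OF B, of l u] by (simp add: inner_basis_sum)
  have *: "\<forall>v\<in>tangent_space A p. \<xi> v = (\<Sum>b\<in>B. l b *\<^sub>R b) \<bullet> v c"
  proof
    fix v assume "v \<in> tangent_space A p"
    then have "\<xi> v = l (v c)" using tangent_of_coordinate[OF _ c] by (simp add: l_def)
    also note l[of "v c"]
    finally show "\<xi> v = (\<Sum>b\<in>B. l b *\<^sub>R b) \<bullet> v c" .
  qed
  then show ?thesis unfolding rep_unique[OF c *] using v by blast
qed

definition covector_of :: "('m, 'e) chart \<Rightarrow> 'm \<Rightarrow> 'e \<Rightarrow> ('m, 'e) covector" where
  "covector_of c p g = (\<lambda>v. if v \<in> tangent_space A p then g \<bullet> v c else 0)"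

lemma tangent_space_add: "v \<in> tangent_space A p \<Longrightarrow> w \<in> tangent_space A p \<Longrightarrow> (\<lambda>c. v c + w c) \<in> tangent_space A p"
proof (rule tangent_spaceI)
  assume v: "v \<in> tangent_space A p" and w: "w \<in> tangent_space A p"
  show "v c + w c = 0" if "c \<notin> charts_at A p" for c
    using tangent_space_outside[OF v that] tangent_space_outside[OF w that] by simp
  show "v d + w d = Diff (transition c d) (snd c p) (v c + w c)" if cd: "c \<in> charts_at A p" "d \<in> charts_at A p" for c d
    unfolding linear_add[OF linear_Diff_transition[OF cd]]
    by (simp only: tangent_space_coordinates[OF v cd] tangent_space_coordinates[OF w cd])
qed

lemma tangent_space_scale: "v \<in> tangent_space A p \<Longrightarrow> (\<lambda>c. a *\<^sub>R v c) \<in> tangent_space A p"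
proof (rule tangent_spaceI)
  assume v: "v \<in> tangent_space A p"
  show "a *\<^sub>R v c = 0" if "c \<notin> charts_at A p" for c
    using tangent_space_outside[OF v that] by simp
  show "a *\<^sub>R v d = Diff (transition c d) (snd c p) (a *\<^sub>R v c)" if cd: "c \<in> charts_at A p" "d \<in> charts_at A p" for c d
    unfolding linear_scale[OF linear_Diff_transition[OF cd]]
    by (simp only: tangent_space_coordinates[OF v cd])
qed

lemma covector_of_in: "covector_of c p g \<in> cotangent_space A p"
  by (auto simp: cotangent_space_def covector_of_def tangent_space_add tangent_space_scale inner_add_right)

lemma rep_covector_of: "c \<in> charts_at A p \<Longrightarrow> rep c (covector_of c p g) p = g"
  by (rule rep_unique) (auto simp: covector_of_def)

lemma covector_of_rep:
  assumes "c \<in> charts_at A p" "\<xi> \<in> cotangent_space A p"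
  shows "covector_of c p (rep c \<xi> p) = \<xi>"
  using rep[OF assms] assms(2) by (auto simp: covector_of_def cotangent_space_def)

lemma covector_scale: "\<xi> \<in> cotangent_space A p \<Longrightarrow> (\<lambda>v. s * \<xi> v) \<in> cotangent_space A p"
  by (auto simp: cotangent_space_def algebra_simps)

lemma rep_scale:
  assumes "c \<in> charts_at A p" "\<xi> \<in> cotangent_space A p"
  shows "rep c (\<lambda>v. s * \<xi> v) p = s *\<^sub>R rep c \<xi> p"
  by (rule rep_unique[OF assms(1)]) (simp add: rep[OF assms])

text \<open>The fibre coordinates transform by the transpose of the derivative of the inverse transition. The
  formula is explicit, so that its continuity in the base point is visible.\<close>

lemma rep_change:
  assumes c: "c \<in> charts_at A p" and d: "d \<in> charts_at A p" and \<xi>: "\<xi> \<in> cotangent_space A p"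
  shows "rep d \<xi> p = (\<Sum>b\<in>B. (rep c \<xi> p \<bullet> Diff (transition d c) (snd d p) b) *\<^sub>R b)"
proof (rule rep_unique[OF d], intro ballI)
  fix v assume v: "v \<in> tangent_space A p"
  have "\<xi> v = rep c \<xi> p \<bullet> v c" by (rule rep[OF c \<xi> v])
  also have "v c = Diff (transition d c) (snd d p) (v d)" by (rule tangent_space_coordinates[OF v d c])
  also have "rep c \<xi> p \<bullet> \<dots> = (\<Sum>b\<in>B. (v d \<bullet> b) * (rep c \<xi> p \<bullet> Diff (transition d c) (snd d p) b))"
    using orthonormal_basis_expand[OF B linear_Diff_transition[OF d c], of "v d"] by (simp add: inner_sum_right)
  also have "\<dots> = (\<Sum>b\<in>B. (rep c \<xi> p \<bullet> Diff (transition d c) (snd d p) b) *\<^sub>R b) \<bullet> v d"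
    by (simp add: inner_basis_sum)
  finally show "\<xi> v = (\<Sum>b\<in>B. (rep c \<xi> p \<bullet> Diff (transition d c) (snd d p) b) *\<^sub>R b) \<bullet> v d" .
qed

text \<open>The induced chart of the cotangent bundle, and the topology and the smooth structure that the induced
  charts define. By definition every chart of the structure is compatible with the induced charts;
  the transitions between two charts of the structure are treated by passing through an induced one.\<close>

abbreviation CC where "CC \<equiv> cotangent_chart X A"
abbreviation TT where "TT \<equiv> cotangent_topology X A"
abbreviation TS where "TS \<equiv> cotangent_structure X A"

lemma fst_CC: "fst (CC c) = {x \<in> cotangent_bundle X A. fst x \<in> fst c}" by (simp add: cotangent_chart_def)

lemma snd_CC: "snd (CC c) (p, \<xi>) = (snd c p, rep c \<xi> p)" by (simp add: cotangent_chart_def rep_def)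

lemma fst_snd_CC: "fst (snd (CC c) x) = snd c (fst x)" by (cases x) (simp add: snd_CC)

lemma mem_fst_CC: "c \<in> A \<Longrightarrow> (p, \<xi>) \<in> fst (CC c) \<longleftrightarrow> c \<in> charts_at A p \<and> \<xi> \<in> cotangent_space A p"
  using charts_at_topspace[of c p] by (auto simp: fst_CC cotangent_bundle_def charts_at_def)

lemma inj_CC:
  assumes "c \<in> A" shows "inj_on (snd (CC c)) (fst (CC c))"
proof (rule inj_onI)
  fix x y assume x: "x \<in> fst (CC c)" and y: "y \<in> fst (CC c)" and eq: "snd (CC c) x = snd (CC c) y"
  obtain p \<xi> q \<eta> where xy: "x = (p, \<xi>)" "y = (q, \<eta>)" by (cases x, cases y)
  have p: "c \<in> charts_at A p" "\<xi> \<in> cotangent_space A p" and q: "c \<in> charts_at A q" "\<eta> \<in> cotangent_space A q"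
    using x y mem_fst_CC[OF assms] by (auto simp: xy)
  have "snd c p = snd c q" and r: "rep c \<xi> p = rep c \<eta> q" using eq by (auto simp: xy snd_CC)
  then have "p = q" using inj_onD[OF inj[OF assms], of p q] p(1) q(1) by (simp add: charts_at_def)
  have "\<xi> = covector_of c p (rep c \<xi> p)" using covector_of_rep[OF p] by (rule sym)
  also have "\<dots> = \<eta>" unfolding r unfolding \<open>p = q\<close> by (rule covector_of_rep[OF q])
  finally show "x = y" using \<open>p = q\<close> by (simp only: xy)
qed

lemma image_CC:
  assumes "c \<in> A"
  shows "snd (CC c) ` {x \<in> fst (CC c). fst x \<in> U} = snd c ` (fst c \<inter> U) \<times> UNIV"
proof (intro equalityI subsetI)
  fix z assume "z \<in> snd (CC c) ` {x \<in> fst (CC c). fst x \<in> U}"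
  then show "z \<in> snd c ` (fst c \<inter> U) \<times> UNIV" using fst_CC by (auto simp: snd_CC)
next
  fix z assume "z \<in> snd c ` (fst c \<inter> U) \<times> (UNIV :: 'e set)"
  then obtain p g where p: "p \<in> fst c" "p \<in> U" and z: "z = (snd c p, g)" by auto
  have c: "c \<in> charts_at A p" using p assms by (simp add: charts_at_def)
  have "(p, covector_of c p g) \<in> fst (CC c)" using mem_fst_CC[OF assms] c covector_of_in by blast
  then show "z \<in> snd (CC c) ` {x \<in> fst (CC c). fst x \<in> U}"
    using p by (intro image_eqI[of _ _ "(p, covector_of c p g)"]) (auto simp: snd_CC rep_covector_of[OF c] z)
qed

text \<open>In the induced coordinates of \<open>c\<close>, the basic open sets given by \<open>d\<close> are preimages under the
  continuous coordinate change \<open>f\<close>. This shows that induced charts are open maps.\<close>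

lemma open_CC_basis:
  assumes c: "c \<in> A" and d: "d \<in> A" and "open W"
  shows "open (snd (CC c) ` ({x \<in> fst (CC d). snd (CC d) x \<in> W} \<inter> fst (CC c)))"
proof -
  define D where "D = snd c ` (fst c \<inter> fst d) \<times> (UNIV :: 'e set)"
  define f where "f w = (transition c d (fst w), (\<Sum>b\<in>B. (snd w \<bullet> Diff (transition d c) (transition c d (fst w)) b) *\<^sub>R b))" for w
  have D: "open D" unfolding D_def by (intro open_Times open_overlap c d) simp
  have tcd: "continuous_on D (\<lambda>w. transition c d (fst w))"
    by (rule continuous_on_compose2[OF smooth_on_continuous[OF transition_smooth[OF c d]] continuous_on_fst[OF continuous_on_id]])
      (auto simp: D_def)
  have tdc: "continuous_on (snd d ` (fst d \<inter> fst c)) (\<lambda>z. Diff (transition d c) z b)" for b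
    by (rule smooth_on_continuous[OF smooth_on_Diff[OF transition_smooth[OF d c]]])
  have im: "transition c d (fst w) \<in> snd d ` (fst d \<inter> fst c)" if w: "w \<in> D" for w
  proof -
    obtain p where p: "p \<in> fst c \<inter> fst d" "fst w = snd c p" using w by (auto simp: D_def)
    then have "transition c d (fst w) = snd d p" using transition_apply[OF inj[OF c], of p d] by simp
    then show ?thesis using p by blast
  qed
  have "continuous_on D (\<lambda>w. Diff (transition d c) (transition c d (fst w)) b)" for b
    by (rule continuous_on_compose2[OF tdc tcd]) (use im in auto)
  then have f: "continuous_on D f"
    unfolding f_def by (intro continuous_intros tcd)
  have "snd (CC c) ` ({x \<in> fst (CC d). snd (CC d) x \<in> W} \<inter> fst (CC c)) = D \<inter> f -` W"
  proof -
    have fx: "f (snd (CC c) x) = snd (CC d) x" if x: "x \<in> fst (CC c)" "x \<in> fst (CC d)" for x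
    proof -
      obtain p \<xi> where p: "x = (p, \<xi>)" by (cases x)
      have c': "c \<in> charts_at A p" and d': "d \<in> charts_at A p" and \<xi>: "\<xi> \<in> cotangent_space A p"
        using x mem_fst_CC c d by (auto simp: p)
      have "transition c d (snd c p) = snd d p" using transition_apply[OF inj[OF c]] c' by (simp add: charts_at_def)
      then show ?thesis using rep_change[OF c' d' \<xi>] by (simp add: p snd_CC f_def)
    qed
    have D': "D = snd (CC c) ` (fst (CC c) \<inter> fst (CC d))"
    proof -
      have "fst (CC c) \<inter> fst (CC d) = {x \<in> fst (CC c). fst x \<in> fst d}" by (auto simp: fst_CC)
      then show ?thesis using image_CC[OF c, of "fst d"] by (simp add: D_def)
    qed
    show ?thesis
    proof (intro equalityI subsetI)
      fix z assume "z \<in> snd (CC c) ` ({x \<in> fst (CC d). snd (CC d) x \<in> W} \<inter> fst (CC c))"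
      then obtain x where x: "x \<in> fst (CC c)" "x \<in> fst (CC d)" "snd (CC d) x \<in> W" "z = snd (CC c) x" by blast
      then show "z \<in> D \<inter> f -` W" unfolding D' using fx[OF x(1,2)] by simp
    next
      fix z assume z: "z \<in> D \<inter> f -` W"
      then obtain x where x: "x \<in> fst (CC c)" "x \<in> fst (CC d)" "z = snd (CC c) x" unfolding D' by blast
      then have "snd (CC d) x \<in> W" using z fx[OF x(1,2)] by simp
      then show "z \<in> snd (CC c) ` ({x \<in> fst (CC d). snd (CC d) x \<in> W} \<inter> fst (CC c))" using x by blast
    qed
  qed
  then show ?thesis using continuous_open_preimage[OF f D \<open>open W\<close>] by simp
qed

lemma open_CC_image:
  assumes c: "c \<in> A" and "openin TT V"
  shows "open (snd (CC c) ` (V \<inter> fst (CC c)))"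
proof -
  let ?G = "{{x \<in> fst (CC d). snd (CC d) x \<in> W} | d W. d \<in> A \<and> open W}"
  have "generate_topology_on ?G V"
    using assms(2) by (simp add: cotangent_topology_def openin_topology_generated_by_iff)
  then show ?thesis
  proof (induction rule: generate_topology_on.induct)
    case Empty
    then show ?case by simp
  next
    case (Int a b)
    have "snd (CC c) ` (a \<inter> b \<inter> fst (CC c)) = snd (CC c) ` (a \<inter> fst (CC c)) \<inter> snd (CC c) ` (b \<inter> fst (CC c))"
    proof -
      have "a \<inter> b \<inter> fst (CC c) = (a \<inter> fst (CC c)) \<inter> (b \<inter> fst (CC c))" by blast
      then show ?thesis
        using inj_on_image_Int[OF inj_CC[OF c], of "a \<inter> fst (CC c)" "b \<inter> fst (CC c)"] by simp
    qed
    then show ?case using open_Int[OF Int.IH] by simp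
  next
    case (UN K)
    have "snd (CC c) ` (\<Union>K \<inter> fst (CC c)) = (\<Union>k\<in>K. snd (CC c) ` (k \<inter> fst (CC c)))" by blast
    moreover have "open (\<Union>k\<in>K. snd (CC c) ` (k \<inter> fst (CC c)))"
      by (rule open_UN) (use UN.IH in blast)
    ultimately show ?case by (simp only:)
  next
    case (Basis s)
    then obtain d W where dW: "d \<in> A" "open W" "s = {x \<in> fst (CC d). snd (CC d) x \<in> W}" by auto
    show ?case unfolding dW(3) by (rule open_CC_basis[OF c dW(1,2)])
  qed
qed

lemma openin_CC: "c \<in> A \<Longrightarrow> openin TT (fst (CC c))"
proof -
  assume "c \<in> A"
  moreover have "fst (CC c) = {x \<in> fst (CC c). snd (CC c) x \<in> UNIV}" by simp
  ultimately have "fst (CC c) \<in> {{x \<in> fst (CC d). snd (CC d) x \<in> W} | d W. d \<in> A \<and> open W}"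
    using open_UNIV by blast
  then show ?thesis unfolding cotangent_topology_def by (rule topology_generated_by_Basis)
qed

lemma topspace_TT: "topspace TT \<subseteq> cotangent_bundle X A"
  unfolding cotangent_topology_def topology_generated_by_topspace by (auto simp: fst_CC)

lemma TS_chart: "c \<in> TS \<Longrightarrow> is_chart TT c" and TS_compat: "c \<in> TS \<Longrightarrow> d \<in> A \<Longrightarrow> compatible c (CC d)"
  by (auto simp: cotangent_structure_def maximal_atlas_def)

lemma TS_subset: "c \<in> TS \<Longrightarrow> fst c \<subseteq> cotangent_bundle X A"
  using TS_chart topspace_TT openin_subset unfolding is_chart_def by blast

lemma TS_open: "c \<in> TS \<Longrightarrow> openin TT (fst c)" using TS_chart by (simp add: is_chart_def)

lemma TS_inj: "c \<in> TS \<Longrightarrow> inj_on (snd c) (fst c)" using TS_chart is_chart_inj by blast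

lemma TS_CC_smooth:
  assumes "c \<in> TS" "d \<in> A"
  shows "smooth_on (snd c ` (fst c \<inter> fst (CC d))) (transition c (CC d))"
    "smooth_on (snd (CC d) ` (fst c \<inter> fst (CC d))) (transition (CC d) c)"
  using TS_compat[OF assms] by (simp_all add: compatible_def)

lemma TS_CC_open:
  assumes "c \<in> TS" "d \<in> A"
  shows "open (snd c ` (fst c \<inter> fst (CC d)))" "open (snd (CC d) ` (fst c \<inter> fst (CC d)))"
  using is_chart_open_image[OF TS_chart[OF assms(1)] openin_CC[OF assms(2)]]
    open_CC_image[OF assms(2) TS_open[OF assms(1)]] by simp_all

lemma CC_exists:
  assumes "x \<in> cotangent_bundle X A"
  shows "\<exists>c\<in>A. x \<in> fst (CC c) \<and> c \<in> charts_at A (fst x)"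
proof -
  have "fst x \<in> topspace X" using assms by (auto simp: cotangent_bundle_def)
  then obtain c where "c \<in> charts_at A (fst x)" using charts_at_exists by blast
  then show ?thesis using assms by (intro bexI[of _ c]) (simp_all add: fst_CC charts_at_def)
qed

sublocale TS: transition_family TS
proof
  show "inj_on (snd c) (fst c)" if "c \<in> TS" for c using TS_inj that .
  show "open (snd c ` (fst c \<inter> fst d))" if "c \<in> TS" "d \<in> TS" for c d
    using is_chart_open_image TS_chart TS_open that by blast
  show "transition c d differentiable (at (snd c x))" if "c \<in> charts_at TS x" "d \<in> charts_at TS x" for c d x
  proof -
    have c: "c \<in> TS" "x \<in> fst c" and d: "d \<in> TS" "x \<in> fst d" using that by (auto simp: charts_at_def)
    obtain e where e: "e \<in> A" "x \<in> fst (CC e)" using CC_exists TS_subset[OF c(1)] c(2) by blast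
    have m: "snd c x \<in> snd c ` (fst c \<inter> fst (CC e))" "snd (CC e) x \<in> snd (CC e) ` (fst d \<inter> fst (CC e))"
      using c d e by auto
    have "(transition c d has_derivative (\<lambda>v. Diff (transition (CC e) d) (snd (CC e) x) (Diff (transition c (CC e)) (snd c x) v))) (at (snd c x))"
      by (rule transition_chain[OF TS_inj[OF c(1)] inj_CC[OF e(1)] TS_CC_open(1)[OF c(1) e(1)] c(2) e(2)
            smooth_onD[OF TS_CC_smooth(1)[OF c(1) e(1)] m(1)] smooth_onD[OF TS_CC_smooth(2)[OF d(1) e(1)] m(2)]])
    then show ?thesis by (auto simp: differentiable_def)
  qed
qed

section \<open>The Liouville form in induced coordinates\<close>

text \<open>The definition of the differential uses an arbitrary chart of the structure. The chain rule
  replaces it by the chart \<open>\<Phi>\<close> in which the tangent vector is given.\<close>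

lemma projection_differential:
  assumes \<Phi>: "\<Phi> \<in> charts_at TS x" and d: "d \<in> charts_at A (fst x)"
  shows "differential TS A fst x (tangent_of TS x \<Phi> u) d = fst (Diff (transition \<Phi> (CC d)) (snd \<Phi> x) u)"
proof -
  define c where "c = (SOME c. c \<in> charts_at TS x)"
  have c: "c \<in> charts_at TS x" unfolding c_def using \<Phi> by (rule someI)
  have cT: "c \<in> TS" "x \<in> fst c" and \<Phi>T: "\<Phi> \<in> TS" "x \<in> fst \<Phi>" and dA: "d \<in> A" "fst x \<in> fst d"
    using c \<Phi> d by (simp_all add: charts_at_def)
  have xd: "x \<in> fst (CC d)" using TS_subset[OF cT(1)] cT(2) dA by (auto simp: fst_CC)
  have eq: "snd d \<circ> fst \<circ> inv_into (fst c) (snd c) = (\<lambda>z. fst (transition c (CC d) z))"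
    by (simp add: fun_eq_iff transition_def fst_snd_CC)
  have D1: "(transition c (CC d) has_derivative Diff (transition c (CC d)) (snd c x)) (at (snd c x))"
    by (rule smooth_onD[OF TS_CC_smooth(1)[OF cT(1) dA(1)]]) (use cT xd in blast)
  have D2: "Diff (snd d \<circ> fst \<circ> inv_into (fst c) (snd c)) (snd c x) = (\<lambda>v. fst (Diff (transition c (CC d)) (snd c x) v))"
    unfolding eq by (rule Diff_eq[OF has_derivative_fst[OF D1]])
  have "(transition \<Phi> (CC d) has_derivative (\<lambda>v. Diff (transition c (CC d)) (snd c x) (Diff (transition \<Phi> c) (snd \<Phi> x) v))) (at (snd \<Phi> x))"
    by (rule transition_chain[OF TS_inj[OF \<Phi>T(1)] TS_inj[OF cT(1)] TS.open_overlap[OF \<Phi>T(1) cT(1)] \<Phi>T(2) cT(2)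
          TS.transition_has_derivative[OF \<Phi> c] D1])
  then have "Diff (transition \<Phi> (CC d)) (snd \<Phi> x) = (\<lambda>v. Diff (transition c (CC d)) (snd c x) (Diff (transition \<Phi> c) (snd \<Phi> x) v))"
    by (rule Diff_eq)
  then show ?thesis
    using d c by (simp add: differential_def Let_def c_def[symmetric] D2 tangent_of_def)
qed

lemma projection_differential_tangent:
  assumes \<Phi>: "\<Phi> \<in> charts_at TS x"
  shows "differential TS A fst x (tangent_of TS x \<Phi> u) \<in> tangent_space A (fst x)"
proof (rule tangent_spaceI)
  show "differential TS A fst x (tangent_of TS x \<Phi> u) d = 0" if "d \<notin> charts_at A (fst x)" for d
    using that by (simp add: differential_def)
  fix d d' assume d: "d \<in> charts_at A (fst x)" and d': "d' \<in> charts_at A (fst x)"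
  have \<Phi>T: "\<Phi> \<in> TS" "x \<in> fst \<Phi>" and dA: "d \<in> A" "fst x \<in> fst d" and dA': "d' \<in> A" "fst x \<in> fst d'"
    using \<Phi> d d' by (simp_all add: charts_at_def)
  have xd: "x \<in> fst (CC d)" and xd': "x \<in> fst (CC d')"
    using TS_subset[OF \<Phi>T(1)] \<Phi>T(2) dA dA' by (auto simp: fst_CC)
  have D: "((\<lambda>z. fst (transition \<Phi> (CC e) z)) has_derivative (\<lambda>v. fst (Diff (transition \<Phi> (CC e)) (snd \<Phi> x) v))) (at (snd \<Phi> x))"
    if "e \<in> A" "x \<in> fst (CC e)" for e
    by (rule has_derivative_fst, rule smooth_onD[OF TS_CC_smooth(1)[OF \<Phi>T(1) that(1)]]) (use \<Phi>T that in blast)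
  have px: "fst (transition \<Phi> (CC e) (snd \<Phi> y)) = snd e (fst y)" if "y \<in> fst \<Phi>" for e y
    using that TS_inj[OF \<Phi>T(1)] by (simp add: transition_apply fst_snd_CC)
  have "(transition d d' has_derivative Diff (transition d d') (snd d (fst x))) (at (fst (transition \<Phi> (CC d) (snd \<Phi> x))))"
    unfolding px[OF \<Phi>T(2)] by (rule transition_has_derivative[OF d d'])
  from has_derivative_compose[OF D[OF dA(1) xd] this]
  have "((\<lambda>z. fst (transition \<Phi> (CC d') z)) has_derivative
     (\<lambda>v. Diff (transition d d') (snd d (fst x)) (fst (Diff (transition \<Phi> (CC d)) (snd \<Phi> x) v)))) (at (snd \<Phi> x))"
  proof (rule has_derivative_transform_within_open[OF _ TS_CC_open(1)[OF \<Phi>T(1) dA(1)]])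
    show "snd \<Phi> x \<in> snd \<Phi> ` (fst \<Phi> \<inter> fst (CC d))" using \<Phi>T xd by blast
    fix z assume "z \<in> snd \<Phi> ` (fst \<Phi> \<inter> fst (CC d))"
    then obtain y where y: "y \<in> fst \<Phi>" "y \<in> fst (CC d)" "z = snd \<Phi> y" by blast
    then have "fst y \<in> fst d" by (simp add: fst_CC)
    then show "transition d d' (fst (transition \<Phi> (CC d) z)) = fst (transition \<Phi> (CC d') z)"
      unfolding y(3) px[OF y(1)] by (rule transition_apply[OF inj[OF dA(1)]])
  qed
  from has_derivative_unique[OF D[OF dA'(1) xd'] this]
  show "differential TS A fst x (tangent_of TS x \<Phi> u) d' =
      Diff (transition d d') (snd d (fst x)) (differential TS A fst x (tangent_of TS x \<Phi> u) d)"
    unfolding projection_differential[OF \<Phi> d] projection_differential[OF \<Phi> d'] by (rule fun_cong)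
qed

text \<open>This is \<open>\<theta> = y \<bullet> dq\<close> in the coordinates \<open>(q, y)\<close>.\<close>

lemma liouville_form_coordinates:
  assumes \<Phi>: "\<Phi> \<in> charts_at TS x" and c: "c \<in> charts_at A (fst x)"
  shows "liouville_form X A x (tangent_of TS x \<Phi> u) =
    snd (snd (CC c) x) \<bullet> fst (Diff (transition \<Phi> (CC c)) (snd \<Phi> x) u)"
proof -
  obtain p \<xi> where x: "x = (p, \<xi>)" by (cases x)
  have "x \<in> cotangent_bundle X A" using \<Phi> TS_subset[of \<Phi>] by (auto simp: charts_at_def)
  then have \<xi>: "\<xi> \<in> cotangent_space A p" by (simp add: x cotangent_bundle_def)
  have "\<xi> (differential TS A fst x (tangent_of TS x \<Phi> u)) = rep c \<xi> p \<bullet> differential TS A fst x (tangent_of TS x \<Phi> u) c"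
    by (rule rep) (use c \<xi> projection_differential_tangent[OF \<Phi>] in \<open>simp_all add: x\<close>)
  then show ?thesis unfolding liouville_form_def projection_differential[OF \<Phi> c] by (simp add: x snd_CC)
qed

lemma scaled_covector_CC:
  assumes "c \<in> A" "(p, \<xi>) \<in> fst (CC c)"
  shows "(p, \<lambda>v. s * \<xi> v) \<in> fst (CC c)" "snd (CC c) (p, \<lambda>v. s * \<xi> v) = (snd c p, s *\<^sub>R rep c \<xi> p)"
  using assms mem_fst_CC covector_scale rep_scale by (auto simp: snd_CC)

lemma zero_covector_CC:
  assumes "c \<in> charts_at A p"
  shows "(p, \<lambda>v. 0) \<in> fst (CC c)" "snd (CC c) (p, \<lambda>v. 0) = (snd c p, 0)"
proof -
  have c: "c \<in> A" using assms by (simp add: charts_at_def)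
  have "(p, covector_of c p 0) \<in> fst (CC c)" using mem_fst_CC[OF c] assms covector_of_in by blast
  from scaled_covector_CC[OF c this, of 0] show "(p, \<lambda>v. 0) \<in> fst (CC c)" "snd (CC c) (p, \<lambda>v. 0) = (snd c p, 0)"
    by simp_all
qed

end

section \<open>Submanifolds on which the Liouville form vanishes\<close>

locale theta_null_submanifold = manifold X A B
  for X :: "'m topology" and A :: "('m, 'e::{real_inner, banach}) chart set" and B :: "'e set" +
  fixes L :: "('m \<times> ('m, 'e) covector) set"
  assumes submanifold_L: "submanifold_of_dim (card B) TS L"
    and theta_null: "\<And>x \<zeta>. x \<in> L \<Longrightarrow> \<zeta> \<in> sub_tangent_space TS L x \<Longrightarrow> liouville_form X A x \<zeta> = 0"
begin

lemma L_bundle: "x \<in> L \<Longrightarrow> x \<in> cotangent_bundle X A"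
  using submanifold_L TS_subset unfolding submanifold_of_dim_def slice_chart_def charts_at_def by blast

text \<open>A slice chart of \<open>L\<close> and an induced chart, restricted to their common domain, form a coordinate model
  of \<open>L\<close>. A slice chart at \<open>x\<close> is also one at every other point of \<open>L\<close> in its domain, which gives the
  vanishing of \<open>\<theta>\<close> along the whole local model.\<close>

lemma local_model:
  assumes x: "x \<in> L" and c: "c \<in> charts_at A (fst x)"
  obtains S \<Omega> \<phi> \<psi> CF where "theta_null_chart B S \<Omega> \<phi> \<psi> CF" "S \<subseteq> snd (CC c) ` fst (CC c)" "snd (CC c) x \<in> S"
    "\<And>y. y \<in> fst (CC c) \<Longrightarrow> snd (CC c) y \<in> S \<Longrightarrow> y \<in> L \<longleftrightarrow> \<phi> (snd (CC c) y) \<in> span CF"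
proof -
  obtain \<Phi> F where slice: "slice_chart TS L x \<Phi> F" and dimF: "dim F = card B"
    using submanifold_L x unfolding submanifold_of_dim_def by blast
  have \<Phi>: "\<Phi> \<in> TS" "x \<in> fst \<Phi>" and F: "subspace F" "snd \<Phi> ` (fst \<Phi> \<inter> L) = snd \<Phi> ` fst \<Phi> \<inter> F"
    using slice by (simp_all add: slice_chart_def charts_at_def)
  have cA: "c \<in> A" using c by (simp add: charts_at_def)
  have xc: "x \<in> fst (CC c)" using L_bundle[OF x] c by (simp add: fst_CC charts_at_def)
  obtain CF where CF: "orthonormal_set CF" "span CF = F"
    using ex_orthonormal_subspace[OF orthonormal_basis_prod[OF B B] F(1)] by blast
  \<comment> \<open>half the dimension of the cotangent bundle, so that \<open>L\<close> will be Lagrangian\<close>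
  have "dim F = card CF"
    by (rule dim_eq_card[OF _ orthonormal_set_independent[OF CF(1)]]) (simp only: CF(2) span_eq_iff[THEN iffD2, OF F(1)])
  then have cardCF: "card CF = card B" using dimF by simp
  have L_iff: "y \<in> L \<longleftrightarrow> snd \<Phi> y \<in> F" if y: "y \<in> fst \<Phi>" for y
  proof
    assume "y \<in> L"
    then show "snd \<Phi> y \<in> F" using F(2) y by blast
  next
    assume "snd \<Phi> y \<in> F"
    then have "snd \<Phi> y \<in> snd \<Phi> ` (fst \<Phi> \<inter> L)" using F(2) y by blast
    then obtain y' where y': "y' \<in> fst \<Phi>" "y' \<in> L" "snd \<Phi> y = snd \<Phi> y'" by blast
    then have "y = y'" using inj_onD[OF TS_inj[OF \<Phi>(1)] y'(3) y y'(1)] by simp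
    then show "y \<in> L" using y'(2) by simp
  qed
  define O1 where "O1 = fst \<Phi> \<inter> fst (CC c)"
  show thesis
  proof (rule that[of "snd (CC c) ` O1" "snd \<Phi> ` O1" "transition (CC c) \<Phi>" "transition \<Phi> (CC c)" CF])
    have t1: "transition (CC c) \<Phi> (snd (CC c) y) = snd \<Phi> y" if "y \<in> O1" for y
      using transition_apply[OF inj_CC[OF cA]] that by (simp add: O1_def)
    have t2: "transition \<Phi> (CC c) (snd \<Phi> y) = snd (CC c) y" if "y \<in> O1" for y
      using transition_apply[OF TS_inj[OF \<Phi>(1)]] that by (simp add: O1_def)
    show "theta_null_chart B (snd (CC c) ` O1) (snd \<Phi> ` O1) (transition (CC c) \<Phi>) (transition \<Phi> (CC c)) CF"
    proof
      show "open (snd (CC c) ` O1)" "open (snd \<Phi> ` O1)" unfolding O1_def by (rule TS_CC_open[OF \<Phi>(1) cA])+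
      show "smooth_on (snd (CC c) ` O1) (transition (CC c) \<Phi>)" "smooth_on (snd \<Phi> ` O1) (transition \<Phi> (CC c))"
        unfolding O1_def by (rule TS_CC_smooth[OF \<Phi>(1) cA])+
      show "transition (CC c) \<Phi> z \<in> snd \<Phi> ` O1" "transition \<Phi> (CC c) (transition (CC c) \<Phi> z) = z"
        if z: "z \<in> snd (CC c) ` O1" for z using z t1 t2 by auto
      show "transition \<Phi> (CC c) z \<in> snd (CC c) ` O1" "transition (CC c) \<Phi> (transition \<Phi> (CC c) z) = z"
        if z: "z \<in> snd \<Phi> ` O1" for z using z t1 t2 by auto
      fix z u assume "z \<in> snd \<Phi> ` O1" "z \<in> span CF" and u: "u \<in> span CF"
      then obtain y where y: "y \<in> O1" "z = snd \<Phi> y" by blast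
      then have yL: "y \<in> L" using L_iff[of y] \<open>z \<in> span CF\<close> by (simp add: O1_def CF)
      have \<Phi>y: "\<Phi> \<in> charts_at TS y" using y \<Phi> by (simp add: O1_def charts_at_def)
      have cy: "c \<in> charts_at A (fst y)" using y cA by (simp add: O1_def charts_at_def fst_CC)
      have "slice_chart TS L y \<Phi> F" using \<Phi>y F by (simp add: slice_chart_def)
      then have "tangent_of TS y \<Phi> u \<in> sub_tangent_space TS L y"
        by (rule sub_tangent_spaceI[OF TS.tangent_of_in_tangent_space[OF \<Phi>y]])
          (use u CF(2) TS.tangent_of_same[OF \<Phi>y, of u] in simp)
      from theta_null[OF yL this]
      show "snd (transition \<Phi> (CC c) z) \<bullet> fst (Diff (transition \<Phi> (CC c)) z u) = 0"
        unfolding liouville_form_coordinates[OF \<Phi>y cy] y(2) t2[OF y(1)] .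
    qed (rule B CF cardCF)+
    show "snd (CC c) ` O1 \<subseteq> snd (CC c) ` fst (CC c)" by (auto simp: O1_def)
    show "snd (CC c) x \<in> snd (CC c) ` O1" using \<Phi> xc by (simp add: O1_def)
    fix y assume y: "y \<in> fst (CC c)" "snd (CC c) y \<in> snd (CC c) ` O1"
    then have yO: "y \<in> O1" using inj_onD[OF inj_CC[OF cA], of y] by (auto simp: O1_def)
    then show "y \<in> L \<longleftrightarrow> transition (CC c) \<Phi> (snd (CC c) y) \<in> span CF"
      using L_iff[of y] t1[OF yO] by (simp add: O1_def CF)
  qed
qed

lemma L_dilation_local:
  assumes "(p, \<xi>) \<in> L"
  shows "\<exists>e>0. \<forall>t. \<bar>t - 1\<bar> < e \<longrightarrow> (p, \<lambda>v. t * \<xi> v) \<in> L"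
proof -
  obtain c where cA: "c \<in> A" and pc: "(p, \<xi>) \<in> fst (CC c)" and c: "c \<in> charts_at A (fst (p, \<xi>))"
    using CC_exists[OF L_bundle[OF assms]] by blast
  obtain S \<Omega> \<phi> \<psi> CF where ex: "theta_null_chart B S \<Omega> \<phi> \<psi> CF" and SS: "S \<subseteq> snd (CC c) ` fst (CC c)" "snd (CC c) (p, \<xi>) \<in> S"
    and L: "\<And>y. y \<in> fst (CC c) \<Longrightarrow> snd (CC c) y \<in> S \<Longrightarrow> y \<in> L \<longleftrightarrow> \<phi> (snd (CC c) y) \<in> span CF"
    by (rule local_model[OF assms c], rule that)
  interpret theta_null_chart B S \<Omega> \<phi> \<psi> CF by (rule ex)
  have "snd (CC c) (p, \<xi>) \<in> Lam" using L[OF pc SS(2)] SS(2) assms by (simp add: Lam_def)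
  then have "(snd c p, rep c \<xi> p) \<in> Lam" by (simp add: snd_CC)
  then obtain e where e: "e > 0" "\<And>t. \<bar>t - 1\<bar> < e \<Longrightarrow> (snd c p, t *\<^sub>R rep c \<xi> p) \<in> Lam"
    using dilation_local by blast
  have "(p, \<lambda>v. t * \<xi> v) \<in> L" if "\<bar>t - 1\<bar> < e" for t
  proof -
    note sc = scaled_covector_CC[OF cA pc, of t]
    have "snd (CC c) (p, \<lambda>v. t * \<xi> v) \<in> Lam" unfolding sc(2) by (rule e(2)[OF that])
    then show ?thesis using L[OF sc(1)] by (simp add: Lam_def)
  qed
  then show ?thesis using e(1) by blast
qed

lemma fibre_continuous:
  assumes \<xi>: "\<xi> \<in> cotangent_space A p" and p: "p \<in> topspace X"
  shows "continuous_map euclideanreal TT (\<lambda>s. (p, \<lambda>v. s * \<xi> v))"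
  unfolding cotangent_topology_def continuous_on_generated_topo_iff
proof (intro conjI allI impI)
  fix U assume "U \<in> {{x \<in> fst (CC c). snd (CC c) x \<in> W} |c W. c \<in> A \<and> open W}"
  then obtain c W where cW: "c \<in> A" "open W" "U = {x \<in> fst (CC c). snd (CC c) x \<in> W}" by auto
  have "open ((\<lambda>s. (p, \<lambda>v. s * \<xi> v)) -` U)"
  proof (cases "c \<in> charts_at A p")
    case True
    then have "(p, \<xi>) \<in> fst (CC c)" using mem_fst_CC[OF cW(1)] \<xi> by simp
    then have "(\<lambda>s. (p, \<lambda>v. s * \<xi> v)) -` U = (\<lambda>s. (snd c p, s *\<^sub>R rep c \<xi> p)) -` W"
      using scaled_covector_CC[OF cW(1), of p \<xi>] by (auto simp: cW(3))
    moreover have "open ((\<lambda>s. (snd c p, s *\<^sub>R rep c \<xi> p)) -` W)"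
      by (rule open_vimage[OF cW(2)]) (intro continuous_intros)
    ultimately show ?thesis by simp
  next
    case False
    then have "(\<lambda>s. (p, \<lambda>v. s * \<xi> v)) -` U = {}" using mem_fst_CC[OF cW(1)] by (auto simp: cW(3))
    then show ?thesis by simp
  qed
  then show "openin euclideanreal ((\<lambda>s. (p, \<lambda>v. s * \<xi> v)) -` U \<inter> topspace euclideanreal)" by simp
next
  obtain c where c: "c \<in> charts_at A p" using charts_at_exists[OF p] by blast
  then have cA: "c \<in> A" by (simp add: charts_at_def)
  have "(p, \<lambda>v. s * \<xi> v) \<in> fst (CC c)" for s
    using scaled_covector_CC(1)[OF cA] mem_fst_CC[OF cA] c \<xi> by blast
  moreover have "fst (CC c) \<in> {{x \<in> fst (CC c). snd (CC c) x \<in> W} |c W. c \<in> A \<and> open W}"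
  proof -
    have "fst (CC c) = {x \<in> fst (CC c). snd (CC c) x \<in> UNIV}" by simp
    then show ?thesis using cA open_UNIV by blast
  qed
  ultimately show "(\<lambda>s. (p, \<lambda>v. s * \<xi> v)) ` topspace euclideanreal \<subseteq> \<Union> {{x \<in> fst (CC c). snd (CC c) x \<in> W} |c W. c \<in> A \<and> open W}"
    by blast
qed

text \<open>The set of factors \<open>s > 0\<close> that keep the covector in \<open>L\<close> is open by local invariance under dilations,
  and closed since \<open>L\<close> is closed. It contains \<open>1\<close>, so it contains all \<open>s > 0\<close>, and then \<open>s = 0\<close> too.\<close>

lemma L_conic:
  assumes closed: "closedin TT L" and x: "(p, \<xi>) \<in> L" and "s \<ge> 0"
  shows "(p, \<lambda>v. s * \<xi> v) \<in> L"
proof -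
  have \<xi>: "\<xi> \<in> cotangent_space A p" and p: "p \<in> topspace X" using L_bundle[OF x] by (auto simp: cotangent_bundle_def)
  define T where "T = {s. (p, \<lambda>v. s * \<xi> v) \<in> L}"
  have "closedin euclideanreal {s \<in> topspace euclideanreal. (p, \<lambda>v. s * \<xi> v) \<in> L}"
    by (rule closedin_continuous_map_preimage[OF fibre_continuous[OF \<xi> p] closed])
  then have T: "closed T" by (simp add: T_def)
  have sub: "{0<..} \<subseteq> T"
  proof (rule multiplicative_continuation[of _ 1])
    show "closedin (top_of_set {0<..}) (T \<inter> {0<..})"
      using closedin_closed_Int[OF T, of "{0<..}"] by (simp add: Int_commute)
    show "1 \<in> T" using x by (simp add: T_def)
    fix r assume "r \<in> T"
    then have "(p, \<lambda>v. r * \<xi> v) \<in> L" by (simp add: T_def)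
    from L_dilation_local[OF this] show "\<exists>e>0. \<forall>t. \<bar>t - 1\<bar> < e \<longrightarrow> t * r \<in> T"
      by (simp add: T_def mult.assoc)
  qed auto
  then have "closure {0<..} \<subseteq> T" using T by (rule closure_minimal)
  then show ?thesis using \<open>s \<ge> 0\<close> by (auto simp: T_def)
qed

definition R where "R = fst ` (L \<inter> zero_section X)"

lemma mem_R: "p \<in> R \<longleftrightarrow> (p, \<lambda>v. 0) \<in> L"
  using L_bundle by (force simp: R_def zero_section_def cotangent_bundle_def)

lemma zero_model:
  assumes p: "p \<in> R" and c: "c \<in> charts_at A p"
  obtains S \<Omega> \<phi> \<psi> CF CH where "theta_null_chart_at_zero B S \<Omega> \<phi> \<psi> CF (snd c p) CH" "S \<subseteq> snd (CC c) ` fst (CC c)"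
    "\<And>y. y \<in> fst (CC c) \<Longrightarrow> snd (CC c) y \<in> S \<Longrightarrow> y \<in> L \<longleftrightarrow> \<phi> (snd (CC c) y) \<in> span CF"
proof -
  have x: "(p, \<lambda>v. 0) \<in> L" using p by (simp add: mem_R)
  have c': "c \<in> charts_at A (fst (p, \<lambda>v. 0))" using c by simp
  obtain S \<Omega> \<phi> \<psi> CF where ex: "theta_null_chart B S \<Omega> \<phi> \<psi> CF" and SS: "S \<subseteq> snd (CC c) ` fst (CC c)" "snd (CC c) (p, \<lambda>v. 0) \<in> S"
    and L: "\<And>y. y \<in> fst (CC c) \<Longrightarrow> snd (CC c) y \<in> S \<Longrightarrow> y \<in> L \<longleftrightarrow> \<phi> (snd (CC c) y) \<in> span CF"
    by (rule local_model[OF x c'], rule that)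
  interpret theta_null_chart B S \<Omega> \<phi> \<psi> CF by (rule ex)
  note z = zero_covector_CC[OF c]
  have zero: "(snd c p, 0) \<in> Lam" using L[OF z(1)] SS(2) x by (simp add: Lam_def z(2))
  have "subspace {h. (h, 0) \<in> Tan (snd c p, 0)}"
  proof -
    have "linear (\<lambda>h::'e. (h, 0::'e))" by (auto intro!: linearI)
    from linear_subspace_vimage[OF this subspace_Tan[OF Lam_in_S[OF zero]]] show ?thesis by (simp add: vimage_def)
  qed
  then obtain CH where CH: "orthonormal_set CH" "span CH = {h. (h, 0) \<in> Tan (snd c p, 0)}"
    using ex_orthonormal_subspace[OF B] by blast
  have "theta_null_chart_at_zero B S \<Omega> \<phi> \<psi> CF (snd c p) CH"
    by unfold_locales (rule zero CH)+
  then show thesis using SS(1) L by (rule that)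
qed

text \<open>The straightening map \<open>\<kappa>\<close> of the local model turns \<open>c\<close> into a slice chart \<open>c1\<close> of \<open>R\<close>. Since \<open>\<kappa>\<close> has
  derivative the identity at the point, tangent vectors have the same coordinates in both charts, and
  those tangent to \<open>R\<close> at \<open>p\<close> include all vectors with coordinates in \<open>span CH\<close>.\<close>

lemma R_slice:
  assumes p: "p \<in> R" and c: "c \<in> charts_at A p"
  obtains S \<Omega> \<phi> \<psi> CF CH c1 where "theta_null_chart_at_zero B S \<Omega> \<phi> \<psi> CF (snd c p) CH" "S \<subseteq> snd (CC c) ` fst (CC c)"
    "\<And>y. y \<in> fst (CC c) \<Longrightarrow> snd (CC c) y \<in> S \<Longrightarrow> y \<in> L \<longleftrightarrow> \<phi> (snd (CC c) y) \<in> span CF"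
    "slice_chart A R p c1 (span CH)" "\<And>v. v \<in> tangent_space A p \<Longrightarrow> v c1 = v c"
proof -
  have cA: "c \<in> A" "p \<in> fst c" using c by (simp_all add: charts_at_def)
  obtain S \<Omega> \<phi> \<psi> CF CH where ex: "theta_null_chart_at_zero B S \<Omega> \<phi> \<psi> CF (snd c p) CH" and SS: "S \<subseteq> snd (CC c) ` fst (CC c)"
    and L: "\<And>y. y \<in> fst (CC c) \<Longrightarrow> snd (CC c) y \<in> S \<Longrightarrow> y \<in> L \<longleftrightarrow> \<phi> (snd (CC c) y) \<in> span CF"
    by (rule zero_model[OF p c], rule that)
  interpret theta_null_chart_at_zero B S \<Omega> \<phi> \<psi> CF "snd c p" CH by (rule ex)
  obtain U \<kappa> g where U: "open U" "snd c p \<in> U" "\<And>q. q \<in> U \<Longrightarrow> (q, 0) \<in> S" and \<kappa>: "smooth_on U \<kappa>"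
    and g: "\<And>q. q \<in> U \<Longrightarrow> g (\<kappa> q) = q" "open (\<kappa> ` U)" "smooth_on (\<kappa> ` U) g"
    and D: "(\<kappa> has_derivative (\<lambda>h. h)) (at (snd c p))"
    and slice: "\<kappa> ` {q \<in> U. (q, 0) \<in> Lam} = \<kappa> ` U \<inter> span CH"
    by (rule zero_section_slice, rule that)
  have Usub: "U \<subseteq> snd c ` fst c"
  proof
    fix q assume "q \<in> U"
    then obtain y where y: "y \<in> fst (CC c)" "(q, 0) = snd (CC c) y" using U(3) SS by blast
    then have "q = snd c (fst y)" using fst_snd_CC[of c y] by (metis fst_conv)
    then show "q \<in> snd c ` fst c" using y(1) by (simp add: fst_CC)
  qed
  define U1 where "U1 = {y \<in> fst c. snd c y \<in> U}"
  define c1 where "c1 = (U1, \<lambda>y. \<kappa> (snd c y))"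
  have f1: "fst c1 = U1" and s1: "snd c1 y = \<kappa> (snd c y)" for y by (simp_all add: c1_def)
  have c1: "c1 \<in> A" unfolding c1_def U1_def by (rule straightened_chart[OF cA(1) U(1) Usub \<kappa> g])
  have c1p: "c1 \<in> charts_at A p" using c1 cA U(2) by (simp add: charts_at_def f1 U1_def)
  have R: "y \<in> R \<longleftrightarrow> (snd c y, 0) \<in> Lam" if y: "y \<in> U1" for y
  proof -
    have cy: "c \<in> charts_at A y" and yU: "snd c y \<in> U" using y cA by (simp_all add: charts_at_def U1_def)
    note z = zero_covector_CC[OF cy]
    show ?thesis unfolding mem_R using L[OF z(1)] U(3)[OF yU] by (simp add: z(2) Lam_def)
  qed
  have im: "snd c ` U1 = U" using Usub by (auto simp: U1_def)
  have "slice_chart A R p c1 (span CH)"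
    unfolding slice_chart_def f1
  proof (intro conjI c1p subspace_span)
    have "snd c ` (U1 \<inter> R) = {q \<in> U. (q, 0) \<in> Lam}"
      unfolding im[symmetric] using R by blast
    then have "snd c1 ` (U1 \<inter> R) = \<kappa> ` {q \<in> U. (q, 0) \<in> Lam}" unfolding s1 image_image[symmetric] by simp
    moreover have "snd c1 ` U1 = \<kappa> ` U" unfolding s1 image_image[symmetric] im ..
    ultimately show "snd c1 ` (U1 \<inter> R) = snd c1 ` U1 \<inter> span CH" using slice by simp
  qed
  moreover have "v c1 = v c" if v: "v \<in> tangent_space A p" for v
  proof -
    have "(transition c c1 has_derivative (\<lambda>h. h)) (at (snd c p))"
    proof (rule has_derivative_transform_within_open[OF D U(1,2)])
      fix q assume "q \<in> U"
      then obtain y where y: "y \<in> fst c" "q = snd c y" using Usub by blast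
      show "\<kappa> q = transition c c1 q" unfolding y(2) transition_apply[OF inj[OF cA(1)] y(1)] s1 ..
    qed
    from Diff_eq[OF this] tangent_space_coordinates[OF v c c1p] show ?thesis by simp
  qed
  ultimately show thesis using ex SS L that by blast
qed

lemma submanifold_R: "submanifold A R"
  unfolding submanifold_def
proof
  fix p assume p: "p \<in> R"
  then have "(p, \<lambda>v. 0) \<in> L" by (simp add: mem_R)
  then have "p \<in> topspace X" using L_bundle by (auto simp: cotangent_bundle_def)
  then obtain c where c: "c \<in> charts_at A p" using charts_at_exists by blast
  show "\<exists>c F. slice_chart A R p c F"
    by (rule R_slice[OF p c]) (intro exI)
qed

text \<open>Both a tangent vector of \<open>R\<close> and the covector \<open>\<xi>\<close>, as a vertical vector, are tangent to \<open>L\<close> at the zero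
  covector over \<open>p\<close>: the former because \<open>R\<close> lies in \<open>L\<close>, the latter because \<open>L\<close> contains the ray through
  \<open>\<xi>\<close>. Their pairing is the symplectic form, which vanishes on tangent vectors of \<open>L\<close>.\<close>

lemma closed_L_in_conormal:
  assumes closed: "closedin TT L" and x: "(p, \<xi>) \<in> L"
  shows "(p, \<xi>) \<in> conormal_bundle X A R"
proof -
  have p: "p \<in> R" using L_conic[OF closed x, of 0] by (simp add: mem_R)
  have bx: "(p, \<xi>) \<in> cotangent_bundle X A" by (rule L_bundle[OF x])
  then have \<xi>: "\<xi> \<in> cotangent_space A p" and pX: "p \<in> topspace X" by (auto simp: cotangent_bundle_def)
  obtain c where c: "c \<in> charts_at A p" using charts_at_exists[OF pX] by blast
  then have cA: "c \<in> A" "p \<in> fst c" by (simp_all add: charts_at_def)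
  have xc: "(p, \<xi>) \<in> fst (CC c)" using mem_fst_CC[OF cA(1)] c \<xi> by simp
  obtain S \<Omega> \<phi> \<psi> CF CH where ex: "theta_null_chart_at_zero B S \<Omega> \<phi> \<psi> CF (snd c p) CH" and SS: "S \<subseteq> snd (CC c) ` fst (CC c)"
    and L: "\<And>y. y \<in> fst (CC c) \<Longrightarrow> snd (CC c) y \<in> S \<Longrightarrow> y \<in> L \<longleftrightarrow> \<phi> (snd (CC c) y) \<in> span CF"
    by (rule zero_model[OF p c], rule that)
  interpret theta_null_chart_at_zero B S \<Omega> \<phi> \<psi> CF "snd c p" CH by (rule ex)
  define y where "y = rep c \<xi> p"
  have vert: "(0, y) \<in> Tan (snd c p, 0)"
  proof (rule fibre_Tan)
    have n: "norm y + 1 > 0" using norm_ge_zero[of y] by linarith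
    show "r0 / (norm y + 1) > 0" by (rule divide_pos_pos[OF r0 n])
    fix t :: real assume t: "0 \<le> t" "t < r0 / (norm y + 1)"
    have "t * (norm y + 1) < r0" using t(2) n by (simp add: pos_less_divide_eq)
    then have "norm (t *\<^sub>R y) < r0" using t(1) by (simp add: distrib_left)
    then have "(snd c p, t *\<^sub>R y) \<in> S" using r0 by (intro r0_box) simp_all
    moreover note sc = scaled_covector_CC[OF cA(1) xc, of t]
    ultimately show "(snd c p, t *\<^sub>R y) \<in> Lam"
      using L[OF sc(1)] L_conic[OF closed x t(1)] by (simp add: sc(2) Lam_def y_def)
  qed
  have "\<xi> v = 0" if v: "v \<in> sub_tangent_space A R p" for v
  proof -
    obtain d F where vT: "v \<in> tangent_space A p" and slice: "slice_chart A R p d F" and vF: "v d \<in> F"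
      using v unfolding sub_tangent_space_def by blast
    have d: "d \<in> charts_at A p" and F: "subspace F" "snd d ` (fst d \<inter> R) = snd d ` fst d \<inter> F"
      using slice by (simp_all add: slice_chart_def)
    have dA: "d \<in> A" "p \<in> fst d" using d by (simp_all add: charts_at_def)
    have pF: "snd d p \<in> F" using F(2) dA p by blast
    \<comment> \<open>the curve in \<open>R\<close> that is a straight line in the slice chart \<open>d\<close>, seen in the chart \<open>c\<close>\<close>
    define \<gamma> where "\<gamma> t = transition d c (snd d p + t *\<^sub>R v d)" for t
    have line: "((\<lambda>t. snd d p + t *\<^sub>R v d) has_derivative (\<lambda>t. t *\<^sub>R v d)) (at 0)"
      by (auto intro!: derivative_eq_intros)
    have "(transition d c has_derivative Diff (transition d c) (snd d p)) (at (snd d p + 0 *\<^sub>R v d))"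
      using transition_has_derivative[OF d c] by simp
    from has_derivative_compose[OF line this]
    have "(\<gamma> has_derivative (\<lambda>t. Diff (transition d c) (snd d p) (t *\<^sub>R v d))) (at 0)"
      unfolding \<gamma>_def[abs_def] .
    moreover have "Diff (transition d c) (snd d p) (t *\<^sub>R v d) = t *\<^sub>R v c" for t
      unfolding linear_scale[OF linear_Diff_transition[OF d c]] tangent_space_coordinates[OF vT d c] ..
    ultimately have \<gamma>: "(\<gamma> has_derivative (\<lambda>t. t *\<^sub>R v c)) (at 0)" by simp
    have \<gamma>0: "\<gamma> 0 = snd c p" using transition_apply[OF inj[OF dA(1)] dA(2)] by (simp add: \<gamma>_def)
    have "\<forall>\<^sub>F t in nhds 0. snd d p + t *\<^sub>R v d \<in> snd d ` (fst d \<inter> fst c)"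
      by (rule isCont_eventually_nhds[OF has_derivative_continuous[OF line] open_overlap[OF dA(1) cA(1)]])
        (use dA cA in simp)
    moreover have "\<forall>\<^sub>F t in nhds 0. \<gamma> t \<in> ball (snd c p) r0"
      by (rule isCont_eventually_nhds[OF has_derivative_continuous[OF \<gamma>] open_ball]) (simp add: \<gamma>0 r0)
    ultimately have "\<forall>\<^sub>F t in nhds 0. snd d p + t *\<^sub>R v d \<in> snd d ` (fst d \<inter> fst c) \<and> \<gamma> t \<in> ball (snd c p) r0"
      by (rule eventually_conj)
    then obtain e where e: "e > 0" "\<And>t. dist t 0 < e \<Longrightarrow> snd d p + t *\<^sub>R v d \<in> snd d ` (fst d \<inter> fst c) \<and> \<gamma> t \<in> ball (snd c p) r0"
      unfolding eventually_nhds_metric by blast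
    have "(v c, 0) \<in> Tan (snd c p, 0)"
    proof (rule Tan_curve[where \<gamma> = "\<lambda>t. (\<gamma> t, 0)", OF _ zero_S _ e(1)])
      show "(\<gamma> 0, 0) = (snd c p, 0)" by (simp add: \<gamma>0)
      have "((\<lambda>t. (\<gamma> t, 0 :: 'e)) has_derivative (\<lambda>t. (t *\<^sub>R v c, 0))) (at 0)"
        by (intro has_derivative_Pair \<gamma> has_derivative_const)
      moreover have "(\<lambda>t. (t *\<^sub>R v c, 0 :: 'e)) = (\<lambda>t. t *\<^sub>R (v c, 0))" by (simp add: fun_eq_iff)
      ultimately show "((\<lambda>t. (\<gamma> t, 0 :: 'e)) has_vector_derivative (v c, 0)) (at 0 within {0..})"
        unfolding has_vector_derivative_def by (simp only: has_derivative_at_withinI)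
      fix t :: real assume t: "0 \<le> t" "t < e"
      then have "dist t 0 < e" by simp
      note e2 = e(2)[OF this]
      obtain y' where y': "y' \<in> fst d" "y' \<in> fst c" "snd d p + t *\<^sub>R v d = snd d y'" using e2 by blast
      have "snd d y' \<in> F" unfolding y'(3)[symmetric] by (intro subspace_add[OF F(1)] subspace_scale[OF F(1)] pF vF)
      then have "snd d y' \<in> snd d ` (fst d \<inter> R)" using F(2) y'(1) by blast
      then obtain y'' where y'': "y'' \<in> fst d" "y'' \<in> R" "snd d y' = snd d y''" by blast
      have "y' = y''" by (rule inj_onD[OF inj[OF dA(1)] y''(3) y'(1) y''(1)])
      then have "(y', \<lambda>v. 0) \<in> L" using y''(2) by (simp add: mem_R)
      moreover have gt: "\<gamma> t = snd c y'" unfolding \<gamma>_def y'(3) by (rule transition_apply[OF inj[OF dA(1)] y'(1)])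
      have "c \<in> charts_at A y'" using cA y' by (simp add: charts_at_def)
      note z = zero_covector_CC[OF this]
      have "(\<gamma> t, 0) \<in> S" using e2 r0 by (intro r0_box) (simp_all add: dist_commute)
      ultimately show "(\<gamma> t, 0) \<in> Lam" using L[OF z(1)] by (simp add: z(2) gt Lam_def)
    qed
    then have "v c \<in> span CH" by (simp add: CH)
    then have "v c \<bullet> y = 0" by (rule Tan_vertical_orthogonal[OF _ vert])
    then show ?thesis using rep[OF c \<xi> vT] by (simp add: y_def inner_commute)
  qed
  then show ?thesis using bx p by (simp add: conormal_bundle_def)
qed

text \<open>The local model puts a small positive multiple of the conormal covector into \<open>L\<close>; dilation gives the
  covector itself.\<close>

lemma conormal_in_closed_L:
  assumes closed: "closedin TT L" and x: "(p, \<xi>) \<in> conormal_bundle X A R"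
  shows "(p, \<xi>) \<in> L"
proof -
  have bx: "(p, \<xi>) \<in> cotangent_bundle X A" and p: "p \<in> R" and ann: "\<And>v. v \<in> sub_tangent_space A R p \<Longrightarrow> \<xi> v = 0"
    using x by (simp_all add: conormal_bundle_def)
  then have \<xi>: "\<xi> \<in> cotangent_space A p" and pX: "p \<in> topspace X" by (auto simp: cotangent_bundle_def)
  obtain c where c: "c \<in> charts_at A p" using charts_at_exists[OF pX] by blast
  then have cA: "c \<in> A" "p \<in> fst c" by (simp_all add: charts_at_def)
  have xc: "(p, \<xi>) \<in> fst (CC c)" using mem_fst_CC[OF cA(1)] c \<xi> by simp
  obtain S \<Omega> \<phi> \<psi> CF CH c1 where ex: "theta_null_chart_at_zero B S \<Omega> \<phi> \<psi> CF (snd c p) CH" and SS: "S \<subseteq> snd (CC c) ` fst (CC c)"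
    and L: "\<And>y. y \<in> fst (CC c) \<Longrightarrow> snd (CC c) y \<in> S \<Longrightarrow> y \<in> L \<longleftrightarrow> \<phi> (snd (CC c) y) \<in> span CF"
    and slice: "slice_chart A R p c1 (span CH)" and c1: "\<And>v. v \<in> tangent_space A p \<Longrightarrow> v c1 = v c"
    by (rule R_slice[OF p c], rule that)
  interpret theta_null_chart_at_zero B S \<Omega> \<phi> \<psi> CF "snd c p" CH by (rule ex)
  define y where "y = rep c \<xi> p"
  have "h \<bullet> y = 0" if h: "h \<in> span CH" for h
  proof -
    let ?v = "tangent_of A p c h"
    have v: "?v \<in> tangent_space A p" "?v c = h" by (rule tangent_of_in_tangent_space[OF c] tangent_of_same[OF c])+
    have "?v \<in> sub_tangent_space A R p" by (rule sub_tangent_spaceI[OF v(1) slice]) (simp add: c1[OF v(1)] v(2) h)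
    then have "\<xi> ?v = 0" by (rule ann)
    then show ?thesis using rep[OF c \<xi> v(1)] by (simp add: v(2) y_def inner_commute)
  qed
  then obtain s where s: "s > 0" "(snd c p, s *\<^sub>R y) \<in> Lam" using orthogonal_fibre_in_Lam by blast
  note sc = scaled_covector_CC[OF cA(1) xc, of s]
  have "(p, \<lambda>v. s * \<xi> v) \<in> L" using L[OF sc(1)] s(2) by (simp add: sc(2) Lam_def y_def)
  from L_conic[OF closed this, of "1 / s"] s(1) show ?thesis by simp
qed

end

lemma smooth_manifold_orthonormal_basis:
  fixes A :: "('m, 'e::real_inner) chart set"
  assumes "smooth_manifold n X A"
  shows "\<exists>B :: 'e set. orthonormal_basis B \<and> card B = n"
proof -
  obtain E :: "'e set" where E: "finite E" "independent E" "span E = UNIV" "card E = n"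
    using assms unfolding smooth_manifold_def by blast
  obtain B :: "'e set" where B: "orthonormal_basis B" using ex_orthonormal_basis[OF E(1,3)] by blast
  have ind: "independent B" by (rule orthonormal_set_independent) (use B in \<open>simp add: orthonormal_basis_def\<close>)
  have "card B \<le> card E" using independent_span_bound[OF E(1) ind] E(3) by simp
  moreover have "card E \<le> card B"
    using independent_span_bound[OF orthonormal_basis_finite[OF B] E(2)] B by (simp add: orthonormal_basis_def)
  ultimately show ?thesis using B E(4) by (intro exI[of _ B]) simp
qed

theorem proposition2p1:
  fixes X :: "'m topology"
    and A :: "('m, 'e::{real_inner, banach, heine_borel}) chart set"
    and L :: "('m \<times> ('m, 'e) covector) set"
    and n :: nat
  assumes "smooth_manifold n X A"
    and "submanifold_of_dim n (cotangent_structure X A) L"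
    and "\<forall>x\<in>L. \<forall>\<zeta>\<in>sub_tangent_space (cotangent_structure X A) L x. liouville_form X A x \<zeta> = 0"
  shows "let R = cotangent_proj ` (L \<inter> zero_section X) in
    submanifold A R \<and>
    (closedin (cotangent_topology X A) L \<longrightarrow> L = conormal_bundle X A R)"
proof -
  obtain B :: "'e set" where B: "orthonormal_basis B" "card B = n"
    using smooth_manifold_orthonormal_basis[OF assms(1)] by blast
  interpret theta_null_submanifold X A B L
  proof
    show "\<Union> (fst ` A) = topspace X" "A = maximal_atlas X A"
      using assms(1) unfolding smooth_manifold_def by blast+
    show "submanifold_of_dim (card B) (cotangent_structure X A) L" using assms(2) B(2) by simp
    show "liouville_form X A x \<zeta> = 0" if "x \<in> L" "\<zeta> \<in> sub_tangent_space (cotangent_structure X A) L x" for x \<zeta>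
      using assms(3) that by blast
  qed (rule B(1))
  have "L = conormal_bundle X A R" if "closedin (cotangent_topology X A) L"
    using closed_L_in_conormal[OF that] conormal_in_closed_L[OF that] by (intro equalityI subrelI)
  then show ?thesis using submanifold_R by (simp add: Let_def R_def)
qed

end
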